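(* Let each user $i\in[n]$ hold $X_i\in\{e_1,\dots,e_d\}$ (one-hot vectors in $\{0,1\}^d$) and let $\mu=\sum_{i=1}^nX_i$. Let $$t=\log\Big(\frac d\gamma\Big),\qquad w=\min\left(n,\ \frac{n\varepsilon}{\sqrt{\log(d/\gamma)\log(1/\delta)}}\right),$$ $$L=\left\lceil\frac{n\varepsilon^2}{wt\log(1/\delta)}\right\rceil+1,\qquad \theta=O\left(\min\left(\frac14,\ \sqrt{\frac{n\varepsilon^2}{wt\log(1/\delta)}}\right)\right).$$ Let $\hat\mu$ be the output of the noisy-sketch algorithm described in the context, run with these parameters. Then: - $\hat\mu$ satisfies $(O(\varepsilon),\delta)$-differential privacy and $\big(\alpha,\,O\big(\tfrac{\varepsilon^2\alpha}{\log(1/\delta)}\big)\big)$-Rényi differential privacy. - The communication complexity is $\tilde O\big(\min\big(n\varepsilon\log(1/\gamma),\,n\big)\big)$ bits per user. - With probability at least $1-\gamma$, $$\|\hat\mu-\mu\|_\infty=\max_{j\in[d]}|\mu_j-\hat\mu_j|\le\frac{4n}{w}+O\left(\frac{\sqrt{\log(d/\gamma)\log(1/\delta)}}{\varepsilon}\right)=O\left(\frac{\sqrt{\log(d/\gamma)\log(1/\delta)}}{\varepsilon}\right).$$ - By setting $\hat\mu_j=0$ for all $j\in[d]$ such that $\hat\mu_j=O\big(\tfrac{\log(d/\gamma)\log(1/\delta)}{\varepsilon}\big)$, the $\ell_2^2$ estimation error is bounded by $$O\left(\frac{n\log^2(d/\gamma)\log(1/\delta)}{\varepsilon^2}\ri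ght).$$
   Context: $[n]=\{1,\dots,n\}$; $\gamma$ is a failure probability and $\varepsilon,\delta$ are privacy parameters; $\tilde O$ hides logarithmic factors (such as $\log n$, $\log\lceil\varepsilon\rceil$ and $\log\log d$). Algorithm (inputs: users' data $X_1,\dots,X_n$, failure probability $\gamma$, sketch parameters $w,t$, binomial-mechanism parameters $L,\theta$). (1) The server generates i.i.d. count-sketch matrices $S_1,\dots,S_t\in\{-1,0,1\}^{w\times d}$ and broadcasts them to all users; here $w$ is a power of two. Each $S_j$ is built from pairwise independent hash functions $h_j:[d]\to[w]$ and $\sigma_j:[d]\to\{-1,+1\}$ by $(S_j)_{k,l}=\sigma_j(l)\,\mathbf 1\{h_j(l)=k\}$ for $k\in[w]$, $l\in[d]$. (2) For each $j\in[t]$, user $i$ computes $p_{ij}=\theta\sqrt w\,(H_wS_jX_i)+\tfrac12\in\mathbb R^w$, where $H_w\in\{-1/\sqrt w,1/\sqrt w\}^{w\times w}$ is the normalized Walsh–Hadamard matrix ($H_1=[1]$, $H_{2k}=\frac1{\sqrt2}\begin{bmatrix}H_k&H_k\\H_k&-H_k\end{bmatrix}$), and generates $Y_{ij}\sim\mathrm{Binom}(L,p_{ij})$ coordinate-wise. (3) The server aggregates the noisy reports $Y_{ij}$ over $i$ via a secure aggregation protocol (users add random masks in a finite group that cancel in the sum, so that the server learns only the sums $\sum_iY_{ij}$) and computes, for $j\in[t]$, $$\widehat{S_j\mu}=\frac1{\theta\sqrt w}\sum_{i=1}^nH_w\Big(\frac{Y_{ij}}L-\frac12\Big).$$ (4)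 The server outputs the coordinate-wise median $\hat\mu=\mathrm{median}\big(S_1^{\top}\widehat{S_1\mu},\dots,S_t^{\top}\widehat{S_t\mu}\big)$. The communication complexity is the number of bits each user sends when secure aggregation operates on vectors of length $wt$ with entries ranging up to $nL$, i.e. $wt\log(nL+1)$. Privacy. Datasets $(X_1,\dots,X_n)$ and $(X_1,\dots,X_i',\dots,X_n)$ that differ in the records of one user are neighboring. A randomized mechanism $M$ is $(\varepsilon,\delta)$-differentially private if $\Pr(M(x)\in\mathcal S)\le e^{\varepsilon}\Pr(M(x')\in\mathcal S)+\delta$ for all neighboring $x,x'$ and all $\mathcal S$ in the range of $M$. It is $(\alpha,\tau)$-Rényi differentially private if $D_\alpha(P_{M(x)},P_{M(x')})\le\tau$ for all neighboring $x,x'$, where $D_\alpha(P,Q)=\frac1{\alpha-1}\log\mathbb E_Q[(P(X)/Q(X))^\alpha]$ is the Rényi divergence, $\alpha>1$.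
   Formalization: O-constants depend on bounds γ₀,δ₀<1 for γ,δ, on κ, and on constants in θ≍min(…), θ≤1/4. DP assumes ε≤κ log(1/δ), the error bound ε≤κ√(log(d/γ)log(1/δ)), the ℓ₂² bound ε≤κ log(d/γ). w is rounded to a power of two, t up; Õ also hides log d, log(1/γ). *)

theory Defs
  imports "HOL-Probability.Probability" "Jordan_Normal_Form.Matrix"
begin

hide_type (open) Finite_Cartesian_Product.vec
hide_const (open) Finite_Cartesian_Product.vec Finite_Cartesian_Product.vec.vec_nth
  Finite_Cartesian_Product.mat Finite_Cartesian_Product.transpose
no_notation Finite_Cartesian_Product.vec.vec_nth (infixl \<open>$\<close> 90)
no_notation inner (infix \<open>\<bullet>\<close> 70)

text \<open>Indices are 0-based throughout: \<open>[n]\<close> is \<open>{..<n}\<close>. All logarithms are natural, except in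
  the bit count \<open>communication_bits\<close>.\<close>

section \<open>Datasets\<close>

definition one_hot_datasets :: "nat \<Rightarrow> nat \<Rightarrow> real vec list set" where
  "one_hot_datasets n d = {X. length X = n \<and> set X \<subseteq> unit_vec d ` {..<d}}"

definition histogram :: "nat \<Rightarrow> real vec list \<Rightarrow> real vec" where
  "histogram d X = vec d (\<lambda>l. \<Sum>i<length X. (X ! i) $ l)"

definition neighboring :: "'a list \<Rightarrow> 'a list \<Rightarrow> bool" where
  "neighboring X X' \<longleftrightarrow>
     length X = length X' \<and> (\<exists>i<length X. \<forall>k<length X. k \<noteq> i \<longrightarrow> X ! k = X' ! k)"

section \<open>Privacy\<close>

definition differentially_private ::
    "'a list set \<Rightarrow> ('a list \<Rightarrow> 'b pmf) \<Rightarrow> real \<Rightarrow> real \<Rightarrow> bool" where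
  "differentially_private D M \<epsilon> \<delta> \<longleftrightarrow>
     (\<forall>x\<in>D. \<forall>x'\<in>D. neighboring x x' \<longrightarrow>
        (\<forall>A. measure_pmf.prob (M x) A \<le> exp \<epsilon> * measure_pmf.prob (M x') A + \<delta>))"

definition renyi_divergence :: "real \<Rightarrow> 'b pmf \<Rightarrow> 'b pmf \<Rightarrow> real" where
  "renyi_divergence \<alpha> P Q =
     1 / (\<alpha> - 1) * ln (measure_pmf.expectation Q (\<lambda>x. (pmf P x / pmf Q x) powr \<alpha>))"

text \<open>The first two conjuncts exclude exactly the case of an infinite divergence, in which the
  real-valued \<open>renyi_divergence\<close> would be a junk value.\<close>

definition renyi_differentially_private ::
    "'a list set \<Rightarrow> ('a list \<Rightarrow> 'b pmf) \<Rightarrow> real \<Rightarrow> real \<Rightarrow> bool" where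
  "renyi_differentially_private D M \<alpha> \<tau> \<longleftrightarrow>
     (\<forall>x\<in>D. \<forall>x'\<in>D. neighboring x x' \<longrightarrow>
        set_pmf (M x) \<subseteq> set_pmf (M x') \<and>
        integrable (measure_pmf (M x')) (\<lambda>y. (pmf (M x) y / pmf (M x') y) powr \<alpha>) \<and>
        renyi_divergence \<alpha> (M x) (M x') \<le> \<tau>)"

section \<open>Count sketches\<close>

text \<open>A hash family is the distribution of a random hash function on \<open>[d]\<close> with values in \<open>B\<close>;
  the one-point clause is only needed to cover \<open>d = 1\<close>.\<close>

definition pairwise_independent :: "nat \<Rightarrow> 'b set \<Rightarrow> (nat \<Rightarrow> 'b) pmf \<Rightarrow> bool" where
  "pairwise_independent d B F \<longleftrightarrow>
     (\<forall>l<d. map_pmf (\<lambda>f. f l) F = pmf_of_set B) \<and>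
     (\<forall>l<d. \<forall>l'<d. l \<noteq> l' \<longrightarrow> map_pmf (\<lambda>f. (f l, f l')) F = pmf_of_set (B \<times> B))"

definition count_sketch :: "nat \<Rightarrow> nat \<Rightarrow> (nat \<Rightarrow> nat) \<times> (nat \<Rightarrow> real) \<Rightarrow> real mat" where
  "count_sketch w d = (\<lambda>(h, s). mat w d (\<lambda>(k, l). s l * of_bool (h l = k)))"

text \<open>\<open>hadamard q\<close> is the normalized Walsh--Hadamard matrix of size \<open>2 ^ q\<close>.\<close>

primrec hadamard :: "nat \<Rightarrow> real mat" where
  "hadamard 0 = 1\<^sub>m 1"
| "hadamard (Suc q) = (1 / sqrt 2) \<cdot>\<^sub>m
     four_block_mat (hadamard q) (hadamard q) (hadamard q) (- hadamard q)"

section \<open>The noisy sketch\<close>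

definition report_probs :: "nat \<Rightarrow> real \<Rightarrow> real mat \<Rightarrow> real vec \<Rightarrow> real vec" where
  "report_probs q \<theta> S x =
     (\<theta> * sqrt (2 ^ q)) \<cdot>\<^sub>v (hadamard q *\<^sub>v (S *\<^sub>v x)) + vec (2 ^ q) (\<lambda>_. 1 / 2)"

definition user_report :: "nat \<Rightarrow> nat \<Rightarrow> real \<Rightarrow> real mat \<Rightarrow> real vec \<Rightarrow> nat vec pmf" where
  "user_report q L \<theta> S x =
     map_pmf (vec (2 ^ q))
       (Pi_pmf {..<2 ^ q} 0 (\<lambda>k. binomial_pmf L (report_probs q \<theta> S x $ k)))"

text \<open>The sketch estimate depends on the reports \<open>y i\<close> of the \<open>n\<close> users only through their sum,
  which is all that secure aggregation reveals.\<close>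

definition sketch_estimate :: "nat \<Rightarrow> nat \<Rightarrow> nat \<Rightarrow> real \<Rightarrow> (nat \<Rightarrow> nat vec) \<Rightarrow> real vec" where
  "sketch_estimate n q L \<theta> y =
     (1 / (\<theta> * sqrt (2 ^ q))) \<cdot>\<^sub>v
       vec (2 ^ q) (\<lambda>k. \<Sum>i<n.
         (hadamard q *\<^sub>v vec (2 ^ q) (\<lambda>m. real (y i $ m) / real L - 1 / 2)) $ k)"

definition median :: "real list \<Rightarrow> real" where
  "median xs = (let ys = sort xs; m = length xs in (ys ! ((m - 1) div 2) + ys ! (m div 2)) / 2)"

definition noisy_sketch ::
    "nat \<Rightarrow> (nat \<Rightarrow> nat) pmf \<Rightarrow> (nat \<Rightarrow> real) pmf \<Rightarrow> nat \<Rightarrow> nat \<Rightarrow> nat \<Rightarrow> real \<Rightarrow>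
     real vec list \<Rightarrow> real vec pmf" where
  "noisy_sketch d H \<Sigma> q t L \<theta> X =
     do {
       hs \<leftarrow> replicate_pmf t (pair_pmf H \<Sigma>);
       let S = (\<lambda>j. count_sketch (2 ^ q) d (hs ! j));
       Y \<leftarrow> Pi_pmf ({..<length X} \<times> {..<t}) (0\<^sub>v 0)
              (\<lambda>(i, j). user_report q L \<theta> (S j) (X ! i));
       let est = (\<lambda>j. sketch_estimate (length X) q L \<theta> (\<lambda>i. Y (i, j)));
       return_pmf (vec d (\<lambda>l.
         median (map (\<lambda>j. (transpose_mat (S j) *\<^sub>v est j) $ l) [0..<t])))
     }"

definition communication_bits :: "nat \<Rightarrow> nat \<Rightarrow> nat \<Rightarrow> nat \<Rightarrow> real" where
  "communication_bits n w t L = real w * real t * log 2 (real n * real L + 1)"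

definition linf_norm :: "real vec \<Rightarrow> real" where
  "linf_norm v = Max ((\<lambda>l. \<bar>v $ l\<bar>) ` {..<dim_vec v})"

definition l2_norm_sq :: "real vec \<Rightarrow> real" where
  "l2_norm_sq v = (\<Sum>l<dim_vec v. (v $ l)\<^sup>2)"

definition zero_small :: "real \<Rightarrow> real vec \<Rightarrow> real vec" where
  "zero_small \<tau> v = vec (dim_vec v) (\<lambda>l. if \<bar>v $ l\<bar> \<le> \<tau> then 0 else v $ l)"

section \<open>Parameters\<close>

definition target_width :: "nat \<Rightarrow> nat \<Rightarrow> real \<Rightarrow> real \<Rightarrow> real \<Rightarrow> real" where
  "target_width n d \<epsilon> \<delta> \<gamma> =
     min (real n) (real n * \<epsilon> / sqrt (ln (real d / \<gamma>) * ln (1 / \<delta>)))"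

text \<open>\<open>2 ^ q\<close> is \<open>W\<close> rounded down or up to a power of two (and equal to \<open>W\<close> if \<open>W\<close> is one). No
  such \<open>q\<close> exists if \<open>W \<le> 1 / 2\<close>.\<close>

definition rounds_to_power_of_two :: "real \<Rightarrow> nat \<Rightarrow> bool" where
  "rounds_to_power_of_two W q \<longleftrightarrow> W / 2 < 2 ^ q \<and> 2 ^ q < 2 * W"

definition noise_ratio :: "nat \<Rightarrow> nat \<Rightarrow> nat \<Rightarrow> real \<Rightarrow> real \<Rightarrow> real" where
  "noise_ratio n w t \<epsilon> \<delta> = real n * \<epsilon>\<^sup>2 / (real w * real t * ln (1 / \<delta>))"

text \<open>The argument of the hidden polylogarithmic factor of a soft-O bound. Both \<open>d\<close> and \<open>1 / \<gamma>\<close>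
  have to be included: \<open>w * t\<close> contains a factor \<open>t \<ge> ln (d / \<gamma>)\<close>.\<close>

definition log_factor :: "nat \<Rightarrow> nat \<Rightarrow> real \<Rightarrow> real \<Rightarrow> real" where
  "log_factor n d \<epsilon> \<gamma> =
     1 + ln (real n) + ln (of_int \<lceil>\<epsilon>\<rceil>) + ln (real d) + ln (1 / \<gamma>)"

end

(*
  Privacy. Given the sketches, the reports enter the output only through their sums, one per bucket. Such a
  sum counts the heads among n L independent coins of bias 1/2 + theta or 1/2 - theta, and changing one user
  flips the bias of L of these coins. By log-concavity, the conditional probability that a given coin
  shows heads increases by O(1/(n L)) when the total increases by one, so flipping one bias gives a likelihood
  ratio whose logarithm is Lipschitz with constant O(theta/(n L)) in the total; for L biases the constant
  is O(theta/n). Peeling off the coins one at a time with Hoeffding's lemma turns this into a Renyi bound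
  O(alpha theta^2 L / n) for every order alpha > 1.

  Accuracy. A row of the sketch errs by O(n/w) plus O(1) standard deviations of the noise except with
  probability 1/36 (Markov and Chebyshev), and then a majority of bad rows has probability at most
  3^(-t) <= gamma/d. Since the number of rows leaves no room for the constant 4 in 4n/w, the excess O(n/w) is
  absorbed into the noise term.
*)
theory Submission
  imports Defs
begin

section \<open>Expectations over discrete distributions\<close>

text \<open>The obstacle on the privacy side is to gain a factor 1/n from the coins of the other
  users: seen in isolation, the flipped coins of one user would cost order \<alpha> \<theta>^2 L in
  each bucket. Log-concavity alone only says that a Turan determinant r(z)^2 - r(z-1) r(z+1) is
  nonnegative. The quantitative bound comes from an exact identity: the product of two consecutive
  masses of a coin law is p (1 - p) times a sum of Turan determinants of laws with one coin removed,
  one summand per coin. Determinants of laws that differ in one bias are comparable, so each of them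
  is smaller than the product by the order of the number of coins. Flipping one bias changes
  likelihood ratios by exactly 2 \<theta> times such a determinant. The parameters make \<theta>^2 L
  comparable to n \<epsilon>^2 / (w t ln (1/\<delta>)), so the cost summed over the w t buckets is
  of order \<alpha> \<epsilon>^2 / ln (1/\<delta>) whatever w and t are. Approximate privacy is then
  read off at the order \<alpha> = 1 + ln (1/\<delta>) / \<epsilon>.\<close>

lemma integrable_pmf_bounded:
  fixes f :: "'a \<Rightarrow> real"
  assumes "\<And>x. x \<in> set_pmf P \<Longrightarrow> \<bar>f x\<bar> \<le> B"
  shows "integrable (measure_pmf P) f"
  by (rule measure_pmf.integrable_const_bound[where B = B]) (use assms in \<open>auto simp: AE_measure_pmf_iff\<close>)

lemma expectation_bind_pmf:
  fixes f :: "'b \<Rightarrow> real"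
  assumes "\<And>y. 0 \<le> f y" "\<And>y. f y \<le> B"
  shows "measure_pmf.expectation (bind_pmf P F) f
    = measure_pmf.expectation P (\<lambda>x. measure_pmf.expectation (F x) f)"
proof -
  have *: "ennreal (measure_pmf.expectation Q f) = (\<integral>\<^sup>+y. ennreal (f y) \<partial>measure_pmf Q)" for Q
    using assms by (intro nn_integral_eq_integral[symmetric] integrable_pmf_bounded[where B = B]) auto
  have le: "measure_pmf.expectation Q f \<le> B" for Q
    using assms by (intro measure_pmf.integral_le_const integrable_pmf_bounded[where B = B]) auto
  have "ennreal (measure_pmf.expectation (bind_pmf P F) f)
      = (\<integral>\<^sup>+x. ennreal (measure_pmf.expectation (F x) f) \<partial>measure_pmf P)"
    by (simp add: *)
  also have "\<dots> = ennreal (measure_pmf.expectation P (\<lambda>x. measure_pmf.expectation (F x) f))"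
    using assms le by (intro nn_integral_eq_integral integrable_pmf_bounded[where B = B]) auto
  finally show ?thesis
    using assms by (simp add: integral_nonneg_AE)
qed

lemma expectation_density:
  fixes f g :: "'a \<Rightarrow> real"
  assumes "\<And>x. 0 \<le> f x" "\<And>x. pmf P x = f x * pmf Q x"
  shows "measure_pmf.expectation P g = measure_pmf.expectation Q (\<lambda>x. f x * g x)"
proof -
  have "measure_pmf.expectation P g = (\<integral>x. pmf P x *\<^sub>R g x \<partial>count_space UNIV)"
    unfolding measure_pmf_eq_density by (subst integral_density) auto
  also have "\<dots> = (\<integral>x. pmf Q x *\<^sub>R (f x * g x) \<partial>count_space UNIV)"
    by (simp add: assms mult_ac)
  also have "\<dots> = measure_pmf.expectation Q (\<lambda>x. f x * g x)"
    unfolding measure_pmf_eq_density by (subst integral_density) auto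
  finally show ?thesis .
qed

section \<open>Renyi bounds in dual form\<close>

text \<open>The bound \<open>E\<^sub>Q[(P/Q)\<^sup>\<alpha>] \<le> K\<^sup>\<alpha>\<close> is expressed by the Hoelder inequality that it is equivalent to. In
  this form it is preserved by mixtures and post-processing, without mentioning densities.\<close>

definition hoelder_dominated :: "real \<Rightarrow> real \<Rightarrow> 'a pmf \<Rightarrow> 'a pmf \<Rightarrow> bool" where
  "hoelder_dominated \<alpha> K P Q \<longleftrightarrow> (\<forall>g B. (\<forall>x. 0 \<le> g x \<and> g x \<le> B) \<longrightarrow>
     measure_pmf.expectation P g
       \<le> K * measure_pmf.expectation Q (\<lambda>x. g x powr (\<alpha> / (\<alpha> - 1))) powr ((\<alpha> - 1) / \<alpha>))"

lemma hoelder_dominatedD: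
  assumes "hoelder_dominated \<alpha> K P Q" "\<And>x. 0 \<le> g x" "\<And>x. g x \<le> B"
  shows "measure_pmf.expectation P g
       \<le> K * measure_pmf.expectation Q (\<lambda>x. g x powr (\<alpha> / (\<alpha> - 1))) powr ((\<alpha> - 1) / \<alpha>)"
  using assms unfolding hoelder_dominated_def by blast

lemma hoelder_dominated_mono:
  assumes "hoelder_dominated \<alpha> K P Q" "K \<le> K'"
  shows "hoelder_dominated \<alpha> K' P Q"
  unfolding hoelder_dominated_def
proof (intro allI impI)
  fix g :: "'a \<Rightarrow> real" and B
  assume g: "\<forall>x. 0 \<le> g x \<and> g x \<le> B"
  note hoelder_dominatedD[OF assms(1), of g B]
  also have "K * measure_pmf.expectation Q (\<lambda>x. g x powr (\<alpha> / (\<alpha> - 1))) powr ((\<alpha> - 1) / \<alpha>)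
    \<le> K' * measure_pmf.expectation Q (\<lambda>x. g x powr (\<alpha> / (\<alpha> - 1))) powr ((\<alpha> - 1) / \<alpha>)"
    using assms(2) by (intro mult_right_mono) auto
  finally show "measure_pmf.expectation P g
      \<le> K' * measure_pmf.expectation Q (\<lambda>x. g x powr (\<alpha> / (\<alpha> - 1))) powr ((\<alpha> - 1) / \<alpha>)"
    using g by auto
qed

text \<open>This is Hoelder's inequality for E_Q[f g], derived from Young's inequality after
  dividing f by K and g by a number m above its norm. The bound \<open>C\<close> makes the
  expectations exist.\<close>

lemma hoelder_dominated_density:
  assumes "1 < \<alpha>" "0 < K" and f: "\<And>x. 0 \<le> f x" "\<And>x. f x \<le> C" "\<And>x. pmf P x = f x * pmf Q x"
    and E: "measure_pmf.expectation Q (\<lambda>x. f x powr \<alpha>) \<le> K powr \<alpha>"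
  shows "hoelder_dominated \<alpha> K P Q"
  unfolding hoelder_dominated_def
proof (intro allI impI)
  fix g :: "'a \<Rightarrow> real" and B
  assume g: "\<forall>x. 0 \<le> g x \<and> g x \<le> B"
  define \<beta> where "\<beta> = \<alpha> / (\<alpha> - 1)"
  have \<beta>: "1 < \<beta>" "1 / \<alpha> + 1 / \<beta> = 1" "(\<alpha> - 1) / \<alpha> = 1 / \<beta>"
    using \<open>1 < \<alpha>\<close> by (auto simp: \<beta>_def field_simps)
  have C0: "0 \<le> C" using f(1,2) order_trans by blast
  have B0: "0 \<le> B" using g order_trans by blast
  have intf: "integrable (measure_pmf Q) (\<lambda>x. f x powr \<alpha>)"
    using f C0 \<open>1 < \<alpha>\<close> by (intro integrable_pmf_bounded[where B = "C powr \<alpha>"]) (auto intro!: powr_mono2)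
  have intg: "integrable (measure_pmf Q) (\<lambda>x. g x powr \<beta>)"
    using g B0 \<beta> by (intro integrable_pmf_bounded[where B = "B powr \<beta>"]) (auto intro!: powr_mono2)
  define G where "G = measure_pmf.expectation Q (\<lambda>x. g x powr \<beta>)"
  have G0: "0 \<le> G" by (simp add: G_def integral_nonneg_AE)
  \<comment> \<open>\<open>m\<close> stays strictly above the norm of \<open>g\<close>, so the
    normalisation makes sense even if that norm is 0; \<open>dense_ge\<close> lets \<open>m\<close>
    decrease to the norm afterwards.\<close>
  have "measure_pmf.expectation P g \<le> K * m" if m: "G powr (1 / \<beta>) < m" for m
  proof -
    have m0: "0 < m" using m powr_ge_zero[of G "1/\<beta>"] by linarith
    have "G = (G powr (1 / \<beta>)) powr \<beta>" using G0 \<beta> by (simp add: powr_powr)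
    also have "\<dots> \<le> m powr \<beta>" using m \<beta> by (intro powr_mono2) auto
    finally have Gm: "G \<le> m powr \<beta>" .
    have "measure_pmf.expectation P g / (K * m) = measure_pmf.expectation Q (\<lambda>x. f x * g x / (K * m))"
      by (simp add: expectation_density[OF f(1,3)])
    also have "\<dots> \<le> measure_pmf.expectation Q (\<lambda>x. f x powr \<alpha> / (K powr \<alpha> * \<alpha>) + g x powr \<beta> / (m powr \<beta> * \<beta>))"
    proof (rule integral_mono)
      show "integrable (measure_pmf Q) (\<lambda>x. f x * g x / (K * m))"
        using f g C0 B0 \<open>0 < K\<close> m0
        by (intro integrable_pmf_bounded[where B = "C * B / (K * m)"])
           (auto simp: abs_mult intro!: divide_right_mono mult_mono)
      show "integrable (measure_pmf Q) (\<lambda>x. f x powr \<alpha> / (K powr \<alpha> * \<alpha>) + g x powr \<beta> / (m powr \<beta> * \<beta>))"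
        using intf intg by auto
      fix x
      have "(f x / K) * (g x / m) \<le> (f x / K) powr \<alpha> / \<alpha> + (g x / m) powr \<beta> / \<beta>"
        using f g \<open>0 < K\<close> m0 \<open>1 < \<alpha>\<close> \<beta> by (intro Youngs_inequality) auto
      then show "f x * g x / (K * m) \<le> f x powr \<alpha> / (K powr \<alpha> * \<alpha>) + g x powr \<beta> / (m powr \<beta> * \<beta>)"
        using f g \<open>0 < K\<close> m0 by (simp add: powr_divide)
    qed
    also have "\<dots> = measure_pmf.expectation Q (\<lambda>x. f x powr \<alpha>) / (K powr \<alpha> * \<alpha>) + G / (m powr \<beta> * \<beta>)"
      using intf intg by (simp add: G_def)
    also have "\<dots> \<le> K powr \<alpha> / (K powr \<alpha> * \<alpha>) + m powr \<beta> / (m powr \<beta> * \<beta>)"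
      using E Gm \<open>1 < \<alpha>\<close> \<beta> by (intro add_mono divide_right_mono) auto
    also have "\<dots> = 1" using \<beta> \<open>0 < K\<close> m0 by simp
    finally show ?thesis using \<open>0 < K\<close> m0 by (simp add: field_simps)
  qed
  then have "measure_pmf.expectation P g / K \<le> G powr (1 / \<beta>)"
    using \<open>0 < K\<close> by - (rule dense_ge, simp add: divide_le_eq mult.commute)
  then show "measure_pmf.expectation P g
      \<le> K * measure_pmf.expectation Q (\<lambda>x. g x powr (\<alpha> / (\<alpha> - 1))) powr ((\<alpha> - 1) / \<alpha>)"
    using \<open>0 < K\<close> by (simp add: G_def \<beta>(3) \<beta>_def[symmetric] divide_le_eq mult.commute)
qed

lemma hoelder_dominated_refl: "1 < \<alpha> \<Longrightarrow> hoelder_dominated \<alpha> 1 P P"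
  by (rule hoelder_dominated_density[where f = "\<lambda>_. 1" and C = 1]) auto

text \<open>The inner norm h(x) of the test function is itself a bounded test function for the outer
  pair, and h^\<beta> is the conditional mean of g^\<beta>, so the nested norms collapse into one
  and the constants multiply. With P = Q and J = 1 this covers mixtures, otherwise adaptive
  composition.\<close>

lemma hoelder_dominated_bind:
  assumes "1 < \<alpha>" "0 \<le> K" and PQ: "hoelder_dominated \<alpha> J P Q"
    and FG: "\<And>x. x \<in> set_pmf P \<Longrightarrow> hoelder_dominated \<alpha> K (F x) (G x)"
  shows "hoelder_dominated \<alpha> (J * K) (bind_pmf P F) (bind_pmf Q G)"
  unfolding hoelder_dominated_def
proof (intro allI impI)
  fix g :: "'b \<Rightarrow> real" and B
  assume g: "\<forall>x. 0 \<le> g x \<and> g x \<le> B"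
  define \<beta> where "\<beta> = \<alpha> / (\<alpha> - 1)"
  have \<beta>: "1 < \<beta>" "(\<alpha> - 1) / \<alpha> = 1 / \<beta>"
    using \<open>1 < \<alpha>\<close> by (auto simp: \<beta>_def field_simps)
  have B0: "0 \<le> B" using g order_trans by blast
  have g': "0 \<le> g x powr \<beta>" "g x powr \<beta> \<le> B powr \<beta>" for x
    using g B0 \<beta> by (auto intro!: powr_mono2)
  define h where "h x = measure_pmf.expectation (G x) (\<lambda>y. g y powr \<beta>) powr (1 / \<beta>)" for x
  have h\<beta>: "h x powr \<beta> = measure_pmf.expectation (G x) (\<lambda>y. g y powr \<beta>)" for x
    using \<beta> by (simp add: h_def powr_powr integral_nonneg_AE)
  have Eg: "measure_pmf.expectation (G x) (\<lambda>y. g y powr \<beta>) \<le> B powr \<beta>" for x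
    using g' by (intro measure_pmf.integral_le_const integrable_pmf_bounded[where B = "B powr \<beta>"]) auto
  have h: "0 \<le> h x" "h x \<le> (B powr \<beta>) powr (1 / \<beta>)" for x
    using Eg[of x] \<beta> by (auto simp: h_def integral_nonneg_AE intro!: powr_mono2)
  have "measure_pmf.expectation (bind_pmf P F) g
      = measure_pmf.expectation P (\<lambda>x. measure_pmf.expectation (F x) g)"
    using g by (intro expectation_bind_pmf[where B = B]) auto
  also have "\<dots> \<le> measure_pmf.expectation P (\<lambda>x. K * h x)"
  proof (rule integral_mono_AE)
    have "measure_pmf.expectation (F x) g \<le> B" for x
      using g by (intro measure_pmf.integral_le_const integrable_pmf_bounded[where B = B]) auto
    moreover have "0 \<le> measure_pmf.expectation (F x) g" for x
      using g by (simp add: integral_nonneg_AE)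
    ultimately show "integrable (measure_pmf P) (\<lambda>x. measure_pmf.expectation (F x) g)"
      by (intro integrable_pmf_bounded[where B = B]) auto
    show "integrable (measure_pmf P) (\<lambda>x. K * h x)"
      using h \<open>0 \<le> K\<close> by (intro integrable_mult_right integrable_pmf_bounded[where B = "(B powr \<beta>) powr (1 / \<beta>)"]) auto
    show "AE x in measure_pmf P. measure_pmf.expectation (F x) g \<le> K * h x"
      unfolding AE_measure_pmf_iff
      using hoelder_dominatedD[OF FG, of _ g B] g by (auto simp: h_def \<beta>(2) \<beta>_def[symmetric])
  qed
  also have "\<dots> = K * measure_pmf.expectation P h" by simp
  also have "\<dots> \<le> K * (J * measure_pmf.expectation Q (\<lambda>x. h x powr \<beta>) powr (1 / \<beta>))"
    using hoelder_dominatedD[OF PQ, of h "(B powr \<beta>) powr (1 / \<beta>)", OF h] \<open>0 \<le> K\<close> by (intro mult_left_mono) (auto simp: \<beta>(2) \<beta>_def[symmetric])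
  also have "measure_pmf.expectation Q (\<lambda>x. h x powr \<beta>)
      = measure_pmf.expectation (bind_pmf Q G) (\<lambda>y. g y powr \<beta>)"
    unfolding h\<beta> using g' by (intro expectation_bind_pmf[symmetric, where B = "B powr \<beta>"]) auto
  finally show "measure_pmf.expectation (bind_pmf P F) g
      \<le> J * K * measure_pmf.expectation (bind_pmf Q G) (\<lambda>x. g x powr (\<alpha> / (\<alpha> - 1))) powr ((\<alpha> - 1) / \<alpha>)"
    by (simp add: \<beta>(2) \<beta>_def[symmetric] mult_ac)
qed

lemma hoelder_dominated_map:
  assumes "hoelder_dominated \<alpha> K P Q"
  shows "hoelder_dominated \<alpha> K (map_pmf f P) (map_pmf f Q)"
  unfolding hoelder_dominated_def
proof (intro allI impI)
  fix g :: "'b \<Rightarrow> real" and B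
  assume "\<forall>x. 0 \<le> g x \<and> g x \<le> B"
  then show "measure_pmf.expectation (map_pmf f P) g
      \<le> K * measure_pmf.expectation (map_pmf f Q) (\<lambda>x. g x powr (\<alpha> / (\<alpha> - 1))) powr ((\<alpha> - 1) / \<alpha>)"
    using hoelder_dominatedD[OF assms, of "\<lambda>x. g (f x)" B] by simp
qed

text \<open>Drawing the coordinates one at a time is an iterated \<open>bind\<close>, so each
  coordinate contributes one factor \<open>K\<close>.\<close>

lemma hoelder_dominated_Pi_pmf:
  assumes "1 < \<alpha>" "finite A" "0 \<le> K" "\<And>a. a \<in> A \<Longrightarrow> hoelder_dominated \<alpha> K (P a) (Q a)"
  shows "hoelder_dominated \<alpha> (K ^ card A) (Pi_pmf A d P) (Pi_pmf A d Q)"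
  using assms(2,4)
proof (induction A rule: finite_induct)
  case empty
  then show ?case using hoelder_dominated_refl[OF \<open>1 < \<alpha>\<close>] by simp
next
  case (insert a A)
  have "hoelder_dominated \<alpha> (K * K ^ card A)
      (P a \<bind> (\<lambda>y. map_pmf (\<lambda>f. f(a := y)) (Pi_pmf A d P)))
      (Q a \<bind> (\<lambda>y. map_pmf (\<lambda>f. f(a := y)) (Pi_pmf A d Q)))"
    using assms insert by (intro hoelder_dominated_bind hoelder_dominated_map) auto
  then show ?case
    using insert by (simp add: Pi_pmf_insert' map_pmf_def)
qed

section \<open>Back from the dual form to supports, moments and approximate privacy\<close>

lemma hoelder_dominated_support:
  assumes "1 < \<alpha>" "hoelder_dominated \<alpha> K P Q"
  shows "set_pmf P \<subseteq> set_pmf Q"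
proof
  fix y assume y: "y \<in> set_pmf P"
  show "y \<in> set_pmf Q"
  proof (rule ccontr)
    assume "y \<notin> set_pmf Q"
    then have "measure_pmf.expectation Q (\<lambda>x. indicator {y} x powr (\<alpha> / (\<alpha> - 1))) = 0"
      by (intro integral_eq_zero_AE) (auto simp: AE_measure_pmf_iff indicator_def)
    moreover have "measure_pmf.expectation P (indicator {y}) \<le> K * measure_pmf.expectation Q
      (\<lambda>x. indicator {y} x powr (\<alpha> / (\<alpha> - 1))) powr ((\<alpha> - 1) / \<alpha>)"
      by (rule hoelder_dominatedD[OF assms(2), where B = 1]) (auto simp: indicator_def)
    ultimately show False
      using y by (simp add: measure_pmf_single pmf_eq_0_set_pmf)
  qed
qed

text \<open>Converse of \<open>hoelder_dominated_density\<close>: the extremal test function gives S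
  \<le> K S^(1/\<beta>) for every finite part S of the moment sum, hence S \<le> K^\<alpha>. The
  bound is uniform in the finite part, which also yields integrability.\<close>

lemma hoelder_dominated_moment:
  assumes "1 < \<alpha>" "0 < K" "hoelder_dominated \<alpha> K P Q"
  defines "f \<equiv> \<lambda>x. (pmf P x / pmf Q x) powr \<alpha>"
  shows "integrable (measure_pmf Q) f" "measure_pmf.expectation Q f \<le> K powr \<alpha>"
proof -
  define \<beta> where "\<beta> = \<alpha> / (\<alpha> - 1)"
  have \<beta>: "1 < \<beta>" "(\<alpha> - 1) / \<alpha> = 1 / \<beta>" "(\<alpha> - 1) * \<beta> = \<alpha>" "1 / \<alpha> = 1 - 1 / \<beta>"
    using \<open>1 < \<alpha>\<close> by (auto simp: \<beta>_def field_simps)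
  have sub: "set_pmf P \<subseteq> set_pmf Q" using hoelder_dominated_support assms by blast
  have fin: "(\<Sum>x\<in>F. pmf Q x * f x) \<le> K powr \<alpha>" if "finite F" for F
  proof -
    define S where "S = (\<Sum>x\<in>F. pmf Q x * f x)"
    \<comment> \<open>Equality case of Hoelder's inequality: (\<alpha> - 1) \<beta> = \<alpha> turns
      g^\<beta> into the summand of the moment. Restricting to the finite set \<open>F\<close> keeps
      \<open>g\<close> bounded and S finite, so that a power of S can be cancelled.\<close>
    define g where "g x = (if x \<in> F then (pmf P x / pmf Q x) powr (\<alpha> - 1) else 0)" for x
    define B where "B = (\<Sum>x\<in>F. g x)"
    have g: "0 \<le> g x" for x by (simp add: g_def)
    have gB: "g x \<le> B" for x
    proof (cases "x \<in> F")
      case True then show ?thesis unfolding B_def using that g by (intro member_le_sum) auto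
    qed (auto simp: g_def B_def intro: sum_nonneg)
    have S0: "0 \<le> S" unfolding S_def f_def by (intro sum_nonneg) auto
    have "(measure_pmf.expectation P g) = (\<Sum>x\<in>F. pmf P x * g x)"
      using that by (subst integral_measure_pmf_real[where A = F]) (auto simp: g_def mult.commute split: if_splits)
    also have "\<dots> = S"
      unfolding S_def
    proof (rule sum.cong[OF refl])
      fix x assume x: "x \<in> F"
      show "pmf P x * g x = pmf Q x * f x"
      proof (cases "pmf Q x = 0")
        case True
        then have "pmf P x = 0" using sub by (auto simp: set_pmf_iff subset_iff)
        with True show ?thesis by simp
      next
        case False
        then have "(pmf P x / pmf Q x) * (pmf P x / pmf Q x) powr (\<alpha> - 1) = f x"
          using powr_mult_base[of "pmf P x / pmf Q x" "\<alpha> - 1"] by (simp add: f_def)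
        then show ?thesis using x False by (simp add: g_def field_simps)
      qed
    qed
    finally have EP: "measure_pmf.expectation P g = S" .
    have "measure_pmf.expectation Q (\<lambda>x. g x powr \<beta>) = (\<Sum>x\<in>F. g x powr \<beta> * pmf Q x)"
      using that by (subst integral_measure_pmf_real[where A = F]) (auto simp: g_def split: if_splits)
    also have "\<dots> = S"
      unfolding S_def by (rule sum.cong) (auto simp: g_def f_def powr_powr \<beta>)
    finally have "S \<le> K * S powr (1 / \<beta>)"
      using hoelder_dominatedD[OF assms(3), of g B, OF g gB] EP by (simp add: \<beta>(2) \<beta>_def[symmetric])
    show "S \<le> K powr \<alpha>"
    proof (cases "S = 0")
      case False
      with S0 have S: "0 < S" by simp
      have "S powr (1 / \<alpha>) * S powr (1 / \<beta>) = S"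
        unfolding \<beta>(4) using S by (simp flip: powr_add)
      with \<open>S \<le> K * S powr (1 / \<beta>)\<close> have "S powr (1 / \<alpha>) * S powr (1 / \<beta>) \<le> K * S powr (1 / \<beta>)" by simp
      then have "S powr (1 / \<alpha>) \<le> K" using S by simp
      then have "(S powr (1 / \<alpha>)) powr \<alpha> \<le> K powr \<alpha>" using \<open>1 < \<alpha>\<close> by (intro powr_mono2) auto
      then show ?thesis using S \<open>1 < \<alpha>\<close> by (simp add: powr_powr)
    qed simp
  qed
  let ?h = "\<lambda>x. pmf Q x * f x"
  have sum: "?h summable_on UNIV"
    using fin by (intro nonneg_bdd_above_summable_on bdd_aboveI[where M = "K powr \<alpha>"]) (auto simp: f_def)
  then have "Infinite_Sum.abs_summable_on ?h UNIV" by (simp add: f_def)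
  then have abs: "Infinite_Set_Sum.abs_summable_on ?h UNIV" by (rule abs_summable_equivalent[THEN iffD1])
  then show "integrable (measure_pmf Q) f"
    unfolding measure_pmf_eq_density abs_summable_on_def by (subst integrable_density) auto
  have "measure_pmf.expectation Q f = infsum ?h UNIV"
    using abs by (simp add: pmf_expectation_eq_infsetsum infsetsum_infsum)
  also have "\<dots> \<le> K powr \<alpha>"
    using sum fin by (intro infsum_le_finite_sums) auto
  finally show "measure_pmf.expectation Q f \<le> K powr \<alpha>" .
qed

lemma hoelder_dominated_renyi_divergence:
  assumes "1 < \<alpha>" "hoelder_dominated \<alpha> (exp (\<tau> * (\<alpha> - 1) / \<alpha>)) P Q" "0 \<le> \<tau>"
  shows "renyi_divergence \<alpha> P Q \<le> \<tau>"
proof -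
  define E where "E = measure_pmf.expectation Q (\<lambda>x. (pmf P x / pmf Q x) powr \<alpha>)"
  have "E \<le> exp (\<tau> * (\<alpha> - 1))"
    using hoelder_dominated_moment(2)[OF assms(1) _ assms(2)] assms(1) by (simp add: E_def exp_powr_real)
  moreover have "0 \<le> E" by (simp add: E_def integral_nonneg_AE)
  \<comment> \<open>\<open>ln 0 = 0\<close> by convention, so the case \<open>E = 0\<close> is
    settled by \<tau> \<ge> 0.\<close>
  ultimately have "ln E \<le> \<tau> * (\<alpha> - 1)"
    using assms ln_mono[of E "exp (\<tau> * (\<alpha> - 1))"] by (cases "E = 0") auto
  then show ?thesis
    using assms(1) by (simp add: renyi_divergence_def E_def[symmetric] field_simps)
qed

text \<open>Testing with the indicator of A gives P(A) \<le> s^(1 - 1/\<alpha>) for s = e^\<tau>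
  Q(A). Either this is at most \<delta>, or s is at least \<delta>^(\<alpha>/(\<alpha>-1)), and then
  the surplus factor s^(-1/\<alpha>) is at most \<delta>^(-1/(\<alpha>-1)).\<close>

lemma hoelder_dominated_approximate_dp:
  assumes "1 < \<alpha>" "0 < \<delta>" "\<delta> < 1" "hoelder_dominated \<alpha> (exp (\<tau> * (\<alpha> - 1) / \<alpha>)) P Q"
  shows "measure_pmf.prob P A
    \<le> exp (\<tau> + ln (1 / \<delta>) / (\<alpha> - 1)) * measure_pmf.prob Q A + \<delta>"
proof -
  define s where "s = exp \<tau> * measure_pmf.prob Q A"
  have s0: "0 \<le> s" by (simp add: s_def)
  have "measure_pmf.expectation P (indicator A)
      \<le> exp (\<tau> * (\<alpha> - 1) / \<alpha>) * measure_pmf.expectation Q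
        (\<lambda>x. indicator A x powr (\<alpha> / (\<alpha> - 1))) powr ((\<alpha> - 1) / \<alpha>)"
    by (rule hoelder_dominatedD[OF assms(4), where B = 1]) (auto simp: indicator_def)
  moreover have "(\<lambda>x. indicator A x powr (\<alpha> / (\<alpha> - 1))) = (indicator A :: _ \<Rightarrow> real)"
    by (auto simp: indicator_def fun_eq_iff)
  ultimately have P: "measure_pmf.prob P A \<le> s powr ((\<alpha> - 1) / \<alpha>)"
    by (simp add: s_def powr_mult exp_powr_real)
  show ?thesis
  proof (cases "s powr ((\<alpha> - 1) / \<alpha>) \<le> \<delta>")
    case True
    then show ?thesis using P assms(2) by (intro order_trans[OF P] order_trans[OF True]) auto
  next
    case False
    then have s: "0 < s" using s0 assms(2) by (cases "s = 0") auto
    have "\<delta> powr (\<alpha> / (\<alpha> - 1)) \<le> (s powr ((\<alpha> - 1) / \<alpha>)) powr (\<alpha> / (\<alpha> - 1))"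
      using False assms by (intro powr_mono2) auto
    also have "\<dots> = s" using s assms(1) by (simp add: powr_powr)
    finally have ds: "\<delta> powr (\<alpha> / (\<alpha> - 1)) \<le> s" .
    have "s powr ((\<alpha> - 1) / \<alpha>) = s * s powr (- 1 / \<alpha>)"
      using s assms(1) by (simp add: powr_mult_base diff_divide_distrib)
    also have "s powr (- 1 / \<alpha>) \<le> (\<delta> powr (\<alpha> / (\<alpha> - 1))) powr (- 1 / \<alpha>)"
      using ds assms by (intro powr_mono2') auto
    also have "\<dots> = \<delta> powr (- 1 / (\<alpha> - 1))"
      using assms by (simp add: powr_powr)
    also have "\<dots> = exp (ln (1 / \<delta>) / (\<alpha> - 1))"
      using assms by (simp add: powr_def ln_div)
    finally have "s powr ((\<alpha> - 1) / \<alpha>) \<le> s * exp (ln (1 / \<delta>) / (\<alpha> - 1))"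
      using s by simp
    then show ?thesis using P assms(2) by (simp add: s_def exp_add mult_ac)
  qed
qed

section \<open>Sums of independent coins\<close>

text \<open>Convolution with the Bernoulli law of bias p. Convolutions commute, so the coins may be
  added or removed in any order.\<close>

definition coin_step :: "real \<Rightarrow> (int \<Rightarrow> real) \<Rightarrow> int \<Rightarrow> real" where
  "coin_step p r z = (1 - p) * r z + p * r (z - 1)"

text \<open>The law of the number of heads among \<open>a\<close> coins of bias \<open>p\<close> and \<open>b\<close> coins of bias \<open>1 - p\<close>.
  It is indexed by integers so that no boundary cases arise.\<close>

definition coins :: "real \<Rightarrow> nat \<Rightarrow> nat \<Rightarrow> int \<Rightarrow> real" where
  "coins p a b = (coin_step p ^^ a) ((coin_step (1 - p) ^^ b) (\<lambda>z. of_bool (z = 0)))"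

lemma coin_step_commute: "coin_step p (coin_step q r) = coin_step q (coin_step p r)"
  by (rule ext) (simp add: coin_step_def algebra_simps)

lemma coins_0_0: "coins p 0 0 z = of_bool (z = 0)"
  by (simp add: coins_def)

lemma coins_Suc_left: "coins p (Suc a) b = coin_step p (coins p a b)"
  by (simp add: coins_def)

lemma coins_Suc_right: "coins p a (Suc b) = coin_step (1 - p) (coins p a b)"
proof (induction a)
  case 0
  show ?case by (simp add: coins_def)
next
  case (Suc a)
  then show ?case by (simp add: coins_Suc_left coin_step_commute)
qed

lemma coins_add_left: "coins p (a + k) b = (coin_step p ^^ k) (coins p a b)"
  by (induction k) (simp_all add: coins_Suc_left)

lemma coins_add_right: "coins p a (b + k) = (coin_step (1 - p) ^^ k) (coins p a b)"
  by (induction k) (simp_all add: coins_Suc_right)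

text \<open>Lets positivity, log-concavity and the moment bound be proved by a single step for an
  arbitrary extra coin of either bias. The first argument of \<open>P\<close> carries the size of
  the support.\<close>

lemma coins_induct [consumes 0, case_names base left right]:
  assumes "P 0 (coins p 0 0)"
    and "\<And>a b. P (a + b) (coins p a b) \<Longrightarrow> P (Suc (a + b)) (coin_step p (coins p a b))"
    and "\<And>a b. P (a + b) (coins p a b) \<Longrightarrow> P (Suc (a + b)) (coin_step (1 - p) (coins p a b))"
  shows "P (a + b) (coins p a b)"
proof (induction a)
  case 0
  show ?case
  proof (induction b)
    case 0
    show ?case using assms(1) by simp
  next
    case (Suc b)
    then show ?case using assms(3)[of 0 b] by (simp add: coins_Suc_right)
  qed
next
  case (Suc a)
  then show ?case using assms(2)[of a b] by (simp add: coins_Suc_left)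
qed

lemma coins_pos:
  assumes "0 < p" "p < 1"
  shows "(0 \<le> z \<and> z \<le> int (a + b) \<longrightarrow> 0 < coins p a b z) \<and> (z < 0 \<or> int (a + b) < z \<longrightarrow> coins p a b z = 0)"
proof -
  have step: "\<forall>z. (0 \<le> z \<and> z \<le> int (Suc n) \<longrightarrow> 0 < coin_step t r z)
      \<and> (z < 0 \<or> int (Suc n) < z \<longrightarrow> coin_step t r z = 0)"
    if r: "\<forall>z. (0 \<le> z \<and> z \<le> int n \<longrightarrow> 0 < r z) \<and> (z < 0 \<or> int n < z \<longrightarrow> r z = 0)"
      and t: "0 < t" "t < 1" for t r n
  proof (intro allI conjI impI)
    fix z :: int
    assume z: "0 \<le> z \<and> z \<le> int (Suc n)"
    have r0: "0 \<le> r y" for y using r by (cases "0 \<le> y \<and> y \<le> int n") (auto intro: less_imp_le)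
    have "0 < r z \<or> 0 < r (z - 1)"
    proof (cases "z \<le> int n")
      case False
      then have "z - 1 = int n" using z by simp
      then show ?thesis using r by simp
    qed (use r z in auto)
    then have "0 < (1 - t) * r z \<or> 0 < t * r (z - 1)" using t by auto
    moreover have "0 \<le> (1 - t) * r z" "0 \<le> t * r (z - 1)" using r0 t by auto
    ultimately show "0 < coin_step t r z" unfolding coin_step_def by linarith
  next
    fix z :: int
    assume "z < 0 \<or> int (Suc n) < z"
    then have "r z = 0" "r (z - 1) = 0" using r by auto
    then show "coin_step t r z = 0" by (simp add: coin_step_def)
  qed
  have "\<forall>z. (0 \<le> z \<and> z \<le> int (a + b) \<longrightarrow> 0 < coins p a b z)
      \<and> (z < 0 \<or> int (a + b) < z \<longrightarrow> coins p a b z = 0)"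
  proof (induction rule: coins_induct)
    case base
    then show ?case by (auto simp: coins_0_0)
  next
    case (left a b)
    then show ?case by (rule step) (use assms in auto)
  next
    case (right a b)
    then show ?case by (rule step) (use assms in auto)
  qed
  then show ?thesis by blast
qed

lemma coins_nonneg: "0 < p \<Longrightarrow> p < 1 \<Longrightarrow> 0 \<le> coins p a b z"
  using coins_pos[of p z a b] by (cases "0 \<le> z \<and> z \<le> int (a + b)") auto

text \<open>Multiplying the law by \<open>z\<close> is a derivation with respect to convolution.\<close>

lemma coins_times_index:
  "of_int z * coins p a b z
    = real a * p * coins p (a - 1) b (z - 1) + real b * (1 - p) * coins p a (b - 1) (z - 1)"
proof (induction a arbitrary: z)
  case 0
  show ?case
  proof (induction b arbitrary: z)
    case 0
    show ?case by (simp add: coins_0_0)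
  next
    case (Suc b)
    have "of_int z * coins p 0 (Suc b) z
      = p * (of_int z * coins p 0 b z) + (1 - p) * (of_int (z - 1) * coins p 0 b (z - 1))
        + (1 - p) * coins p 0 b (z - 1)"
      by (simp add: coins_Suc_right coin_step_def algebra_simps)
    also have "\<dots> = real b * (1 - p) * (p * coins p 0 (b - 1) (z - 1) + (1 - p) * coins p 0 (b - 1) (z - 1 - 1))
        + (1 - p) * coins p 0 b (z - 1)"
      unfolding Suc.IH by (simp add: algebra_simps)
    also have "\<dots> = real (Suc b) * (1 - p) * coins p 0 b (z - 1)"
      by (cases b) (simp_all add: coins_Suc_right coin_step_def algebra_simps)
    finally show ?case by simp
  qed
next
  case (Suc a)
  have "of_int z * coins p (Suc a) b z
    = (1 - p) * (of_int z * coins p a b z) + p * (of_int (z - 1) * coins p a b (z - 1))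
      + p * coins p a b (z - 1)"
    by (simp add: coins_Suc_left coin_step_def algebra_simps)
  also have "\<dots> = (real a * p * ((1 - p) * coins p (a - 1) b (z - 1) + p * coins p (a - 1) b (z - 1 - 1))
        + p * coins p a b (z - 1))
      + real b * (1 - p) * ((1 - p) * coins p a (b - 1) (z - 1) + p * coins p a (b - 1) (z - 1 - 1))"
    unfolding Suc.IH by (simp add: algebra_simps)
  also have "real a * p * ((1 - p) * coins p (a - 1) b (z - 1) + p * coins p (a - 1) b (z - 1 - 1))
        + p * coins p a b (z - 1) = real (Suc a) * p * coins p a b (z - 1)"
    by (cases a) (simp_all add: coins_Suc_left coin_step_def algebra_simps)
  also have "(1 - p) * coins p a (b - 1) (z - 1) + p * coins p a (b - 1) (z - 1 - 1)
      = coins p (Suc a) (b - 1) (z - 1)"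
    by (simp add: coins_Suc_left coin_step_def)
  finally show ?case by simp
qed

subsection \<open>Log-concavity\<close>

text \<open>Asking for all i \<le> j instead of i = j also excludes internal zeros, and it is the
  form that convolution consumes, where gaps of several widths meet.\<close>

definition log_concave :: "(int \<Rightarrow> real) \<Rightarrow> bool" where
  "log_concave r \<longleftrightarrow> (\<forall>z. 0 \<le> r z) \<and> (\<forall>i j. i \<le> j \<longrightarrow> r (i - 1) * r (j + 1) \<le> r i * r j)"

text \<open>The Turan determinant, the defect in the log-concavity inequality at z.\<close>

definition turan :: "(int \<Rightarrow> real) \<Rightarrow> int \<Rightarrow> real" where
  "turan r z = r z * r z - r (z - 1) * r (z + 1)"

lemma turan_nonneg: "log_concave r \<Longrightarrow> 0 \<le> turan r z"
  by (simp add: log_concave_def turan_def)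

lemma log_concaveD: "log_concave r \<Longrightarrow> i \<le> j \<Longrightarrow> r (i - 1) * r (j + 1) \<le> r i * r j"
  by (simp add: log_concave_def)

text \<open>Log-concavity is used twice, moving both indices inward by one each time. If i = j or i
  = j + 1 the indices cross, and then a step or the whole claim is an equality of swapped
  products.\<close>

lemma log_concave_wide:
  assumes "log_concave r" "i \<le> j + 1"
  shows "r (i - 2) * r (j + 1) \<le> r i * r (j - 1)"
proof (cases "i \<le> j")
  case True
  have "r (i - 1 - 1) * r (j + 1) \<le> r (i - 1) * r j"
    using log_concaveD[OF assms(1), of "i - 1" j] True by simp
  also have "\<dots> \<le> r i * r (j - 1)"
  proof (cases "i = j")
    case False
    then show ?thesis using log_concaveD[OF assms(1), of i "j - 1"] True by simp
  qed (simp add: mult.commute)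
  finally show ?thesis by (simp add: algebra_simps)
next
  case False
  then have "i = j + 1" using assms(2) by simp
  then show ?thesis by (simp add: mult.commute)
qed

text \<open>In the expanded difference the mixed products r(i-1) r(j) cancel. The rest is a
  combination with weights (1-p)^2, p(1-p) and p^2 of three differences, each nonnegative by
  log-concavity of r.\<close>

lemma log_concave_coin_step:
  assumes r: "log_concave r" and p: "0 \<le> p" "p \<le> 1"
  shows "log_concave (coin_step p r)"
  unfolding log_concave_def
proof (intro conjI allI impI)
  fix z show "0 \<le> coin_step p r z" using r p by (simp add: coin_step_def log_concave_def)
next
  fix i j :: int
  assume ij: "i \<le> j"
  have 1: "0 \<le> r i * r j - r (i - 1) * r (j + 1)"
    using r ij by (simp add: log_concave_def)
  have 2: "0 \<le> r i * r (j - 1) - r (i - 2) * r (j + 1)"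
    using log_concave_wide[OF r, of i j] ij by simp
  have 3: "0 \<le> r (i - 1) * r (j - 1) - r (i - 2) * r j"
    using log_concaveD[OF r, of "i - 1" "j - 1"] ij by simp
  have "coin_step p r i * coin_step p r j - coin_step p r (i - 1) * coin_step p r (j + 1)
    = (1 - p) * (1 - p) * (r i * r j - r (i - 1) * r (j + 1))
      + p * (1 - p) * (r i * r (j - 1) - r (i - 2) * r (j + 1))
      + p * p * (r (i - 1) * r (j - 1) - r (i - 2) * r j)"
    by (simp add: coin_step_def algebra_simps)
  also have "\<dots> \<ge> 0" using 1 2 3 p by (intro add_nonneg_nonneg mult_nonneg_nonneg) auto
  finally show "coin_step p r (i - 1) * coin_step p r (j + 1) \<le> coin_step p r i * coin_step p r j"
    by simp
qed

lemma log_concave_coins: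
  assumes "0 \<le> p" "p \<le> 1"
  shows "log_concave (coins p a b)"
proof (induction rule: coins_induct[where P = "\<lambda>_. log_concave"])
  case base
  show ?case by (auto simp: log_concave_def coins_0_0)
qed (use assms in \<open>auto intro!: log_concave_coin_step\<close>)

text \<open>The determinant after a coin of bias t combines three nonnegative quantities with
  weights (1-t)^2, t(1-t) and t^2. Exchanging p and 1 - p changes these weights by a factor of at
  most 3^2, since both biases lie between 1/4 and 3/4.\<close>

lemma turan_coin_step_le:
  assumes r: "log_concave r" and p: "1 / 4 \<le> p" "p \<le> 3 / 4"
  shows "turan (coin_step p r) z \<le> 9 * turan (coin_step (1 - p) r) z"
proof -
  have eq: "turan (coin_step t r) z
    = (1 - t) * (1 - t) * turan r z + t * (1 - t) * (r z * r (z - 1) - r (z - 2) * r (z + 1))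
      + t * t * turan r (z - 1)" for t
    by (simp add: turan_def coin_step_def algebra_simps)
  have Y: "0 \<le> r z * r (z - 1) - r (z - 2) * r (z + 1)"
    using log_concave_wide[OF r, of z z] by simp
  have "(1 - p) * (1 - p) \<le> (3 * p) * (3 * p)" "p * p \<le> (3 * (1 - p)) * (3 * (1 - p))"
    using p by (intro mult_mono; simp)+
  then have "(1 - p) * (1 - p) \<le> 9 * (p * p)" "p * p \<le> 9 * ((1 - p) * (1 - p))"
    by (simp_all only: mult_ac)
  moreover have "0 \<le> p * (1 - p)" using p by (intro mult_nonneg_nonneg) auto
  ultimately have "(1 - p) * (1 - p) * turan r z \<le> 9 * (p * p) * turan r z"
    "p * p * turan r (z - 1) \<le> 9 * ((1 - p) * (1 - p)) * turan r (z - 1)"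
    "p * (1 - p) * (r z * r (z - 1) - r (z - 2) * r (z + 1))
      \<le> 9 * (p * (1 - p)) * (r z * r (z - 1) - r (z - 2) * r (z + 1))"
    using Y by (intro mult_right_mono turan_nonneg r; simp only:)+
  then show ?thesis unfolding eq by (simp add: algebra_simps)
qed

section \<open>Turan determinants and likelihood ratios of coin laws\<close>

lemma turan_cross: "s z * coin_step t s z - s (z - 1) * coin_step t s (z + 1) = (1 - t) * turan s z"
  by (simp add: turan_def coin_step_def algebra_simps)

text \<open>Writing Q(z) Q(z+1) as the difference of (z+1) Q(z+1) Q(z) and z Q(z) Q(z+1) allows
  \<open>coins_times_index\<close> to be applied to both terms. It removes one coin from one of the
  factors, and \<open>turan_cross\<close> evaluates each remaining cross difference as a Turan
  determinant.\<close>

lemma coins_consecutive_product: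
  "coins p a (Suc b) z * coins p a (Suc b) (z + 1)
    = p * (1 - p) * (real a * turan (coins p (a - 1) (Suc b)) z + real (Suc b) * turan (coins p a b) z)"
proof -
  let ?Q = "coins p a (Suc b)" and ?u = "coins p (a - 1) (Suc b)" and ?s = "coins p a b"
  have s: "?s z * ?Q z - ?s (z - 1) * ?Q (z + 1) = p * turan ?s z"
    using turan_cross[of ?s z "1 - p"] by (simp add: coins_Suc_right)
  have u: "real a * (?u z * ?Q z - ?u (z - 1) * ?Q (z + 1)) = real a * ((1 - p) * turan ?u z)"
    using turan_cross[of ?u z p] by (cases a) (simp_all add: coins_Suc_left)
  have "?Q z * ?Q (z + 1) = (of_int (z + 1) * ?Q (z + 1)) * ?Q z - (of_int z * ?Q z) * ?Q (z + 1)"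
    by (simp add: algebra_simps)
  also have "\<dots> = p * (real a * (?u z * ?Q z - ?u (z - 1) * ?Q (z + 1)))
      + real (Suc b) * (1 - p) * (?s z * ?Q z - ?s (z - 1) * ?Q (z + 1))"
    unfolding coins_times_index by (simp add: algebra_simps)
  finally show ?thesis unfolding s u by (simp add: algebra_simps)
qed

text \<open>The identity for the product has a + b + 1 summands. Those belonging to the law with a -
  1 and b + 1 coins differ from the present one in a single bias, so every summand is at least a
  ninth of the determinant on the left. The factor a + b + 1 is the amplification by the other
  coins.\<close>

lemma turan_coins_le:
  assumes p: "1 / 4 \<le> p" "p \<le> 3 / 4"
  shows "p * (1 - p) * real (Suc (a + b)) * turan (coins p a b) z
    \<le> 9 * (coins p a (Suc b) z * coins p a (Suc b) (z + 1))"
proof -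
  have lc: "log_concave (coins p a' b')" for a' b'
    using p by (intro log_concave_coins) auto
  have "real a * turan (coins p a b) z \<le> 9 * (real a * turan (coins p (a - 1) (Suc b)) z)"
  proof (cases a)
    case (Suc a')
    have "turan (coins p a b) z \<le> 9 * turan (coins p (a - 1) (Suc b)) z"
      using turan_coin_step_le[OF lc p, of a' b z] Suc by (simp add: coins_Suc_left coins_Suc_right)
    from mult_left_mono[OF this, of "real a"] show ?thesis by simp
  qed simp
  moreover have "0 \<le> real (Suc b) * turan (coins p a b) z" using lc by (simp add: turan_nonneg)
  moreover have "x + y \<le> 9 * (v + y)" if "x \<le> 9 * v" "0 \<le> y" for x y v :: real
    using that by simp
  ultimately have "real a * turan (coins p a b) z + real (Suc b) * turan (coins p a b) z
    \<le> 9 * (real a * turan (coins p (a - 1) (Suc b)) z + real (Suc b) * turan (coins p a b) z)"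
    by blast
  then have "real (Suc (a + b)) * turan (coins p a b) z
    \<le> 9 * (real a * turan (coins p (a - 1) (Suc b)) z + real (Suc b) * turan (coins p a b) z)"
    by (simp add: algebra_simps)
  then have "(p * (1 - p)) * (real (Suc (a + b)) * turan (coins p a b) z)
    \<le> (p * (1 - p)) * (9 * (real a * turan (coins p (a - 1) (Suc b)) z + real (Suc b) * turan (coins p a b) z))"
    using p by (intro mult_left_mono) auto
  then show ?thesis unfolding coins_consecutive_product by (simp add: algebra_simps)
qed

text \<open>Both laws add one coin to the same law s, and their cross difference is (p^2 - (1-p)^2)
  times the Turan determinant of s, that is 2 \<theta> times it. Its sign gives the first bound, its
  size the second.\<close>

lemma coins_swap_likelihood_ratio:
  assumes \<theta>: "0 \<le> \<theta>" "\<theta> \<le> 1 / 4"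
  defines "p \<equiv> 1 / 2 + \<theta>"
  shows "coins p (Suc a) b z * coins p a (Suc b) (z + 1) \<le> coins p (Suc a) b (z + 1) * coins p a (Suc b) z"
    and "coins p (Suc a) b (z + 1) * coins p a (Suc b) z
      \<le> (1 + 288 * \<theta> / real (Suc (a + b))) * (coins p (Suc a) b z * coins p a (Suc b) (z + 1))"
proof -
  let ?P = "coins p (Suc a) b" and ?Q = "coins p a (Suc b)" and ?s = "coins p a b" and ?n = "real (Suc (a + b))"
  have p: "1 / 4 \<le> p" "p \<le> 3 / 4" "p - (1 - p) = 2 * \<theta>" "0 < p" "p < 1" using \<theta> by (auto simp: p_def)
  have eq: "?P (z + 1) * ?Q z - ?P z * ?Q (z + 1) = 2 * \<theta> * turan ?s z"
    unfolding p(3)[symmetric] by (simp add: coins_Suc_left coins_Suc_right coin_step_def turan_def algebra_simps)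
  have T0: "0 \<le> turan ?s z" using p by (intro turan_nonneg log_concave_coins) auto
  show "?P z * ?Q (z + 1) \<le> ?P (z + 1) * ?Q z"
    using eq T0 \<theta> mult_nonneg_nonneg[of "2 * \<theta>" "turan ?s z"] by linarith
  have "3 / 16 \<le> p * (1 - p)"
  proof -
    have "p * (1 - p) = 3 / 16 + (p - 1 / 4) * (3 / 4 - p)" by (simp add: field_simps)
    moreover have "0 \<le> (p - 1 / 4) * (3 / 4 - p)" using p by (intro mult_nonneg_nonneg) auto
    ultimately show ?thesis by linarith
  qed
  then have "3 / 16 * (?n * turan ?s z) \<le> p * (1 - p) * (?n * turan ?s z)"
    using T0 by (intro mult_right_mono) auto
  also have "\<dots> \<le> 9 * (?Q z * ?Q (z + 1))"
    using turan_coins_le[OF p(1,2), of a b z] by (simp add: mult.assoc)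
  finally have "?n * turan ?s z \<le> 48 * (?Q z * ?Q (z + 1))" by (simp add: mult.commute)
  moreover have "?Q z * ?Q (z + 1) \<le> 3 * ?P z * ?Q (z + 1)"
  proof (rule mult_right_mono)
    have "p * ?s z \<le> 3 * (1 - p) * ?s z" "(1 - p) * ?s (z - 1) \<le> 3 * p * ?s (z - 1)"
      using p coins_nonneg[of p] by (intro mult_right_mono; simp)+
    then show "?Q z \<le> 3 * ?P z"
      by (simp add: coins_Suc_left coins_Suc_right coin_step_def algebra_simps)
  qed (use p coins_nonneg in auto)
  ultimately have "?n * turan ?s z \<le> 144 * (?P z * ?Q (z + 1))" by simp
  \<comment> \<open>48 = 9 * 16 / 3 uses p (1 - p) \<ge> 3/16, and the step to 144 replaces
    \<open>?Q z\<close> by \<open>3 * ?P z\<close>. The factor 2 \<theta> of the cross difference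
    then makes 288.\<close>
  then have "turan ?s z \<le> 144 / ?n * (?P z * ?Q (z + 1))"
    by (simp add: pos_le_divide_eq mult.commute del: of_nat_Suc)
  then have "2 * \<theta> * turan ?s z \<le> 2 * \<theta> * (144 / ?n * (?P z * ?Q (z + 1)))"
    using \<theta> by (intro mult_left_mono) auto
  then show "?P (z + 1) * ?Q z \<le> (1 + 288 * \<theta> / ?n) * (?P z * ?Q (z + 1))"
    using eq by (simp add: algebra_simps)
qed

text \<open>The l coins are flipped one after the other along the interpolation \<open>F\<close>.
  The total number of coins stays the same, so each flip costs the same factor, and l such factors
  are bounded by an exponential.\<close>

lemma coins_likelihood_ratio:
  assumes \<theta>: "0 \<le> \<theta>" "\<theta> \<le> 1 / 4" and z: "0 \<le> z" "z < int (a + b + l)"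
  defines "p \<equiv> 1 / 2 + \<theta>"
  defines "P \<equiv> coins p (a + l) b" and "Q \<equiv> coins p a (b + l)"
  shows "Q (z + 1) / Q z \<le> P (z + 1) / P z"
    and "P (z + 1) / P z \<le> exp (288 * \<theta> * real l / real (a + b + l)) * (Q (z + 1) / Q z)"
proof -
  let ?c = "288 * \<theta> / real (a + b + l)"
  define F where "F k = coins p (a + k) (b + (l - k))" for k
  have p: "0 < p" "p < 1" using \<theta> by (auto simp: p_def)
  have "F 0 (z + 1) / F 0 z \<le> F k (z + 1) / F k z
      \<and> F k (z + 1) / F k z \<le> (1 + ?c) ^ k * (F 0 (z + 1) / F 0 z)" if "k \<le> l" for k
    using that
  proof (induction k)
    case (Suc k)
    obtain b' where b': "b + (l - k) = Suc b'" "b + (l - Suc k) = b'" using Suc by (cases "l - k") auto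
    have pos: "0 < F j y" if "y \<in> {z, z + 1}" "j \<le> l" for j y
      using that z coins_pos[OF p, of y "a + j" "b + (l - j)"] by (auto simp: F_def)
    have n: "Suc (a + k + b') = a + b + l" using b' Suc by simp
    have F: "F (Suc k) = coins p (Suc (a + k)) b'" "F k = coins p (a + k) (Suc b')"
      by (simp_all only: F_def b' add_Suc_right)
    note swap = coins_swap_likelihood_ratio[OF \<theta>, of "a + k" b' z, folded p_def, folded F, unfolded n]
    have 1: "F k (z + 1) / F k z \<le> F (Suc k) (z + 1) / F (Suc k) z"
      using swap(1) pos[of z k] pos[of z "Suc k"] Suc by (simp add: field_simps)
    have 2: "F (Suc k) (z + 1) / F (Suc k) z \<le> (1 + ?c) * (F k (z + 1) / F k z)"
      using swap(2) pos[of z k] pos[of z "Suc k"] Suc by (simp add: pos_divide_le_eq) (simp add: pos_le_divide_eq mult_ac)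
    also have "\<dots> \<le> (1 + ?c) * ((1 + ?c) ^ k * (F 0 (z + 1) / F 0 z))"
      using Suc \<theta> by (intro mult_left_mono) auto
    finally show ?case using 1 Suc by auto
  qed simp
  from this[of l] have *: "F 0 (z + 1) / F 0 z \<le> F l (z + 1) / F l z"
    "F l (z + 1) / F l z \<le> (1 + ?c) ^ l * (F 0 (z + 1) / F 0 z)" by auto
  have F: "F 0 = Q" "F l = P" by (simp_all add: F_def P_def Q_def)
  show "Q (z + 1) / Q z \<le> P (z + 1) / P z" using * F by simp
  have "(1 + ?c) ^ l \<le> exp ?c ^ l"
    using \<theta> by (intro power_mono exp_ge_add_one_self) auto
  also have "\<dots> = exp (288 * \<theta> * real l / real (a + b + l))"
    by (simp flip: exp_of_nat_mult)
  finally have "(1 + ?c) ^ l * (Q (z + 1) / Q z) \<le> exp (288 * \<theta> * real l / real (a + b + l)) * (Q (z + 1) / Q z)"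
    using coins_nonneg[OF p] by (intro mult_right_mono) (auto simp: Q_def)
  then show "P (z + 1) / P z \<le> exp (288 * \<theta> * real l / real (a + b + l)) * (Q (z + 1) / Q z)"
    using *(2) F by simp
qed

subsection \<open>Moments of slowly varying likelihood ratios\<close>

text \<open>Hoeffding's lemma for a Bernoulli variable. Negative s is reduced to positive s by
  exchanging the two outcomes.\<close>

lemma two_point_mgf_le:
  fixes p s :: real
  assumes "0 \<le> p" "p \<le> 1"
  shows "1 - p + p * exp s \<le> exp (p * s + s\<^sup>2 / 8)"
proof -
  have pos: "1 - r + r * exp u \<le> exp (r * u + u\<^sup>2 / 8)" if "0 \<le> r" "r \<le> 1" "0 \<le> u" for r u :: real
  proof -
    have "0 < 1 + r * (exp u - 1)" using that by (intro add_pos_nonneg mult_nonneg_nonneg) auto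
    moreover have "ln (1 + r * (exp u - 1)) \<le> r * u + u\<^sup>2 / 8"
      using Hoeffdings_lemma_aux[OF that(3,1)] by (simp add: mult.commute)
    ultimately have "1 + r * (exp u - 1) \<le> exp (r * u + u\<^sup>2 / 8)"
      by (metis exp_le_cancel_iff exp_ln)
    then show ?thesis by (simp add: algebra_simps)
  qed
  show ?thesis
  proof (cases "0 \<le> s")
    case True
    then show ?thesis using pos assms by simp
  next
    case False
    then have "1 - (1 - p) + (1 - p) * exp (- s) \<le> exp ((1 - p) * (- s) + (- s)\<^sup>2 / 8)"
      using assms by (intro pos) auto
    then have "exp s * (p + (1 - p) * exp (- s)) \<le> exp s * exp ((1 - p) * (- s) + s\<^sup>2 / 8)"
      by (intro mult_left_mono) simp_all
    also have "exp s * exp ((1 - p) * (- s) + s\<^sup>2 / 8) = exp (p * s + s\<^sup>2 / 8)"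
      by (simp add: mult_exp_exp algebra_simps)
    also have "exp s * (p + (1 - p) * exp (- s)) = p * exp s + (1 - p)"
      by (simp add: distrib_left mult.left_commute mult_exp_exp mult.commute[of "exp s" p])
    finally show ?thesis by simp
  qed
qed

text \<open>A reverse Jensen inequality. Under the law tilted by the values themselves, the
  \<alpha>-th moment becomes m times a moment of order \<alpha> - 1. Hoeffding's lemma is applied
  there twice, once to compare y with the mean m and once to that moment; the linear terms cancel
  and only squares of s = ln (x/y) survive.\<close>

lemma two_point_moment_le:
  fixes x y :: real
  assumes p: "0 \<le> p" "p \<le> 1" and xy: "0 < x" "0 < y" "x \<le> exp c * y" "y \<le> exp c * x" and \<alpha>: "1 < \<alpha>"
  shows "(1 - p) * y powr \<alpha> + p * x powr \<alpha>
    \<le> exp (\<alpha> * (\<alpha> - 1) * c\<^sup>2 / 8) * ((1 - p) * y + p * x) powr \<alpha>"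
proof -
  define m where "m = (1 - p) * y + p * x"
  define s where "s = ln (x / y)"
  have m: "0 < m"
    unfolding m_def using p xy by (cases "p = 0") (auto intro: add_nonneg_pos)
  have es: "exp s = x / y" using xy by (simp add: s_def)
  have "x / y \<le> exp c" "y / x \<le> exp c" using xy by (simp_all add: pos_divide_le_eq)
  then have "ln (x / y) \<le> c" "ln (y / x) \<le> c" using xy by (metis divide_pos_pos ln_exp ln_le_cancel_iff exp_gt_zero)+
  then have "s \<le> c" "- c \<le> s" using xy by (simp_all add: s_def ln_div)
  then have s2: "s\<^sup>2 \<le> c\<^sup>2" using \<open>s \<le> c\<close> by (simp add: abs_le_square_iff[symmetric] abs_le_iff)
  \<comment> \<open>The tilted probability of the outcome x.\<close>
  define r where "r = p * x / m"
  have r: "0 \<le> r" "r \<le> 1" using p xy m by (auto simp: r_def m_def)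
  have x: "x = y * exp s" using es xy by simp
  have "1 - r = (1 - p) * y / m"
    using m by (simp add: r_def eq_divide_eq left_diff_distrib) (simp add: m_def algebra_simps)
  moreover have "r * exp (- s) = p * y / m" using xy by (simp add: r_def exp_minus es)
  ultimately have "y / m = 1 - r + r * exp (- s)"
    by (simp add: add_divide_distrib[symmetric]) (simp add: algebra_simps)
  also have "\<dots> \<le> exp (- (r * s) + s\<^sup>2 / 8)" using two_point_mgf_le[OF r, of "- s"] by simp
  finally have "y \<le> m * exp (- (r * s) + s\<^sup>2 / 8)"
    using m by (simp add: pos_divide_le_eq mult.commute)
  then have "y * exp (r * s) \<le> m * exp (- (r * s) + s\<^sup>2 / 8) * exp (r * s)"
    by (intro mult_right_mono) auto
  then have "y * exp (r * s) \<le> m * exp (s\<^sup>2 / 8)"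
    by (simp add: mult.assoc mult_exp_exp)
  then have "(y * exp (r * s)) powr (\<alpha> - 1) \<le> (m * exp (s\<^sup>2 / 8)) powr (\<alpha> - 1)"
    using \<alpha> xy by (intro powr_mono2) auto
  then have 1: "y powr (\<alpha> - 1) * exp (r * s * (\<alpha> - 1)) \<le> m powr (\<alpha> - 1) * exp (s\<^sup>2 / 8 * (\<alpha> - 1))"
    using xy m by (simp add: powr_mult exp_powr_real)
  have "(1 - p) * y powr \<alpha> + p * x powr \<alpha>
      = m * y powr (\<alpha> - 1) * (1 - r + r * exp ((\<alpha> - 1) * s))"
  proof -
    have "y powr \<alpha> = y * y powr (\<alpha> - 1)" "x powr \<alpha> = x * (y powr (\<alpha> - 1) * exp ((\<alpha> - 1) * s))"
      using xy \<alpha> powr_mult_base[of x "\<alpha> - 1"] powr_mult_base[of y "\<alpha> - 1"]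
      by (simp_all add: x powr_mult exp_powr_real mult.commute)
    moreover have "m * r = p * x" "m * (1 - r) = (1 - p) * y"
      using m by (simp_all add: r_def right_diff_distrib) (simp add: m_def)
    moreover have "m * y powr (\<alpha> - 1) * (1 - r + r * exp ((\<alpha> - 1) * s))
      = y powr (\<alpha> - 1) * (m * (1 - r)) + y powr (\<alpha> - 1) * exp ((\<alpha> - 1) * s) * (m * r)"
      by (simp add: algebra_simps)
    ultimately show ?thesis by (simp only: mult_ac)
  qed
  also have "\<dots> \<le> m * y powr (\<alpha> - 1) * exp (r * ((\<alpha> - 1) * s) + ((\<alpha> - 1) * s)\<^sup>2 / 8)"
    using two_point_mgf_le[OF r] m by (intro mult_left_mono) auto
  also have "\<dots> = m * exp (((\<alpha> - 1) * s)\<^sup>2 / 8) * (y powr (\<alpha> - 1) * exp (r * s * (\<alpha> - 1)))"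
    by (simp add: exp_add mult_ac)
  also have "\<dots> \<le> m * exp (((\<alpha> - 1) * s)\<^sup>2 / 8) * (m powr (\<alpha> - 1) * exp (s\<^sup>2 / 8 * (\<alpha> - 1)))"
    using 1 m by (intro mult_left_mono) auto
  also have "\<dots> = m powr \<alpha> * exp (((\<alpha> - 1) * s)\<^sup>2 / 8 + s\<^sup>2 / 8 * (\<alpha> - 1))"
    using m powr_mult_base[of m "\<alpha> - 1"] by (simp add: exp_add mult_ac)
  \<comment> \<open>(\<alpha> - 1)^2 from the moment plus \<alpha> - 1 from the comparison with the
    mean gives \<alpha> (\<alpha> - 1).\<close>
  also have "((\<alpha> - 1) * s)\<^sup>2 / 8 + s\<^sup>2 / 8 * (\<alpha> - 1) = \<alpha> * (\<alpha> - 1) * s\<^sup>2 / 8"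
    by (simp add: power2_eq_square field_simps)
  also have "m powr \<alpha> * exp (\<alpha> * (\<alpha> - 1) * s\<^sup>2 / 8) \<le> m powr \<alpha> * exp (\<alpha> * (\<alpha> - 1) * c\<^sup>2 / 8)"
    using s2 \<alpha> by (intro mult_left_mono) (auto intro!: divide_right_mono mult_left_mono)
  finally show ?thesis by (simp add: m_def mult.commute)
qed

definition weighted_sum :: "nat \<Rightarrow> (int \<Rightarrow> real) \<Rightarrow> (nat \<Rightarrow> real) \<Rightarrow> real" where
  "weighted_sum n r h = (\<Sum>k\<le>n. r (int k) * h k)"

text \<open>A multiplicative form of the condition that ln h is Lipschitz with constant c on {0..n};
  no logarithms have to be handled.\<close>

definition slowly_varying :: "nat \<Rightarrow> real \<Rightarrow> (nat \<Rightarrow> real) \<Rightarrow> bool" where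
  "slowly_varying n c h \<longleftrightarrow> (\<forall>k\<le>n. 0 < h k) \<and>
     (\<forall>k<n. h (Suc k) \<le> exp c * h k \<and> h k \<le> exp c * h (Suc k))"

text \<open>Convolution is adjoint to averaging: the coin moves from the law into the function,
  which is how one coin is integrated out.\<close>

lemma weighted_sum_coin_step:
  assumes "r (-1) = 0" "r (int (Suc n)) = 0"
  shows "weighted_sum (Suc n) (coin_step p r) h
    = weighted_sum n r (\<lambda>k. (1 - p) * h k + p * h (Suc k))"
proof -
  have "weighted_sum (Suc n) (coin_step p r) h
    = (\<Sum>k\<le>Suc n. (1 - p) * r (int k) * h k) + (\<Sum>k\<le>Suc n. p * r (int k - 1) * h k)"
    unfolding weighted_sum_def sum.distrib[symmetric] by (simp add: coin_step_def distrib_right)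
  also have "(\<Sum>k\<le>Suc n. (1 - p) * r (int k) * h k) = (\<Sum>k\<le>n. (1 - p) * r (int k) * h k)"
    using assms by simp
  also have "(\<Sum>k\<le>Suc n. p * r (int k - 1) * h k) = (\<Sum>k\<le>n. p * r (int k) * h (Suc k))"
    unfolding sum.atMost_Suc_shift using assms by simp
  finally show ?thesis
    by (simp add: weighted_sum_def sum.distrib[symmetric] algebra_simps)
qed

text \<open>The constant c does not deteriorate when a coin is integrated out, so every coin can be
  charged the same price.\<close>

lemma slowly_varying_average:
  assumes "slowly_varying (Suc n) c h" "0 \<le> p" "p \<le> 1"
  shows "slowly_varying n c (\<lambda>k. (1 - p) * h k + p * h (Suc k))"
  unfolding slowly_varying_def
proof (intro conjI allI impI)
  fix k assume "k \<le> n"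
  then have "0 < h k" "0 < h (Suc k)" using assms by (auto simp: slowly_varying_def)
  then show "0 < (1 - p) * h k + p * h (Suc k)"
    using assms by (cases "p = 0") (auto intro: add_nonneg_pos)
next
  fix k assume "k < n"
  then have h: "h (Suc k) \<le> exp c * h k" "h k \<le> exp c * h (Suc k)"
    "h (Suc (Suc k)) \<le> exp c * h (Suc k)" "h (Suc k) \<le> exp c * h (Suc (Suc k))"
    using assms(1) unfolding slowly_varying_def by auto
  have "(1 - p) * h (Suc k) + p * h (Suc (Suc k)) \<le> (1 - p) * (exp c * h k) + p * (exp c * h (Suc k))"
    "(1 - p) * h k + p * h (Suc k) \<le> (1 - p) * (exp c * h (Suc k)) + p * (exp c * h (Suc (Suc k)))"
    using h assms by (auto intro!: add_mono mult_left_mono)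
  then show "(1 - p) * h (Suc k) + p * h (Suc (Suc k)) \<le> exp c * ((1 - p) * h k + p * h (Suc k))"
    "(1 - p) * h k + p * h (Suc k) \<le> exp c * ((1 - p) * h (Suc k) + p * h (Suc (Suc k)))"
    by (simp_all add: algebra_simps)
qed

text \<open>For each value k of the remaining total, the last coin chooses between h(k) and h(k+1),
  whose ratio is within exp c, so \<open>two_point_moment_le\<close> charges one factor for it. The
  induction quantifies over h because the averaged function takes its place.\<close>

lemma coins_moment_le:
  assumes p: "0 < p" "p < 1" and "1 < \<alpha>" "slowly_varying (a + b) c h"
  shows "weighted_sum (a + b) (coins p a b) (\<lambda>k. h k powr \<alpha>)
    \<le> exp (\<alpha> * (\<alpha> - 1) * real (a + b) * c\<^sup>2 / 8) * weighted_sum (a + b) (coins p a b) h powr \<alpha>"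
proof -
  define C where "C = exp (\<alpha> * (\<alpha> - 1) * c\<^sup>2 / 8)"
  have step: "\<forall>h. slowly_varying (Suc (a + b)) c h \<longrightarrow>
      weighted_sum (Suc (a + b)) (coin_step t (coins p a b)) (\<lambda>k. h k powr \<alpha>)
        \<le> C ^ Suc (a + b) * weighted_sum (Suc (a + b)) (coin_step t (coins p a b)) h powr \<alpha>"
    if IH: "\<forall>h. slowly_varying (a + b) c h \<longrightarrow> weighted_sum (a + b) (coins p a b) (\<lambda>k. h k powr \<alpha>)
        \<le> C ^ (a + b) * weighted_sum (a + b) (coins p a b) h powr \<alpha>"
      and t: "0 \<le> t" "t \<le> 1" for t a b
  proof (intro allI impI)
    fix h assume h: "slowly_varying (Suc (a + b)) c h"
    define h' where "h' k = (1 - t) * h k + t * h (Suc k)" for k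
    have supp: "coins p a b (-1) = 0" "coins p a b (int (Suc (a + b))) = 0"
      using coins_pos[OF p] by simp_all
    have "weighted_sum (Suc (a + b)) (coin_step t (coins p a b)) (\<lambda>k. h k powr \<alpha>)
      = weighted_sum (a + b) (coins p a b) (\<lambda>k. (1 - t) * h k powr \<alpha> + t * h (Suc k) powr \<alpha>)"
      by (rule weighted_sum_coin_step[OF supp])
    also have "\<dots> \<le> weighted_sum (a + b) (coins p a b) (\<lambda>k. C * h' k powr \<alpha>)"
      unfolding weighted_sum_def
    proof (intro sum_mono mult_left_mono)
      fix k assume k: "k \<in> {..a + b}"
      then show "(1 - t) * h k powr \<alpha> + t * h (Suc k) powr \<alpha> \<le> C * h' k powr \<alpha>"
        unfolding h'_def C_def using h t \<open>1 < \<alpha>\<close>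
        by (intro two_point_moment_le) (auto simp: slowly_varying_def)
    qed (rule coins_nonneg[OF p])
    also have "\<dots> = C * weighted_sum (a + b) (coins p a b) (\<lambda>k. h' k powr \<alpha>)"
      by (simp add: weighted_sum_def sum_distrib_left mult.left_commute)
    also have "\<dots> \<le> C * (C ^ (a + b) * weighted_sum (a + b) (coins p a b) h' powr \<alpha>)"
      using IH slowly_varying_average[OF h t] unfolding h'_def[symmetric]
      by (intro mult_left_mono) (auto simp: C_def)
    also have "weighted_sum (a + b) (coins p a b) h'
        = weighted_sum (Suc (a + b)) (coin_step t (coins p a b)) h"
      unfolding h'_def by (rule weighted_sum_coin_step[OF supp, symmetric])
    finally show "weighted_sum (Suc (a + b)) (coin_step t (coins p a b)) (\<lambda>k. h k powr \<alpha>)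
        \<le> C ^ Suc (a + b) * weighted_sum (Suc (a + b)) (coin_step t (coins p a b)) h powr \<alpha>"
      by simp
  qed
  have "\<forall>h. slowly_varying (a + b) c h \<longrightarrow> weighted_sum (a + b) (coins p a b) (\<lambda>k. h k powr \<alpha>)
        \<le> C ^ (a + b) * weighted_sum (a + b) (coins p a b) h powr \<alpha>"
  proof (induction rule: coins_induct)
    case base
    show ?case by (simp add: weighted_sum_def coins_0_0)
  next
    case (left a b)
    then show ?case by (rule step) (use p in auto)
  next
    case (right a b)
    then show ?case by (rule step) (use p in auto)
  qed
  moreover have "C ^ (a + b) = exp (\<alpha> * (\<alpha> - 1) * real (a + b) * c\<^sup>2 / 8)"
    by (simp add: C_def mult_ac flip: exp_of_nat_mult)
  ultimately show ?thesis using assms(4) by simp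
qed

lemma hoelder_dominated_coins:
  assumes p: "0 < p" "p < 1" and \<alpha>: "1 < \<alpha>"
    and P: "\<And>k. pmf P k = coins p a b (int k)" and Q: "\<And>k. pmf Q k = coins p a' b' (int k)"
    and n: "a + b = n" "a' + b' = n" and ratio: "slowly_varying n c (\<lambda>k. pmf P k / pmf Q k)"
  shows "hoelder_dominated \<alpha> (exp ((\<alpha> - 1) * real n * c\<^sup>2 / 8)) P Q"
proof -
  define f where "f k = pmf P k / pmf Q k" for k
  have pos: "0 < pmf P k" "0 < pmf Q k" if "k \<le> n" for k
    using that coins_pos[OF p] n by (auto simp: P Q)
  have zero: "pmf P k = 0" "pmf Q k = 0" if "n < k" for k
    using that coins_pos[OF p] n by (auto simp: P Q)
  have E: "measure_pmf.expectation Q g = weighted_sum n (coins p a' b') g" for g :: "nat \<Rightarrow> real"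
    unfolding weighted_sum_def
    by (subst integral_measure_pmf_real[where A = "{..n}"])
       (auto simp: Q mult.commute set_pmf_iff not_le[symmetric] intro: ccontr zero(2)[unfolded Q])
  \<comment> \<open>Both laws have support {0..n}, so the likelihood ratio has mean 1 and only the
    exponential factor of the moment bound remains.\<close>
  have "weighted_sum n (coins p a' b') f = (\<Sum>k\<le>n. pmf P k)"
    unfolding weighted_sum_def using pos(2)[THEN less_imp_neq, THEN not_sym]
    by (intro sum.cong) (auto simp: f_def Q[symmetric])
  also have "\<dots> = 1"
    by (rule sum_pmf_eq_1) (use zero(1) in \<open>auto simp: set_pmf_iff not_less[symmetric]\<close>)
  finally have Ef: "weighted_sum n (coins p a' b') f = 1" .
  have sv: "slowly_varying n c f" using ratio by (simp add: f_def[abs_def])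
  show ?thesis
  proof (rule hoelder_dominated_density[where f = f and C = "\<Sum>k\<le>n. f k"])
    show "measure_pmf.expectation Q (\<lambda>k. f k powr \<alpha>) \<le> exp ((\<alpha> - 1) * real n * c\<^sup>2 / 8) powr \<alpha>"
      unfolding E using coins_moment_le[OF p \<alpha>, of a' b' c f] sv n Ef
      by (simp add: exp_powr_real mult_ac)
    show "f k \<le> (\<Sum>k\<le>n. f k)" for k
    proof (cases "k \<le> n")
      case True
      then show ?thesis by (intro member_le_sum) (auto simp: f_def)
    qed (auto simp: f_def zero not_le intro!: sum_nonneg)
    show "pmf P k = f k * pmf Q k" for k
      using pos[of k] zero[of k] by (cases "k \<le> n") (auto simp: f_def)
  qed (use \<alpha> in \<open>auto simp: f_def\<close>)
qed

text \<open>Consecutive values of P/Q have a quotient between 1 and exp c, so P/Q and its inverse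
  are both slowly varying. The two directions are needed because a changed record may raise or lower
  the bias.\<close>

lemma hoelder_dominated_coins_swap:
  assumes \<theta>: "0 \<le> \<theta>" "\<theta> \<le> 1 / 4" and "1 < \<alpha>"
  defines "p \<equiv> 1 / 2 + \<theta>"
  assumes P: "\<And>k. pmf P k = coins p (a + l) b (int k)" and Q: "\<And>k. pmf Q k = coins p a (b + l) (int k)"
  defines "K \<equiv> exp ((\<alpha> - 1) * real (a + b + l) * (288 * \<theta> * real l / real (a + b + l))\<^sup>2 / 8)"
  shows "hoelder_dominated \<alpha> K P Q" "hoelder_dominated \<alpha> K Q P"
proof -
  let ?n = "a + b + l" and ?c = "288 * \<theta> * real l / real (a + b + l)"
  have p: "0 < p" "p < 1" using \<theta> by (auto simp: p_def)
  have pos: "0 < pmf P k" "0 < pmf Q k" if "k \<le> ?n" for k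
    using that coins_pos[OF p] by (auto simp: P Q)
  have c0: "1 \<le> exp ?c" using \<theta> by simp
  have ratio: "pmf Q (Suc k) / pmf Q k \<le> pmf P (Suc k) / pmf P k"
    "pmf P (Suc k) / pmf P k \<le> exp ?c * (pmf Q (Suc k) / pmf Q k)" if "k < ?n" for k
    using that coins_likelihood_ratio[OF \<theta>, of "int k" a b l]
    by (auto simp: P Q p_def add.commute)
  have r: "pmf Q (Suc k) * pmf P k \<le> pmf P (Suc k) * pmf Q k"
    "pmf P (Suc k) * pmf Q k \<le> exp ?c * (pmf Q (Suc k) * pmf P k)" if "k < ?n" for k
    using ratio[OF that] pos[of k] that by (auto simp: pos_divide_le_eq pos_le_divide_eq mult_ac)
  have r': "pmf Q (Suc k) * pmf P k \<le> exp ?c * (pmf P (Suc k) * pmf Q k)" if "k < ?n" for k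
    using mult_mono[OF c0 r(1)[OF that]] by simp
  have sv: "slowly_varying ?n ?c (\<lambda>k. pmf P k / pmf Q k)"
    "slowly_varying ?n ?c (\<lambda>k. pmf Q k / pmf P k)"
    unfolding slowly_varying_def using r r' pos
    by (auto simp: pos_divide_le_eq pos_le_divide_eq mult_ac Suc_le_eq)
  show "hoelder_dominated \<alpha> K P Q" "hoelder_dominated \<alpha> K Q P"
    unfolding K_def
    by (rule hoelder_dominated_coins[OF p \<open>1 < \<alpha>\<close> P Q _ _ sv(1)]; simp)
       (rule hoelder_dominated_coins[OF p \<open>1 < \<alpha>\<close> Q P _ _ sv(2)]; simp)
qed

section \<open>Aggregated reports\<close>

definition count_law :: "nat pmf \<Rightarrow> int \<Rightarrow> real" where
  "count_law M z = (if 0 \<le> z then pmf M (nat z) else 0)"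

lemma count_law_of_nat [simp]: "count_law M (int k) = pmf M k"
  by (simp add: count_law_def)

lemma count_law_add_bernoulli:
  assumes "0 \<le> p" "p \<le> 1"
  shows "count_law (do {b \<leftarrow> bernoulli_pmf p; k \<leftarrow> M; return_pmf ((if b then 1 else 0) + k)})
    = coin_step p (count_law M)"
proof
  fix z :: int
  have "pmf (map_pmf Suc M) k = (if k = 0 then 0 else pmf M (k - 1))" for k
    by (cases k) (auto simp: pmf_map_inj' pmf_eq_0_set_pmf)
  moreover have "pmf (do {b \<leftarrow> bernoulli_pmf p; k \<leftarrow> M; return_pmf ((if b then 1 else 0) + k)}) k
    = p * pmf (map_pmf Suc M) k + (1 - p) * pmf M k" for k
    using assms by (subst pmf_bind) (simp add: map_pmf_def bind_return_pmf')
  ultimately show "count_law (do {b \<leftarrow> bernoulli_pmf p; k \<leftarrow> M; return_pmf ((if b then 1 else 0) + k)}) z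
    = coin_step p (count_law M) z"
    by (auto simp: count_law_def coin_step_def nat_diff_distrib)
qed

lemma count_law_add_binomial:
  assumes p: "0 \<le> p" "p \<le> 1"
  shows "count_law (do {b \<leftarrow> binomial_pmf n p; k \<leftarrow> M; return_pmf (b + k)})
    = (coin_step p ^^ n) (count_law M)"
proof (induction n)
  case 0
  then show ?case using p by (simp add: binomial_pmf_0 bind_return_pmf bind_return_pmf')
next
  case (Suc n)
  have "do {b \<leftarrow> binomial_pmf (Suc n) p; k \<leftarrow> M; return_pmf (b + k)}
    = do {b \<leftarrow> bernoulli_pmf p; k \<leftarrow> do {b \<leftarrow> binomial_pmf n p; k \<leftarrow> M; return_pmf (b + k)};
          return_pmf ((if b then 1 else 0) + k)}"
    using p by (simp add: binomial_pmf_Suc bind_assoc_pmf bind_return_pmf add.assoc)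
  then show ?case using p by (simp add: count_law_add_bernoulli Suc.IH)
qed

definition binomial_sum :: "nat \<Rightarrow> 'a set \<Rightarrow> ('a \<Rightarrow> real) \<Rightarrow> nat pmf" where
  "binomial_sum L I p = map_pmf (\<lambda>f. \<Sum>i\<in>I. f i) (Pi_pmf I 0 (\<lambda>i. binomial_pmf L (p i)))"

lemma binomial_sum_insert:
  assumes "finite I" "x \<notin> I"
  shows "binomial_sum L (insert x I) p
    = do {b \<leftarrow> binomial_pmf L (p x); k \<leftarrow> binomial_sum L I p; return_pmf (b + k)}"
proof -
  have "(\<Sum>i\<in>insert x I. (f(x := y)) i) = y + (\<Sum>i\<in>I. f i)" for f and y :: nat
    using assms by (simp add: sum.insert) (intro sum.cong, auto)
  then show ?thesis
    using assms unfolding binomial_sum_def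
    by (simp add: Pi_pmf_insert' map_bind_pmf bind_map_pmf map_pmf_def bind_assoc_pmf bind_return_pmf)
qed

text \<open>Each user contributes L coins of one bias. The second class is
  \<open>ps i \<noteq> p\<close> and not \<open>ps i = 1 - p\<close>, so that the classes partition
  I also when p = 1/2.\<close>

lemma count_law_binomial_sum:
  assumes "finite I" "0 \<le> p" "p \<le> 1" "\<And>i. i \<in> I \<Longrightarrow> ps i = p \<or> ps i = 1 - p"
  shows "count_law (binomial_sum L I ps)
    = coins p (L * card {i \<in> I. ps i = p}) (L * card {i \<in> I. ps i \<noteq> p})"
  using assms(1,4)
proof (induction I rule: finite_induct)
  case empty
  show ?case by (auto simp: binomial_sum_def count_law_def coins_0_0 fun_eq_iff indicator_def)
next
  case (insert x I)
  have ps: "0 \<le> ps x" "ps x \<le> 1" using insert assms by fastforce+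
  have "count_law (binomial_sum L (insert x I) ps)
      = (coin_step (ps x) ^^ L) (coins p (L * card {i \<in> I. ps i = p}) (L * card {i \<in> I. ps i \<noteq> p}))"
    using insert by (simp add: binomial_sum_insert count_law_add_binomial[OF ps])
  moreover have "{i \<in> insert x I. ps i = p} = (if ps x = p then insert x {i \<in> I. ps i = p} else {i \<in> I. ps i = p})"
    "{i \<in> insert x I. ps i \<noteq> p} = (if ps x = p then {i \<in> I. ps i \<noteq> p} else insert x {i \<in> I. ps i \<noteq> p})"
    by auto
  moreover have "ps x \<noteq> p \<Longrightarrow> ps x = 1 - p" using insert.prems by auto
  ultimately show ?case
    using insert coins_add_left[of p "L * card {i \<in> I. ps i = p}" L "L * card {i \<in> I. ps i \<noteq> p}"]
      coins_add_right[of p "L * card {i \<in> I. ps i = p}" "L * card {i \<in> I. ps i \<noteq> p}" L]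
    by (auto simp: add.commute)
qed

lemma binomial_sum_privacy:
  assumes I: "finite I" "i\<^sub>0 \<in> I" and "0 < L" and \<theta>: "0 \<le> \<theta>" "\<theta> \<le> 1 / 4" and \<alpha>: "1 < \<alpha>"
    and ps: "\<And>i. i \<in> I \<Longrightarrow> ps i \<in> {1 / 2 + \<theta>, 1 / 2 - \<theta>}" "\<And>i. i \<in> I \<Longrightarrow> ps' i \<in> {1 / 2 + \<theta>, 1 / 2 - \<theta>}"
    and eq: "\<And>i. i \<in> I \<Longrightarrow> i \<noteq> i\<^sub>0 \<Longrightarrow> ps i = ps' i"
  shows "hoelder_dominated \<alpha> (exp ((\<alpha> - 1) * (10368 * \<theta>\<^sup>2 * L / card I))) (binomial_sum L I ps) (binomial_sum L I ps')"
proof (cases "ps i\<^sub>0 = ps' i\<^sub>0")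
  case True
  then have "binomial_sum L I ps = binomial_sum L I ps'"
    unfolding binomial_sum_def using eq by (intro arg_cong[where f = "map_pmf _"] Pi_pmf_cong) (auto, metis)
  moreover have "1 \<le> exp ((\<alpha> - 1) * (10368 * \<theta>\<^sup>2 * L / card I))" using \<alpha> by simp
  ultimately show ?thesis by (metis hoelder_dominated_mono hoelder_dominated_refl \<alpha>)
next
  case False
  define p where "p = 1 / 2 + \<theta>"
  have p: "0 \<le> p" "p \<le> 1" "1 - p = 1 / 2 - \<theta>" using \<theta> by (auto simp: p_def)
  define J where "J = I - {i\<^sub>0}"
  define a where "a = L * card {i \<in> J. ps i = p}"
  define b where "b = L * card {i \<in> J. ps i \<noteq> p}"
  have J: "finite J" "i\<^sub>0 \<notin> J" "I = insert i\<^sub>0 J" using I by (auto simp: J_def)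
  have law: "count_law (binomial_sum L I rs) = (coin_step (rs i\<^sub>0) ^^ L) (coins p a b)"
    if "\<And>i. i \<in> I \<Longrightarrow> rs i \<in> {p, 1 - p}" "\<And>i. i \<in> J \<Longrightarrow> rs i = ps i" for rs
  proof -
    have rs: "0 \<le> rs i\<^sub>0" "rs i\<^sub>0 \<le> 1" using that(1)[OF I(2)] p by auto
    have "{i \<in> J. rs i = p} = {i \<in> J. ps i = p}" "{i \<in> J. rs i \<noteq> p} = {i \<in> J. ps i \<noteq> p}"
      using that(2) by auto
    then have "count_law (binomial_sum L J rs) = coins p a b"
      using count_law_binomial_sum[OF J(1) p(1,2), of rs L] that(1) J by (auto simp: a_def b_def)
    then show ?thesis
      using J rs by (simp add: binomial_sum_insert count_law_add_binomial)
  qed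
  have "card {i \<in> J. ps i = p} + card {i \<in> J. ps i \<noteq> p} = card ({i \<in> J. ps i = p} \<union> {i \<in> J. ps i \<noteq> p})"
    using J by (intro card_Un_disjoint[symmetric]) auto
  also have "{i \<in> J. ps i = p} \<union> {i \<in> J. ps i \<noteq> p} = J" by auto
  finally have "card I = Suc (card {i \<in> J. ps i = p} + card {i \<in> J. ps i \<noteq> p})" using J by simp
  then have n: "a + b + L = L * card I" by (simp add: a_def b_def algebra_simps)
  have cI: "0 < card I" using I by (auto simp: card_gt_0_iff)
  \<comment> \<open>10368 = 288^2 / 8. There are \<open>L * card I\<close> coins, and the Lipschitz
    constant is \<open>288 * \<theta> / card I\<close>.\<close>
  have K: "exp ((\<alpha> - 1) * real (a + b + L) * (288 * \<theta> * real L / real (a + b + L))\<^sup>2 / 8)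
    = exp ((\<alpha> - 1) * (10368 * \<theta>\<^sup>2 * L / card I))"
    unfolding n using \<open>0 < L\<close> cI by (simp add: power2_eq_square field_simps)
  have eq': "ps' i = ps i" if "i \<in> J" for i using eq that by (metis J(2,3) insertI2)
  have P: "count_law (binomial_sum L I ps) = (coin_step (ps i\<^sub>0) ^^ L) (coins p a b)"
    "count_law (binomial_sum L I ps') = (coin_step (ps' i\<^sub>0) ^^ L) (coins p a b)"
    using ps eq' p by (intro law; auto simp: p_def)+
  have "ps i\<^sub>0 = p \<and> ps' i\<^sub>0 = 1 - p \<or> ps i\<^sub>0 = 1 - p \<and> ps' i\<^sub>0 = p"
    using ps[OF I(2)] False p by (auto simp: p_def)
  then show ?thesis
  proof
    assume *: "ps i\<^sub>0 = p \<and> ps' i\<^sub>0 = 1 - p"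
    have "pmf (binomial_sum L I ps) k = coins p (a + L) b (int k)"
      "pmf (binomial_sum L I ps') k = coins p a (b + L) (int k)" for k
      using P * by (simp_all add: coins_add_left coins_add_right flip: count_law_of_nat)
    then show ?thesis
      using hoelder_dominated_coins_swap(1)[OF \<theta> \<alpha>, of _ a L b, folded p_def] K by metis
  next
    assume *: "ps i\<^sub>0 = 1 - p \<and> ps' i\<^sub>0 = p"
    have "pmf (binomial_sum L I ps') k = coins p (a + L) b (int k)"
      "pmf (binomial_sum L I ps) k = coins p a (b + L) (int k)" for k
      using P * by (simp_all add: coins_add_left coins_add_right flip: count_law_of_nat)
    then show ?thesis
      using hoelder_dominated_coins_swap(2)[OF \<theta> \<alpha>, of _ a L b, folded p_def] K by metis
  qed
qed

subsection \<open>Products of product distributions\<close>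

lemma Pi_pmf_times:
  assumes "finite A" "finite B"
  shows "map_pmf curry (Pi_pmf (A \<times> B) d P) = Pi_pmf A (\<lambda>_. d) (\<lambda>a. Pi_pmf B d (\<lambda>b. P (a, b)))"
proof (rule pmf_eqI)
  fix f :: "'a \<Rightarrow> 'b \<Rightarrow> 'c"
  have "inj (curry :: ('a \<times> 'b \<Rightarrow> 'c) \<Rightarrow> _)" by (auto simp: inj_def fun_eq_iff)
  then have "pmf (map_pmf curry (Pi_pmf (A \<times> B) d P)) (curry (case_prod f)) = pmf (Pi_pmf (A \<times> B) d P) (case_prod f)"
    by (rule pmf_map_inj')
  moreover have "pmf (Pi_pmf (A \<times> B) d P) (case_prod f)
    = pmf (Pi_pmf A (\<lambda>_. d) (\<lambda>a. Pi_pmf B d (\<lambda>b. P (a, b)))) f"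
  proof (cases "\<forall>x. x \<notin> A \<times> B \<longrightarrow> case_prod f x = d")
    case True
    then have "\<forall>a. a \<notin> A \<longrightarrow> f a = (\<lambda>_. d)" "\<forall>a\<in>A. \<forall>b. b \<notin> B \<longrightarrow> f a b = d" by auto
    then show ?thesis
      using assms True by (simp add: pmf_Pi prod.cartesian_product case_prod_unfold)
  next
    case False
    then obtain a b where ab: "(a, b) \<notin> A \<times> B" "f a b \<noteq> d" by auto
    show ?thesis
    proof (cases "a \<in> A")
      case True
      then have "pmf (Pi_pmf B d (\<lambda>b. P (a, b))) (f a) = 0" using ab assms by (auto simp: pmf_Pi)
      then have "(\<Prod>a\<in>A. pmf (Pi_pmf B d (\<lambda>b. P (a, b))) (f a)) = 0"
        using True assms by (auto intro: prod_zero)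
      then have "pmf (Pi_pmf A (\<lambda>_. d) (\<lambda>a. Pi_pmf B d (\<lambda>b. P (a, b)))) f = 0"
        using assms by (simp only: pmf_Pi[of A] if_cancel)
      moreover have "pmf (Pi_pmf (A \<times> B) d P) (case_prod f) = 0"
        using False assms by (intro pmf_Pi_outside) auto
      ultimately show ?thesis by simp
    next
      case False
      then have "f a \<noteq> (\<lambda>_. d)" using ab by auto
      then show ?thesis using False ab assms by (auto simp: pmf_Pi)
    qed
  qed
  ultimately show "pmf (map_pmf curry (Pi_pmf (A \<times> B) d P)) f
    = pmf (Pi_pmf A (\<lambda>_. d) (\<lambda>a. Pi_pmf B d (\<lambda>b. P (a, b)))) f" by simp
qed

text \<open>Used to exchange the order of user, row and bucket. The bijection acts on the whole
  index type, so the default values outside A are carried along.\<close>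

lemma Pi_pmf_reindex:
  assumes "finite A" "bij h"
  shows "map_pmf (\<lambda>f. f \<circ> h) (Pi_pmf A d P) = Pi_pmf (h -` A) d (\<lambda>x. P (h x))"
proof (rule pmf_eqI)
  fix f :: "'b \<Rightarrow> 'c"
  have h: "surj h" "inj h" using assms by (auto simp: bij_def)
  have "inj (\<lambda>f :: 'a \<Rightarrow> 'c. f \<circ> h)" using h(1) by (auto simp: inj_def fun_eq_iff) (metis surjD)
  then have "pmf (map_pmf (\<lambda>f. f \<circ> h) (Pi_pmf A d P)) ((f \<circ> inv_into UNIV h) \<circ> h) = pmf (Pi_pmf A d P) (f \<circ> inv_into UNIV h)"
    by (rule pmf_map_inj'[where f = "\<lambda>f. f \<circ> h"])
  moreover have "(f \<circ> inv_into UNIV h) \<circ> h = f" using h by (simp add: fun_eq_iff)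
  moreover have "pmf (Pi_pmf A d P) (f \<circ> inv_into UNIV h) = pmf (Pi_pmf (h -` A) d (\<lambda>x. P (h x))) f"
  proof -
    have "finite (h -` A)" using assms h by (intro finite_vimageI)
    moreover have "(\<forall>x. x \<notin> A \<longrightarrow> f (inv_into UNIV h x) = d) \<longleftrightarrow> (\<forall>x. x \<notin> h -` A \<longrightarrow> f x = d)"
      using h by (metis inv_f_f surj_f_inv_f vimage_eq)
    moreover have "(\<Prod>x\<in>A. pmf (P x) (f (inv_into UNIV h x))) = (\<Prod>x\<in>h -` A. pmf (P (h x)) (f x))"
      using h by (intro prod.reindex_bij_witness[where i = h and j = "inv_into UNIV h"]) (auto simp: surj_f_inv_f)
    ultimately show ?thesis using assms by (auto simp: pmf_Pi)
  qed
  ultimately show "pmf (map_pmf (\<lambda>f. f \<circ> h) (Pi_pmf A d P)) f = pmf (Pi_pmf (h -` A) d (\<lambda>x. P (h x))) f" by simp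
qed

section \<open>The noisy sketch in terms of the aggregated reports\<close>

lemma hadamard_carrier: "hadamard q \<in> carrier_mat (2 ^ q) (2 ^ q)"
  by (induction q) (auto simp: mult_2)

lemma hadamard_dims [simp]: "dim_row (hadamard q) = 2 ^ q" "dim_col (hadamard q) = 2 ^ q"
  using hadamard_carrier[of q] by auto

lemma hadamard_entry:
  "i < 2 ^ q \<Longrightarrow> j < 2 ^ q \<Longrightarrow> sqrt (2 ^ q) * hadamard q $$ (i, j) \<in> {-1, 1}"
proof (induction q arbitrary: i j)
  case (Suc q)
  have "sqrt (2 ^ Suc q) * hadamard (Suc q) $$ (i, j)
    = sqrt (2 ^ q) * four_block_mat (hadamard q) (hadamard q) (hadamard q) (- hadamard q) $$ (i, j)"
    using Suc.prems by (simp add: real_sqrt_mult)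
  moreover have "i - 2 ^ q < 2 ^ q" "j - 2 ^ q < 2 ^ q" using Suc.prems by auto
  ultimately show ?case using Suc by (auto simp: not_less)
qed simp

lemma hadamard_involution: "hadamard q * hadamard q = 1\<^sub>m (2 ^ q)"
proof (induction q)
  case (Suc q)
  let ?H = "hadamard q" and ?n = "2 ^ q :: nat"
  let ?F = "four_block_mat ?H ?H ?H (- ?H)"
  note H = hadamard_carrier[of q]
  have F: "?F \<in> carrier_mat (?n + ?n) (?n + ?n)" using H by auto
  have smult: "a \<cdot>\<^sub>m (b \<cdot>\<^sub>m A) = (a * b) \<cdot>\<^sub>m A" for a b :: real and A by (rule eq_matI) auto
  have mm: "?H * (- ?H) = - 1\<^sub>m ?n" "(- ?H) * ?H = - 1\<^sub>m ?n" "(- ?H) * (- ?H) = 1\<^sub>m ?n"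
    using H Suc by (simp_all add: uminus_mult_left_mat uminus_mult_right_mat)
  have "?F * ?F = four_block_mat (1\<^sub>m ?n + 1\<^sub>m ?n) (1\<^sub>m ?n + - 1\<^sub>m ?n) (1\<^sub>m ?n + - 1\<^sub>m ?n) (1\<^sub>m ?n + 1\<^sub>m ?n)"
    using H by (subst mult_four_block_mat[OF H H H _ H H H]) (auto simp: Suc mm)
  then have "hadamard (Suc q) * hadamard (Suc q) = (1 / sqrt 2 * (1 / sqrt 2)) \<cdot>\<^sub>m
    four_block_mat (1\<^sub>m ?n + 1\<^sub>m ?n) (1\<^sub>m ?n + - 1\<^sub>m ?n) (1\<^sub>m ?n + - 1\<^sub>m ?n) (1\<^sub>m ?n + 1\<^sub>m ?n)"
    using mult_smult_assoc_mat[OF F, of "1 / sqrt 2 \<cdot>\<^sub>m ?F" "?n + ?n" "1 / sqrt 2"]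
      mult_smult_distrib[OF F F, of "1 / sqrt 2"] F
    by (simp add: smult)
  also have "\<dots> = 1\<^sub>m (2 ^ Suc q)"
    by (rule eq_matI) (auto simp: not_less)
  finally show ?case .
qed (auto intro!: eq_matI)

lemma hadamard_sum_sq: "k < 2 ^ q \<Longrightarrow> (\<Sum>m<2 ^ q. (hadamard q $$ (k, m))\<^sup>2) = 1"
proof -
  assume k: "k < 2 ^ q"
  have "(hadamard q $$ (k, m))\<^sup>2 = 1 / 2 ^ q" if "m < 2 ^ q" for m
  proof -
    have "(sqrt (2 ^ q) * hadamard q $$ (k, m))\<^sup>2 = 1" using hadamard_entry[OF k that] by auto
    then show ?thesis by (simp add: power_mult_distrib field_simps)
  qed
  then show ?thesis by simp
qed

lemma hadamard_twice:
  assumes "k < 2 ^ q" "j < 2 ^ q"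
  shows "(\<Sum>m<2 ^ q. hadamard q $$ (k, m) * hadamard q $$ (m, j)) = of_bool (k = j)"
proof -
  have "(\<Sum>m<2 ^ q. hadamard q $$ (k, m) * hadamard q $$ (m, j)) = (hadamard q * hadamard q) $$ (k, j)"
    using assms by (simp add: scalar_prod_def atLeast0LessThan)
  also have "\<dots> = of_bool (k = j)" using assms by (simp add: hadamard_involution)
  finally show ?thesis .
qed

lemma hadamard_mult_vec:
  "k < 2 ^ q \<Longrightarrow> (hadamard q *\<^sub>v vec (2 ^ q) f) $ k = (\<Sum>m<2 ^ q. hadamard q $$ (k, m) * f m)"
  by (simp add: scalar_prod_def atLeast0LessThan)

section \<open>Report probabilities of one-hot inputs\<close>

lemma count_sketch_unit_vec:
  "l < d \<Longrightarrow> count_sketch w d (h, s) *\<^sub>v unit_vec d l = vec w (\<lambda>k. s l * of_bool (h l = k))"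
  by (rule eq_vecI) (auto simp: count_sketch_def scalar_prod_right_unit)

text \<open>A one-hot input picks out one signed column of the Hadamard matrix, which the scaling by
  sqrt w turns into signs. Hence every report has bias 1/2 + \<theta> or 1/2 - \<theta>, and bucket
  totals are coin laws with two opposite biases.\<close>

lemma report_probs_unit_vec:
  assumes "l < d" "k < 2 ^ q" "h l < 2 ^ q"
  shows "report_probs q \<theta> (count_sketch (2 ^ q) d (h, s)) (unit_vec d l) $ k
    = 1 / 2 + \<theta> * s l * (sqrt (2 ^ q) * hadamard q $$ (k, h l))"
proof -
  have "(hadamard q *\<^sub>v (count_sketch (2 ^ q) d (h, s) *\<^sub>v unit_vec d l)) $ k
    = (\<Sum>m<2 ^ q. hadamard q $$ (k, m) * (s l * of_bool (h l = m)))"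
    using assms by (simp add: count_sketch_unit_vec hadamard_mult_vec del: index_mult_mat_vec)
  also have "\<dots> = (\<Sum>m\<in>{h l}. hadamard q $$ (k, m) * (s l * of_bool (h l = m)))"
    using assms by (intro sum.mono_neutral_right) auto
  finally show ?thesis
    using assms unfolding report_probs_def by (simp del: index_mult_mat_vec)
qed

lemma report_probs_range:
  assumes "l < d" "k < 2 ^ q" "h l < 2 ^ q" "s l \<in> {-1, 1}"
  shows "report_probs q \<theta> (count_sketch (2 ^ q) d (h, s)) (unit_vec d l) $ k \<in> {1 / 2 + \<theta>, 1 / 2 - \<theta>}"
  using hadamard_entry[OF assms(2,3)] assms by (auto simp: report_probs_unit_vec)

lemma pairwise_independent_range:
  assumes "pairwise_independent d B F" "f \<in> set_pmf F" "l < d" "finite B" "B \<noteq> {}"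
  shows "f l \<in> B"
proof -
  have "f l \<in> set_pmf (map_pmf (\<lambda>f. f l) F)" using assms by auto
  moreover have "map_pmf (\<lambda>f. f l) F = pmf_of_set B" using assms by (auto simp: pairwise_independent_def)
  ultimately show ?thesis using assms by simp
qed

text \<open>Both sides are images of one product law \<open>Z\<close> of independent binomials over
  triples of user, row and bucket, grouped by user and row on the left and by row and bucket on the
  right. The guard gives the value 0 outside the index range, where reading an entry of a default
  report would be unspecified.\<close>

lemma aggregated_reports_law:
  fixes S :: "nat \<Rightarrow> real mat" and n t :: nat
  shows "map_pmf (\<lambda>Y (j, k). if j < t \<and> k < 2 ^ q then \<Sum>i<n. Y (i, j) $ k else 0)
     (Pi_pmf ({..<n} \<times> {..<t}) (0\<^sub>v 0) (\<lambda>(i, j). user_report q L \<theta> (S j) (X ! i)))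
   = Pi_pmf ({..<t} \<times> {..<2 ^ q}) 0
       (\<lambda>(j, k). binomial_sum L {..<n} (\<lambda>i. report_probs q \<theta> (S j) (X ! i) $ k))"
proof -
  let ?I = "{..<n}" and ?J = "{..<t}" and ?K = "{..<2 ^ q} :: nat set"
  define B where "B i j k = binomial_pmf L (report_probs q \<theta> (S j) (X ! i) $ k)" for i j k
  define Z where "Z = Pi_pmf ((?I \<times> ?J) \<times> ?K) 0 (\<lambda>((i, j), k). B i j k)"
  define swap :: "(nat \<times> nat) \<times> nat \<Rightarrow> (nat \<times> nat) \<times> nat" where "swap = (\<lambda>((j, k), i). ((i, j), k))"
  have swap: "bij swap" "swap -` ((?I \<times> ?J) \<times> ?K) = (?J \<times> ?K) \<times> ?I"
    by (rule bij_betw_byWitness[where f' = "\<lambda>((i, j), k). ((j, k), i)"]) (auto simp: swap_def)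
  have "Pi_pmf (?I \<times> ?J) (vec (2 ^ q) (\<lambda>_. 0)) (\<lambda>(i, j). user_report q L \<theta> (S j) (X ! i))
    = map_pmf (\<lambda>f. vec (2 ^ q) \<circ> f) (Pi_pmf (?I \<times> ?J) (\<lambda>_. 0) (\<lambda>(i, j). Pi_pmf ?K 0 (B i j)))"
    by (subst Pi_pmf_map[symmetric, where dflt' = "vec (2 ^ q) (\<lambda>_. 0)"])
       (auto simp: user_report_def B_def[abs_def] case_prod_unfold)
  also have "Pi_pmf (?I \<times> ?J) (\<lambda>_. 0) (\<lambda>(i, j). Pi_pmf ?K 0 (B i j)) = map_pmf curry Z"
    by (simp add: Z_def Pi_pmf_times case_prod_unfold)
  \<comment> \<open>The reports are built with a zero vector of length 2^q as default, since mapping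
    a product law also maps its default. \<open>Pi_pmf_default_swap\<close> then installs the empty
    vector.\<close>
  finally have reports: "Pi_pmf (?I \<times> ?J) (0\<^sub>v 0) (\<lambda>(i, j). user_report q L \<theta> (S j) (X ! i))
    = map_pmf (\<lambda>z a. if a \<in> ?I \<times> ?J then vec (2 ^ q) (\<lambda>k. z (a, k)) else 0\<^sub>v 0) Z"
    by (subst Pi_pmf_default_swap[symmetric, where dflt = "vec (2 ^ q) (\<lambda>_. 0)"])
       (auto simp: pmf.map_comp o_def curry_def)
  have "Pi_pmf (?J \<times> ?K) 0 (\<lambda>(j, k). binomial_sum L ?I (\<lambda>i. report_probs q \<theta> (S j) (X ! i) $ k))
    = map_pmf (\<lambda>f. (\<lambda>g. \<Sum>i<n. g i) \<circ> f) (Pi_pmf (?J \<times> ?K) (\<lambda>_. 0) (\<lambda>(j, k). Pi_pmf ?I 0 (\<lambda>i. B i j k)))"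
    by (subst Pi_pmf_map[symmetric, where dflt' = 0])
       (auto simp: binomial_sum_def B_def case_prod_unfold)
  also have "Pi_pmf (?J \<times> ?K) (\<lambda>_. 0) (\<lambda>(j, k). Pi_pmf ?I 0 (\<lambda>i. B i j k))
    = map_pmf curry (Pi_pmf ((?J \<times> ?K) \<times> ?I) 0 (\<lambda>((j, k), i). B i j k))"
    by (simp add: Pi_pmf_times case_prod_unfold)
  also have "Pi_pmf ((?J \<times> ?K) \<times> ?I) 0 (\<lambda>((j, k), i). B i j k) = map_pmf (\<lambda>f. f \<circ> swap) Z"
    unfolding Z_def using swap by (subst Pi_pmf_reindex) (auto simp: swap_def case_prod_unfold)
  finally have sums: "Pi_pmf (?J \<times> ?K) 0 (\<lambda>(j, k). binomial_sum L ?I (\<lambda>i. report_probs q \<theta> (S j) (X ! i) $ k))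
    = map_pmf (\<lambda>z (j, k). \<Sum>i<n. z ((i, j), k)) Z"
    by (simp add: pmf.map_comp o_def swap_def curry_def case_prod_unfold)
  show ?thesis
    unfolding reports sums pmf.map_comp
  proof (rule map_pmf_cong[OF refl])
    fix z assume "z \<in> set_pmf Z"
    then have "z \<in> {f. \<forall>x. x \<notin> (?I \<times> ?J) \<times> ?K \<longrightarrow> f x = 0}"
      unfolding Z_def by (rule subsetD[OF set_Pi_pmf_subset, rotated]) auto
    then have "z ((i, j), k) = 0" if "\<not> (j < t \<and> k < 2 ^ q)" for i j k
      using that by auto
    then show "((\<lambda>Y (j, k). if j < t \<and> k < 2 ^ q then \<Sum>i<n. Y (i, j) $ k else 0) \<circ>
        (\<lambda>z a. if a \<in> ?I \<times> ?J then vec (2 ^ q) (\<lambda>k. z (a, k)) else 0\<^sub>v 0)) z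
      = (\<lambda>(j, k). \<Sum>i<n. z ((i, j), k))"
      by (auto simp: fun_eq_iff)
  qed
qed

text \<open>By linearity the decoder can be applied to the bucket totals, so the centering is n/2
  per bucket in place of 1/2 per report.\<close>

definition sum_estimate :: "nat \<Rightarrow> nat \<Rightarrow> nat \<Rightarrow> real \<Rightarrow> (nat \<Rightarrow> nat) \<Rightarrow> real vec" where
  "sum_estimate n q L \<theta> s = (1 / (\<theta> * sqrt (2 ^ q))) \<cdot>\<^sub>v
     (hadamard q *\<^sub>v vec (2 ^ q) (\<lambda>m. real (s m) / real L - real n / 2))"

lemma sketch_estimate_eq:
  "sketch_estimate n q L \<theta> y = sum_estimate n q L \<theta> (\<lambda>m. \<Sum>i<n. y i $ m)"
proof -
  have "(\<Sum>i<n. (hadamard q *\<^sub>v vec (2 ^ q) (\<lambda>m. real (y i $ m) / real L - 1 / 2)) $ k)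
    = (hadamard q *\<^sub>v vec (2 ^ q) (\<lambda>m. real (\<Sum>i<n. y i $ m) / real L - real n / 2)) $ k"
    if "k < 2 ^ q" for k
  proof -
    have "(\<Sum>i<n. \<Sum>m<2 ^ q. hadamard q $$ (k, m) * (real (y i $ m) / real L - 1 / 2))
      = (\<Sum>m<2 ^ q. \<Sum>i<n. hadamard q $$ (k, m) * (real (y i $ m) / real L - 1 / 2))"
      by (rule sum.swap)
    also have "\<dots> = (\<Sum>m<2 ^ q. hadamard q $$ (k, m) * (real (\<Sum>i<n. y i $ m) / real L - real n / 2))"
      by (simp add: sum_distrib_left[symmetric] sum_subtractf sum_divide_distrib)
    finally show ?thesis using that by (simp only: hadamard_mult_vec)
  qed
  then show ?thesis
    unfolding sketch_estimate_def sum_estimate_def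
    by (intro arg_cong[where f = "(\<cdot>\<^sub>v) _"] eq_vecI) (simp_all del: index_mult_mat_vec)
qed

lemma sum_estimate_cong:
  "(\<And>m. m < 2 ^ q \<Longrightarrow> s m = s' m) \<Longrightarrow> sum_estimate n q L \<theta> s = sum_estimate n q L \<theta> s'"
  unfolding sum_estimate_def by (intro arg_cong[where f = "(\<cdot>\<^sub>v) _"] arg_cong[where f = "(*\<^sub>v) _"]) auto

definition decode :: "nat \<Rightarrow> nat \<Rightarrow> nat \<Rightarrow> nat \<Rightarrow> nat \<Rightarrow> real \<Rightarrow>
    ((nat \<Rightarrow> nat) \<times> (nat \<Rightarrow> real)) list \<Rightarrow> (nat \<times> nat \<Rightarrow> nat) \<Rightarrow> real vec" where
  "decode n d q t L \<theta> hs s = vec d (\<lambda>l. median (map (\<lambda>j.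
     (transpose_mat (count_sketch (2 ^ q) d (hs ! j)) *\<^sub>v sum_estimate n q L \<theta> (\<lambda>m. s (j, m))) $ l) [0..<t]))"

text \<open>This normal form separates three layers: seeds independent of the data, independent
  bucket totals given the seeds, and a deterministic decoder. Both privacy and accuracy start from
  it.\<close>

lemma noisy_sketch_eq:
  "noisy_sketch d H \<Sigma> q t L \<theta> X = replicate_pmf t (pair_pmf H \<Sigma>) \<bind> (\<lambda>hs.
     map_pmf (decode (length X) d q t L \<theta> hs)
       (Pi_pmf ({..<t} \<times> {..<2 ^ q}) 0 (\<lambda>(j, k).
          binomial_sum L {..<length X} (\<lambda>i. report_probs q \<theta> (count_sketch (2 ^ q) d (hs ! j)) (X ! i) $ k))))"
proof -
  have "decode (length X) d q t L \<theta> hs (\<lambda>(j, k). if j < t \<and> k < 2 ^ q then \<Sum>i<length X. Y (i, j) $ k else 0)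
    = vec d (\<lambda>l. median (map (\<lambda>j. (transpose_mat (count_sketch (2 ^ q) d (hs ! j)) *\<^sub>v
        sketch_estimate (length X) q L \<theta> (\<lambda>i. Y (i, j))) $ l) [0..<t]))" for hs Y
  proof -
    have "sum_estimate (length X) q L \<theta>
        (\<lambda>m. case (j, m) of (j, k) \<Rightarrow> if j < t \<and> k < 2 ^ q then \<Sum>i<length X. Y (i, j) $ k else 0)
      = sketch_estimate (length X) q L \<theta> (\<lambda>i. Y (i, j))" if "j < t" for j
      unfolding sketch_estimate_eq using that by (intro sum_estimate_cong) auto
    then show ?thesis unfolding decode_def
      by (intro eq_vecI) (auto intro!: arg_cong[where f = median] simp del: index_mult_mat_vec)
  qed
  then show ?thesis
    unfolding noisy_sketch_def Let_def aggregated_reports_law[symmetric]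
    by (simp add: pmf.map_comp o_def map_pmf_def[symmetric])
qed

section \<open>Privacy of the noisy sketch\<close>

text \<open>The seeds have the same law for both datasets, so the mixture over them costs a factor
  1. Given the seeds, each of the \<open>t * 2 ^ q\<close> independent totals pays the price of one
  bucket, and decoding is post-processing.\<close>

lemma noisy_sketch_hoelder_dominated:
  assumes X: "X \<in> one_hot_datasets n d" "X' \<in> one_hot_datasets n d" "neighboring X X'"
    and H: "pairwise_independent d {..<2 ^ q} H" and \<Sigma>: "pairwise_independent d {-1, 1} \<Sigma>"
    and "0 < L" and \<theta>: "0 \<le> \<theta>" "\<theta> \<le> 1 / 4" and \<alpha>: "1 < \<alpha>"
  shows "hoelder_dominated \<alpha> (exp ((\<alpha> - 1) * (10368 * \<theta>\<^sup>2 * L / n)) ^ (t * 2 ^ q))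
    (noisy_sketch d H \<Sigma> q t L \<theta> X) (noisy_sketch d H \<Sigma> q t L \<theta> X')"
proof -
  have len: "length X = n" "length X' = n" using X by (auto simp: one_hot_datasets_def)
  obtain i\<^sub>0 where i: "i\<^sub>0 < n" "\<And>i. i < n \<Longrightarrow> i \<noteq> i\<^sub>0 \<Longrightarrow> X ! i = X' ! i"
    using X(3) len by (auto simp: neighboring_def)
  have "hoelder_dominated \<alpha> (1 * exp ((\<alpha> - 1) * (10368 * \<theta>\<^sup>2 * L / n)) ^ (t * 2 ^ q))
    (noisy_sketch d H \<Sigma> q t L \<theta> X) (noisy_sketch d H \<Sigma> q t L \<theta> X')"
    unfolding noisy_sketch_eq len
  proof (intro hoelder_dominated_bind[OF \<alpha> _ hoelder_dominated_refl[OF \<alpha>]] hoelder_dominated_map)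
    fix hs assume hs: "hs \<in> set_pmf (replicate_pmf t (pair_pmf H \<Sigma>))"
    let ?P = "\<lambda>X (j, k). binomial_sum L {..<n} (\<lambda>i. report_probs q \<theta> (count_sketch (2 ^ q) d (hs ! j)) (X ! i) $ k)"
    have range: "report_probs q \<theta> (count_sketch (2 ^ q) d (hs ! j)) (Y ! i) $ k \<in> {1 / 2 + \<theta>, 1 / 2 - \<theta>}"
      if "Y \<in> one_hot_datasets n d" "i < n" "j < t" "k < 2 ^ q" for Y i j k
    proof -
      obtain h s where hsj: "hs ! j = (h, s)" by force
      have "hs ! j \<in> set hs" using hs that by (auto simp: set_replicate_pmf)
      then have "(h, s) \<in> set_pmf (pair_pmf H \<Sigma>)" using hs unfolding hsj by (auto simp: set_replicate_pmf)
      then have hs: "h \<in> set_pmf H" "s \<in> set_pmf \<Sigma>" by auto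
      have "Y ! i \<in> set Y" using that by (auto simp: one_hot_datasets_def)
      then have "Y ! i \<in> unit_vec d ` {..<d}" using that(1) by (auto simp: one_hot_datasets_def)
      then obtain l where l: "l < d" "Y ! i = unit_vec d l" by auto
      have "{..<2 ^ q :: nat} \<noteq> {}" by (auto simp: lessThan_empty_iff)
      then have "h l < 2 ^ q" using pairwise_independent_range[OF H hs(1) l(1)] by auto
      moreover have "s l \<in> {-1, 1}" using pairwise_independent_range[OF \<Sigma> hs(2) l(1)] by auto
      ultimately show ?thesis unfolding hsj l(2) using report_probs_range l that by blast
    qed
    have "hoelder_dominated \<alpha> (exp ((\<alpha> - 1) * (10368 * \<theta>\<^sup>2 * L / n)) ^ card ({..<t} \<times> {..<2 ^ q :: nat}))
      (Pi_pmf ({..<t} \<times> {..<2 ^ q}) 0 (?P X)) (Pi_pmf ({..<t} \<times> {..<2 ^ q}) 0 (?P X'))"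
    proof (rule hoelder_dominated_Pi_pmf[OF \<alpha>])
      fix a :: "nat \<times> nat" assume "a \<in> {..<t} \<times> {..<2 ^ q}"
      then obtain j k where a: "a = (j, k)" "j < t" "k < 2 ^ q" by auto
      show "hoelder_dominated \<alpha> (exp ((\<alpha> - 1) * (10368 * \<theta>\<^sup>2 * L / n))) (?P X a) (?P X' a)"
        unfolding a(1) prod.case
        using binomial_sum_privacy[OF _ _ \<open>0 < L\<close> \<theta> \<alpha>, of "{..<n}" i\<^sub>0] range[OF X(1)] range[OF X(2)] a i
        by simp
    qed auto
    then show "hoelder_dominated \<alpha> (exp ((\<alpha> - 1) * (10368 * \<theta>\<^sup>2 * L / n)) ^ (t * 2 ^ q))
      (Pi_pmf ({..<t} \<times> {..<2 ^ q}) 0 (?P X)) (Pi_pmf ({..<t} \<times> {..<2 ^ q}) 0 (?P X'))"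
      by simp
  qed simp
  then show ?thesis by simp
qed

section \<open>Medians\<close>

text \<open>If the upper middle entry of the sorted list exceeded b, so would all entries after it,
  and if the lower middle entry were below a, so would all entries before it. Either way at least
  half of the entries would be outside, for even and for odd length.\<close>

lemma median_between:
  assumes "2 * card {j. j < length xs \<and> \<not> (a \<le> xs ! j \<and> xs ! j \<le> b)} < length xs"
  shows "a \<le> median xs \<and> median xs \<le> b"
proof -
  define ys where "ys = sort xs"
  define m where "m = length xs"
  have m: "length ys = m" "0 < m" using assms by (auto simp: ys_def m_def)
  have sorted: "sorted ys" by (simp add: ys_def)
  have "length (filter (\<lambda>x. \<not> (a \<le> x \<and> x \<le> b)) xs) = length (filter (\<lambda>x. \<not> (a \<le> x \<and> x \<le> b)) ys)"
    unfolding ys_def by (metis mset_filter mset_sort size_mset)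
  then have bad: "2 * card {j. j < m \<and> \<not> (a \<le> ys ! j \<and> ys ! j \<le> b)} < m"
    using assms m unfolding length_filter_conv_card m_def by simp
  have few: "card J \<le> card {j. j < m \<and> \<not> (a \<le> ys ! j \<and> ys ! j \<le> b)}"
    if "J \<subseteq> {j. j < m \<and> \<not> (a \<le> ys ! j \<and> ys ! j \<le> b)}" for J
    using that by (intro card_mono) auto
  have up: "ys ! (m div 2) \<le> b"
  proof (rule ccontr)
    assume "\<not> ys ! (m div 2) \<le> b"
    then have "{m div 2..<m} \<subseteq> {j. j < m \<and> \<not> (a \<le> ys ! j \<and> ys ! j \<le> b)}"
      using sorted_nth_mono[OF sorted] m by fastforce
    from few[OF this] bad show False by simp
  qed
  have low: "a \<le> ys ! ((m - 1) div 2)"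
  proof (rule ccontr)
    assume "\<not> a \<le> ys ! ((m - 1) div 2)"
    moreover have "ys ! j \<le> ys ! ((m - 1) div 2)" "j < m" if "j \<le> (m - 1) div 2" for j
      using that sorted_nth_mono[OF sorted that] m by (auto simp: less_eq_div_iff_mult_less_eq)
    ultimately have "{..(m - 1) div 2} \<subseteq> {j. j < m \<and> \<not> (a \<le> ys ! j \<and> ys ! j \<le> b)}"
      by fastforce
    from few[OF this] bad show False by simp
  qed
  have "ys ! ((m - 1) div 2) \<le> ys ! (m div 2)"
    using m by (intro sorted_nth_mono[OF sorted]) (auto intro: div_le_mono)
  then show ?thesis using up low by (simp add: median_def Let_def ys_def m_def)
qed

section \<open>Amplification over independent rows\<close>

lemma expectation_replicate_pmf_prod:
  fixes g :: "'a \<Rightarrow> real"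
  assumes "\<And>x. 0 \<le> g x" "\<And>x. g x \<le> C"
  shows "measure_pmf.expectation (replicate_pmf t A) (\<lambda>xs. \<Prod>j<t. g (xs ! j)) = measure_pmf.expectation A g ^ t"
proof (induction t)
  case (Suc t)
  have prod: "0 \<le> (\<Prod>j<s. g (xs ! j))" "(\<Prod>j<s. g (xs ! j)) \<le> C ^ s" for s xs
    using assms prod_mono[of "{..<s}" "\<lambda>j. g (xs ! j)" "\<lambda>_. C"] by (auto intro: prod_nonneg)
  have "measure_pmf.expectation (replicate_pmf (Suc t) A) (\<lambda>xs. \<Prod>j<Suc t. g (xs ! j))
    = measure_pmf.expectation A (\<lambda>x. measure_pmf.expectation
        (map_pmf ((#) x) (replicate_pmf t A)) (\<lambda>xs. \<Prod>j<Suc t. g (xs ! j)))"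
    unfolding replicate_pmf.simps map_pmf_def[symmetric]
    using prod by (intro expectation_bind_pmf[where B = "C ^ Suc t"])
  also have "\<dots> = measure_pmf.expectation A (\<lambda>x. g x * measure_pmf.expectation A g ^ t)"
    by (simp add: prod.lessThan_Suc_shift Suc.IH del: prod.lessThan_Suc)
  finally show ?case by simp
qed simp

text \<open>Each bad row is given weight 36, so that a bad majority has total weight at least \<open>6\<^sup>t\<close>.\<close>

lemma majority_bad_prob_le:
  fixes R :: "'a \<Rightarrow> 'b pmf"
  assumes "measure_pmf.expectation A (\<lambda>a. measure_pmf.prob (R a) {y. bad a y}) \<le> 1 / 36"
  shows "measure_pmf.expectation (replicate_pmf t A) (\<lambda>as. measure_pmf.prob (Pi_pmf {..<t} d (\<lambda>j. R (as ! j)))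
    {y. t \<le> 2 * card {j. j < t \<and> bad (as ! j) (y j)}}) \<le> (1 / 3) ^ t"
proof -
  define W :: "'a \<Rightarrow> 'b \<Rightarrow> real" where "W a y = (if bad a y then 36 else 1)" for a y
  define g where "g a = measure_pmf.expectation (R a) (W a)" for a
  have W: "0 \<le> W a y" "1 \<le> W a y" "W a y \<le> 36" for a y by (auto simp: W_def)
  have intW: "integrable (measure_pmf (R a)) (W a)" for a
    using W by (intro integrable_pmf_bounded[where B = 36]) auto
  have g: "g a = 1 + 35 * measure_pmf.prob (R a) {y. bad a y}" for a
  proof -
    have "W a = (\<lambda>y. 1 + 35 * indicator {y. bad a y} y)" by (auto simp: W_def)
    then show ?thesis unfolding g_def by (simp add: integrable_pmf_bounded[where B = 1])
  qed
  have g0: "0 \<le> g a" "g a \<le> 36" for a by (simp_all add: g)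
  have "measure_pmf.prob (Pi_pmf {..<t} d (\<lambda>j. R (as ! j))) {y. t \<le> 2 * card {j. j < t \<and> bad (as ! j) (y j)}}
    \<le> (1 / 6) ^ t * (\<Prod>j<t. g (as ! j))" for as
  proof -
    let ?D = "Pi_pmf {..<t} d (\<lambda>j. R (as ! j))" and ?A = "{y. t \<le> 2 * card {j. j < t \<and> bad (as ! j) (y j)}}"
    have weight: "(\<Prod>j<t. W (as ! j) (y j)) = 36 ^ card {j. j < t \<and> bad (as ! j) (y j)}" for y
    proof -
      have "(\<Prod>j<t. W (as ! j) (y j)) = (\<Prod>j\<in>{j. j < t \<and> bad (as ! j) (y j)}. 36)"
        unfolding W_def by (simp add: prod.If_cases Int_def)
      then show ?thesis by simp
    qed
    have ge: "indicator ?A y \<le> (1 / 6) ^ t * (\<Prod>j<t. W (as ! j) (y j))" for y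
    proof (cases "y \<in> ?A")
      case True
      then have "(6 :: real) ^ t \<le> 6 ^ (2 * card {j. j < t \<and> bad (as ! j) (y j)})"
        by (intro power_increasing) auto
      then show ?thesis using True unfolding weight by (simp add: power_mult power_divide field_simps)
    qed (simp add: W prod_nonneg)
    have "measure_pmf.prob ?D ?A = measure_pmf.expectation ?D (indicator ?A)" by simp
    also have "\<dots> \<le> measure_pmf.expectation ?D (\<lambda>y. (1 / 6) ^ t * (\<Prod>j<t. W (as ! j) (y j)))"
    proof (rule integral_mono)
      show "integrable (measure_pmf ?D) (\<lambda>y. (1 / 6) ^ t * (\<Prod>j<t. W (as ! j) (y j)))"
        using intW by (intro integrable_mult_right integrable_prod_Pi_pmf) auto
    qed (use ge in \<open>auto intro!: integrable_pmf_bounded[where B = 1]\<close>)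
    also have "\<dots> = (1 / 6) ^ t * (\<Prod>j<t. g (as ! j))"
      using expectation_prod_Pi_pmf[of "{..<t}" "\<lambda>j. R (as ! j)" "\<lambda>j. W (as ! j)" d] W intW
      by (simp add: g_def)
    finally show ?thesis .
  qed
  moreover have "(\<Prod>j<t. g (as ! j)) \<le> 36 ^ t" for as
    using g0 prod_mono[of "{..<t}" "\<lambda>j. g (as ! j)" "\<lambda>_. 36"] by simp
  then have "integrable (measure_pmf (replicate_pmf t A)) (\<lambda>as. \<Prod>j<t. g (as ! j))"
    using g0 by (intro integrable_pmf_bounded[where B = "36 ^ t"]) (simp add: prod_nonneg)
  ultimately have "measure_pmf.expectation (replicate_pmf t A) (\<lambda>as. measure_pmf.prob (Pi_pmf {..<t} d (\<lambda>j. R (as ! j)))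
      {y. t \<le> 2 * card {j. j < t \<and> bad (as ! j) (y j)}})
    \<le> measure_pmf.expectation (replicate_pmf t A) (\<lambda>as. (1 / 6) ^ t * (\<Prod>j<t. g (as ! j)))"
    by (intro integral_mono integrable_mult_right) (auto intro!: integrable_pmf_bounded[where B = 1])
  also have "\<dots> = (1 / 6) ^ t * measure_pmf.expectation A g ^ t"
    using expectation_replicate_pmf_prod[of g 36 t A] g0 by simp
  \<comment> \<open>The mean weight of a row is at most 1 + 35/36 < 2, so Markov's inequality at
    level 6^t gives the base 2/6.\<close>
  also have "\<dots> \<le> (1 / 6) ^ t * 2 ^ t"
  proof (intro mult_left_mono power_mono)
    have "measure_pmf.expectation A g = 1 + 35 * measure_pmf.expectation A (\<lambda>a. measure_pmf.prob (R a) {y. bad a y})"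
      unfolding g by (simp add: integrable_pmf_bounded[where B = 1])
    then show "measure_pmf.expectation A g \<le> 2" using assms by simp
  qed (use g0 in \<open>auto intro: integral_nonneg_AE\<close>)
  also have "\<dots> = (1 / 3) ^ t" by (simp flip: power_mult_distrib)
  finally show ?thesis .
qed

section \<open>Variances\<close>

lemma expectation_bind_pmf_finite:
  fixes f :: "'b \<Rightarrow> real"
  assumes "finite (set_pmf P)" "\<And>x. x \<in> set_pmf P \<Longrightarrow> finite (set_pmf (F x))"
  shows "measure_pmf.expectation (bind_pmf P F) f = measure_pmf.expectation P (\<lambda>x. measure_pmf.expectation (F x) f)"
  using assms by (subst pmf_expectation_bind[where A = "set_pmf P"]) (auto simp: integral_measure_pmf[where A = "set_pmf P"])

lemma finite_set_Pi_pmf: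
  "finite A \<Longrightarrow> (\<And>a. a \<in> A \<Longrightarrow> finite (set_pmf (P a))) \<Longrightarrow> finite (set_pmf (Pi_pmf A d P))"
  by (simp add: set_Pi_pmf finite_PiE_dflt)

text \<open>Both claims are proved in one induction, because the cross term in the second moment
  vanishes by the first. Finite supports make every function integrable.\<close>

lemma Pi_pmf_sum_moments:
  fixes g :: "'a \<Rightarrow> 'b \<Rightarrow> real"
  assumes "finite A" "\<And>a. a \<in> A \<Longrightarrow> finite (set_pmf (P a))"
    and "\<And>a. a \<in> A \<Longrightarrow> measure_pmf.expectation (P a) (g a) = 0"
  shows "measure_pmf.expectation (Pi_pmf A d P) (\<lambda>f. \<Sum>a\<in>A. g a (f a)) = 0"
    and "measure_pmf.expectation (Pi_pmf A d P) (\<lambda>f. (\<Sum>a\<in>A. g a (f a))\<^sup>2)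
      = (\<Sum>a\<in>A. measure_pmf.expectation (P a) (\<lambda>x. (g a x)\<^sup>2))"
proof -
  have "measure_pmf.expectation (Pi_pmf A d P) (\<lambda>f. \<Sum>a\<in>A. g a (f a)) = 0 \<and>
    measure_pmf.expectation (Pi_pmf A d P) (\<lambda>f. (\<Sum>a\<in>A. g a (f a))\<^sup>2)
      = (\<Sum>a\<in>A. measure_pmf.expectation (P a) (\<lambda>x. (g a x)\<^sup>2))"
    using assms
  proof (induction A rule: finite_induct)
    case (insert x A)
    let ?D = "Pi_pmf A d P" and ?S = "\<lambda>f. \<Sum>a\<in>A. g a (f a)"
    have fin: "finite (set_pmf (P x))" "finite (set_pmf ?D)"
      using insert by (auto intro: finite_set_Pi_pmf)
    have int: "integrable (measure_pmf ?D) h" "integrable (measure_pmf (P x)) h'" for h :: "_ \<Rightarrow> real" and h' :: "_ \<Rightarrow> real"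
      using fin by (auto intro: integrable_measure_pmf_finite)
    have S: "(\<Sum>a\<in>insert x A. g a ((f(x := y)) a)) = g x y + ?S f" for f y
      using insert by simp (intro sum.cong, auto)
    have E: "measure_pmf.expectation (Pi_pmf (insert x A) d P) (\<lambda>f. h (\<Sum>a\<in>insert x A. g a (f a)))
      = measure_pmf.expectation (P x) (\<lambda>y. measure_pmf.expectation ?D (\<lambda>f. h (g x y + ?S f)))" for h :: "real \<Rightarrow> real"
      using insert(1,2) fin S
      by (simp add: Pi_pmf_insert' map_pmf_def[symmetric] expectation_bind_pmf_finite del: fun_upd_apply)
    have IH: "measure_pmf.expectation ?D ?S = 0"
      "measure_pmf.expectation ?D (\<lambda>f. (?S f)\<^sup>2) = (\<Sum>a\<in>A. measure_pmf.expectation (P a) (\<lambda>x. (g a x)\<^sup>2))"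
      using insert by auto
    have g0: "measure_pmf.expectation (P x) (g x) = 0" using insert by auto
    have "measure_pmf.expectation ?D (\<lambda>f. c + h f) = c + measure_pmf.expectation ?D h"
      "measure_pmf.expectation ?D (\<lambda>f. (c + h f)\<^sup>2)
        = c\<^sup>2 + measure_pmf.expectation ?D (\<lambda>f. (h f)\<^sup>2) + 2 * c * measure_pmf.expectation ?D h"
      for c :: real and h :: "_ \<Rightarrow> real"
      unfolding power2_sum by (simp_all add: int)
    then have "measure_pmf.expectation ?D (\<lambda>f. g x y + ?S f) = g x y"
      "measure_pmf.expectation ?D (\<lambda>f. (g x y + ?S f)\<^sup>2)
        = (g x y)\<^sup>2 + measure_pmf.expectation ?D (\<lambda>f. (?S f)\<^sup>2)" for y
      by (simp_all add: IH(1))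
    then show ?case
      unfolding E[of "\<lambda>x. x"] E[of "\<lambda>x. x\<^sup>2"] using insert.hyps
      by (simp add: g0 IH(2) int)
  qed simp
  then show "measure_pmf.expectation (Pi_pmf A d P) (\<lambda>f. \<Sum>a\<in>A. g a (f a)) = 0"
    "measure_pmf.expectation (Pi_pmf A d P) (\<lambda>f. (\<Sum>a\<in>A. g a (f a))\<^sup>2)
      = (\<Sum>a\<in>A. measure_pmf.expectation (P a) (\<lambda>x. (g a x)\<^sup>2))" by auto
qed

lemma binomial_pmf_centered_moments:
  assumes p: "0 \<le> p" "p \<le> 1"
  shows "measure_pmf.expectation (binomial_pmf n p) (\<lambda>x. real x - real n * p) = 0"
    and "measure_pmf.expectation (binomial_pmf n p) (\<lambda>x. (real x - real n * p)\<^sup>2) = real n * (p * (1 - p))"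
proof -
  have B: "binomial_pmf n p = map_pmf (\<lambda>f. card {i \<in> {..<n}. f i}) (Pi_pmf {..<n} False (\<lambda>_. bernoulli_pmf p))"
    using p by (intro binomial_pmf_altdef') auto
  have S: "real (card {i. i < n \<and> f i}) - real n * p = (\<Sum>i<n. of_bool (f i) - p)" for f :: "nat \<Rightarrow> bool"
    by (simp add: sum_subtractf sum.If_cases of_bool_def Int_def)
  have 1: "measure_pmf.expectation (bernoulli_pmf p) (\<lambda>b. of_bool b - p) = 0"
    using p by (simp add: algebra_simps)
  have 2: "measure_pmf.expectation (bernoulli_pmf p) (\<lambda>b. (of_bool b - p)\<^sup>2) = p * (1 - p)"
    using p by (simp add: algebra_simps power2_eq_square)
  have "finite (set_pmf (bernoulli_pmf p))" by simp
  note * = Pi_pmf_sum_moments[OF finite_lessThan this 1, of n False, simplified 2]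
  show "measure_pmf.expectation (binomial_pmf n p) (\<lambda>x. real x - real n * p) = 0"
    "measure_pmf.expectation (binomial_pmf n p) (\<lambda>x. (real x - real n * p)\<^sup>2) = real n * (p * (1 - p))"
    using * by (simp_all add: B S)
qed

lemma finite_set_binomial_sum:
  assumes "finite I" "\<And>i. i \<in> I \<Longrightarrow> 0 \<le> p i \<and> p i \<le> 1"
  shows "finite (set_pmf (binomial_sum L I p))"
  using assms unfolding binomial_sum_def by (auto intro!: finite_imageI finite_set_Pi_pmf)

lemma binomial_sum_centered_moments:
  assumes I: "finite I" and p: "\<And>i. i \<in> I \<Longrightarrow> 0 \<le> p i \<and> p i \<le> 1"
  shows "measure_pmf.expectation (binomial_sum L I p) (\<lambda>x. real x - real L * (\<Sum>i\<in>I. p i)) = 0"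
    and "measure_pmf.expectation (binomial_sum L I p) (\<lambda>x. (real x - real L * (\<Sum>i\<in>I. p i))\<^sup>2)
      \<le> real L * real (card I) / 4"
proof -
  have S: "real (\<Sum>i\<in>I. f i) - real L * (\<Sum>i\<in>I. p i) = (\<Sum>i\<in>I. real (f i) - real L * p i)" for f
    by (simp add: sum_subtractf sum_distrib_left)
  have *: "finite (set_pmf (binomial_pmf L (p i)))"
    "measure_pmf.expectation (binomial_pmf L (p i)) (\<lambda>x. real x - real L * p i) = 0" if "i \<in> I" for i
    using p[OF that] binomial_pmf_centered_moments(1)[of "p i" L] by auto
  note m = Pi_pmf_sum_moments[where P = "\<lambda>i. binomial_pmf L (p i)" and g = "\<lambda>i x. real x - real L * p i", OF I *]
  show "measure_pmf.expectation (binomial_sum L I p) (\<lambda>x. real x - real L * (\<Sum>i\<in>I. p i)) = 0"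
    using m(1)[of 0] by (simp add: binomial_sum_def S del: of_nat_sum)
  have "measure_pmf.expectation (binomial_sum L I p) (\<lambda>x. (real x - real L * (\<Sum>i\<in>I. p i))\<^sup>2)
    = (\<Sum>i\<in>I. measure_pmf.expectation (binomial_pmf L (p i)) (\<lambda>x. (real x - real L * p i)\<^sup>2))"
    using m(2)[of 0] by (simp add: binomial_sum_def S del: of_nat_sum)
  also have "\<dots> = (\<Sum>i\<in>I. real L * (p i * (1 - p i)))"
    using p by (intro sum.cong refl binomial_pmf_centered_moments(2)) auto
  also have "\<dots> \<le> (\<Sum>i\<in>I. real L * (1 / 4))"
    using mult_const_minus_self_real_le[of _ 1] by (intro sum_mono mult_left_mono) auto
  finally show "measure_pmf.expectation (binomial_sum L I p) (\<lambda>x. (real x - real L * (\<Sum>i\<in>I. p i))\<^sup>2)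
      \<le> real L * real (card I) / 4" by (simp add: mult.commute)
qed

lemma chebyshev_pmf:
  fixes f :: "'a \<Rightarrow> real"
  assumes "finite (set_pmf P)" "0 < c"
  shows "measure_pmf.prob P {x. c < \<bar>f x\<bar>} \<le> measure_pmf.expectation P (\<lambda>x. (f x)\<^sup>2) / c\<^sup>2"
proof -
  have "measure_pmf.prob P {x. c < \<bar>f x\<bar>} = measure_pmf.expectation P (indicator {x. c < \<bar>f x\<bar>})" by simp
  also have "\<dots> \<le> measure_pmf.expectation P (\<lambda>x. (f x)\<^sup>2 / c\<^sup>2)"
  proof (rule integral_mono)
    fix x
    have "c\<^sup>2 \<le> (f x)\<^sup>2" if "c < \<bar>f x\<bar>" using that \<open>0 < c\<close> by (simp add: abs_le_square_iff[symmetric])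
    then show "indicator {x. c < \<bar>f x\<bar>} x \<le> (f x)\<^sup>2 / c\<^sup>2" using \<open>0 < c\<close> by (auto simp: indicator_def)
  qed (use assms in \<open>auto intro: integrable_measure_pmf_finite\<close>)
  finally show ?thesis by simp
qed

section \<open>Accuracy of the noisy sketch\<close>

lemma prob_bind_pmf:
  "measure_pmf.prob (bind_pmf P F) A = measure_pmf.expectation P (\<lambda>x. measure_pmf.prob (F x) A)"
  using expectation_bind_pmf[of "indicator A" 1 P F] by simp

definition row_law :: "nat \<Rightarrow> nat \<Rightarrow> nat \<Rightarrow> real \<Rightarrow> real vec list \<Rightarrow>
    (nat \<Rightarrow> nat) \<times> (nat \<Rightarrow> real) \<Rightarrow> (nat \<Rightarrow> nat) pmf" where
  "row_law d q L \<theta> X hs = Pi_pmf {..<2 ^ q} 0 (\<lambda>k.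
     binomial_sum L {..<length X} (\<lambda>i. report_probs q \<theta> (count_sketch (2 ^ q) d hs) (X ! i) $ k))"

text \<open>The estimate is unbiased for the signed bucket load because the Hadamard matrix is its
  own inverse. Its error is a sum of centered totals weighted by a row of norm 1, so its variance is
  at most n / (4 \<theta>^2 w L). The radius \<open>e\<close> is the square root of 72 times this
  bound, whence the 18.\<close>

lemma row_noise:
  fixes \<theta> :: real
  defines "e \<equiv> \<lambda>n q L. sqrt (18 * real n / (\<theta>\<^sup>2 * 2 ^ q * real L))"
  assumes X: "length X = n" "\<And>i. i < n \<Longrightarrow> X ! i = unit_vec d (lab i) \<and> lab i < d"
    and hs: "\<And>l. l < d \<Longrightarrow> h l < 2 ^ q \<and> s l \<in> {-1, 1}"
    and \<theta>: "0 < \<theta>" "\<theta> \<le> 1 / 4" and L: "0 < L" and n: "0 < n" and k: "k < 2 ^ q"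
  shows "measure_pmf.prob (row_law d q L \<theta> X (h, s))
    {r. e n q L < \<bar>sum_estimate n q L \<theta> r $ k - (\<Sum>i<n. s (lab i) * of_bool (h (lab i) = k))\<bar>} \<le> 1 / 72"
proof -
  define p where "p i m = report_probs q \<theta> (count_sketch (2 ^ q) d (h, s)) (X ! i) $ m" for i m
  define c where "c = 1 / (\<theta> * sqrt (2 ^ q) * real L)"
  define g where "g m x = hadamard q $$ (k, m) * (real x - real L * (\<Sum>i<n. p i m))" for m x
  have p_eq: "p i m = 1 / 2 + \<theta> * s (lab i) * (sqrt (2 ^ q) * hadamard q $$ (m, h (lab i)))"
    if "i < n" "m < 2 ^ q" for i m
    using that X(2)[OF that(1)] hs[of "lab i"] by (simp add: p_def report_probs_unit_vec)
  have p01: "0 \<le> p i m \<and> p i m \<le> 1" if "i < n" "m < 2 ^ q" for i m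
    using report_probs_range[of "lab i" d m q h s \<theta>] that X(2)[OF that(1)] hs[of "lab i"] \<theta>
    by (auto simp: p_def)
  have mean: "(\<Sum>m<2 ^ q. hadamard q $$ (k, m) * (\<Sum>i<n. p i m - 1 / 2))
    = \<theta> * sqrt (2 ^ q) * (\<Sum>i<n. s (lab i) * of_bool (h (lab i) = k))"
  proof -
    have "(\<Sum>m<2 ^ q. hadamard q $$ (k, m) * (\<Sum>i<n. p i m - 1 / 2))
      = (\<Sum>m<2 ^ q. \<Sum>i<n. hadamard q $$ (k, m) * (\<theta> * s (lab i) * (sqrt (2 ^ q) * hadamard q $$ (m, h (lab i)))))"
      by (simp add: sum_distrib_left p_eq)
    also have "\<dots> = (\<Sum>i<n. \<theta> * sqrt (2 ^ q) * s (lab i) *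
        (\<Sum>m<2 ^ q. hadamard q $$ (k, m) * hadamard q $$ (m, h (lab i))))"
      by (subst sum.swap) (simp add: sum_distrib_left mult_ac)
    also have "\<dots> = (\<Sum>i<n. \<theta> * sqrt (2 ^ q) * s (lab i) * of_bool (h (lab i) = k))"
      using X(2) hs by (intro sum.cong refl) (auto simp: hadamard_twice[OF k])
    finally show ?thesis by (simp only: sum_distrib_left mult.assoc)
  qed
  have err: "sum_estimate n q L \<theta> r $ k - (\<Sum>i<n. s (lab i) * of_bool (h (lab i) = k))
    = c * (\<Sum>m<2 ^ q. g m (r m))" for r
  proof -
    have "sum_estimate n q L \<theta> r $ k
      = (\<Sum>m<2 ^ q. hadamard q $$ (k, m) * (real (r m) / real L - real n / 2)) / (\<theta> * sqrt (2 ^ q))"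
      unfolding sum_estimate_def using k by (simp add: hadamard_mult_vec del: index_mult_mat_vec)
    also have "(\<Sum>m<2 ^ q. hadamard q $$ (k, m) * (real (r m) / real L - real n / 2))
      = (\<Sum>m<2 ^ q. g m (r m) / real L + hadamard q $$ (k, m) * (\<Sum>i<n. p i m - 1 / 2))"
    proof (intro sum.cong refl)
      fix m
      have "(\<Sum>i<n. p i m - 1 / 2) = (\<Sum>i<n. p i m) - real n / 2" by (simp add: sum_subtractf)
      then show "hadamard q $$ (k, m) * (real (r m) / real L - real n / 2)
        = g m (r m) / real L + hadamard q $$ (k, m) * (\<Sum>i<n. p i m - 1 / 2)"
        using L by (simp only: g_def) (simp add: field_simps)
    qed
    also have "\<dots> = (\<Sum>m<2 ^ q. g m (r m)) / real L
        + \<theta> * sqrt (2 ^ q) * (\<Sum>i<n. s (lab i) * of_bool (h (lab i) = k))"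
      unfolding mean[symmetric] by (simp add: sum.distrib sum_divide_distrib)
    finally show ?thesis using \<theta> L by (simp add: c_def add_divide_distrib)
  qed
  let ?D = "row_law d q L \<theta> X (h, s)"
  have D: "?D = Pi_pmf {..<2 ^ q} 0 (\<lambda>m. binomial_sum L {..<n} (\<lambda>i. p i m))"
    by (simp add: row_law_def p_def X(1))
  have fin: "finite (set_pmf (binomial_sum L {..<n} (\<lambda>i. p i m)))" if "m \<in> {..<2 ^ q}" for m
    using that p01 by (intro finite_set_binomial_sum) auto
  have g0: "measure_pmf.expectation (binomial_sum L {..<n} (\<lambda>i. p i m)) (g m) = 0" if "m \<in> {..<2 ^ q}" for m
    unfolding g_def using that p01 binomial_sum_centered_moments(1)[of "{..<n}" "\<lambda>i. p i m" L] by simp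
  have "measure_pmf.expectation ?D (\<lambda>r. (\<Sum>m<2 ^ q. g m (r m))\<^sup>2)
    = (\<Sum>m<2 ^ q. measure_pmf.expectation (binomial_sum L {..<n} (\<lambda>i. p i m)) (\<lambda>x. (g m x)\<^sup>2))"
    unfolding D by (rule Pi_pmf_sum_moments(2)[OF _ fin g0]) auto
  also have "\<dots> \<le> (\<Sum>m<2 ^ q. (hadamard q $$ (k, m))\<^sup>2 * (real L * real n / 4))"
  proof (rule sum_mono)
    fix m :: nat assume "m \<in> {..<2 ^ q}"
    then have "measure_pmf.expectation (binomial_sum L {..<n} (\<lambda>i. p i m))
        (\<lambda>x. (real x - real L * (\<Sum>i<n. p i m))\<^sup>2) \<le> real L * real n / 4"
      using p01 binomial_sum_centered_moments(2)[of "{..<n}" "\<lambda>i. p i m" L] by simp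
    then have "(hadamard q $$ (k, m))\<^sup>2 * measure_pmf.expectation (binomial_sum L {..<n} (\<lambda>i. p i m))
        (\<lambda>x. (real x - real L * (\<Sum>i<n. p i m))\<^sup>2) \<le> (hadamard q $$ (k, m))\<^sup>2 * (real L * real n / 4)"
      by (rule mult_left_mono) simp
    then show "measure_pmf.expectation (binomial_sum L {..<n} (\<lambda>i. p i m)) (\<lambda>x. (g m x)\<^sup>2)
        \<le> (hadamard q $$ (k, m))\<^sup>2 * (real L * real n / 4)"
      by (simp only: g_def power_mult_distrib integral_mult_right_zero)
  qed
  \<comment> \<open>Since the row has unit norm, the sum over 2^q buckets costs no more than a
    single bucket.\<close>
  also have "\<dots> = real L * real n / 4"
    unfolding sum_distrib_right[symmetric] hadamard_sum_sq[OF k] by simp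
  finally have var: "measure_pmf.expectation ?D (\<lambda>r. (\<Sum>m<2 ^ q. g m (r m))\<^sup>2) \<le> real L * real n / 4" .
  have e: "0 < e n q L" "(e n q L)\<^sup>2 = 18 * real n / (\<theta>\<^sup>2 * 2 ^ q * real L)"
    using \<theta> L n by (simp_all add: e_def)
  have "finite (set_pmf ?D)" unfolding D using fin by (intro finite_set_Pi_pmf) auto
  from chebyshev_pmf[OF this e(1), of "\<lambda>r. c * (\<Sum>m<2 ^ q. g m (r m))"]
  have "measure_pmf.prob ?D {r. e n q L < \<bar>c * (\<Sum>m<2 ^ q. g m (r m))\<bar>}
    \<le> c\<^sup>2 * measure_pmf.expectation ?D (\<lambda>r. (\<Sum>m<2 ^ q. g m (r m))\<^sup>2) / (e n q L)\<^sup>2"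
    by (simp add: power_mult_distrib)
  also have "\<dots> \<le> c\<^sup>2 * (real L * real n / 4) / (e n q L)\<^sup>2"
    using var by (intro divide_right_mono mult_left_mono) auto
  also have "\<dots> = 1 / 72"
    using \<theta> L n unfolding e(2) c_def by (simp add: power_mult_distrib power_divide field_simps power2_eq_square)
  finally show ?thesis unfolding err .
qed

section \<open>Hash collisions\<close>

lemma collision_prob:
  assumes H: "pairwise_independent d {..<w} H" and "0 < w" "l < d" "l' < d" "l \<noteq> l'"
  shows "measure_pmf.prob H {h. h l' = h l} = 1 / real w"
proof -
  have "measure_pmf.prob H {h. h l' = h l}
    = measure_pmf.prob (map_pmf (\<lambda>h. (h l', h l)) H) {z. fst z = snd z}"
    by (simp add: vimage_def)
  also have "map_pmf (\<lambda>h. (h l', h l)) H = pmf_of_set ({..<w} \<times> {..<w})"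
    using assms by (auto simp: pairwise_independent_def)
  also have "measure_pmf.prob (pmf_of_set ({..<w} \<times> {..<w})) {z. fst z = snd z}
    = real (card ({..<w} \<times> {..<w} \<inter> {z. fst z = snd z})) / real (card ({..<w} \<times> {..<w}))"
    using \<open>0 < w\<close> by (subst measure_pmf_of_set) auto
  also have "{..<w} \<times> {..<w} \<inter> {z. fst z = snd z} = (\<lambda>k. (k, k)) ` {..<w}" by auto
  also have "real (card ((\<lambda>k. (k, k)) ` {..<w})) / real (card ({..<w} \<times> {..<w})) = 1 / real w"
    using \<open>0 < w\<close> by (subst card_image) (auto simp: inj_on_def)
  finally show ?thesis .
qed

text \<open>Collisions are counted without signs. Pairwise independence bounds the expected number
  by n/w, and Markov's inequality is applied at 72 times that value.\<close>

lemma collision_load: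
  assumes H: "pairwise_independent d {..<w} H" and "0 < w" "0 < n" "l < d" and lab: "\<And>i. i < n \<Longrightarrow> lab i < d"
  shows "measure_pmf.prob H {h. 72 * real n / real w < (\<Sum>i<n. of_bool (lab i \<noteq> l \<and> h (lab i) = h l))} \<le> 1 / 72"
proof -
  let ?f = "\<lambda>h :: nat \<Rightarrow> nat. \<Sum>i<n. of_bool (lab i \<noteq> l \<and> h (lab i) = h l) :: real"
  have f: "0 \<le> ?f h" "?f h \<le> real n" for h :: "nat \<Rightarrow> nat"
    using sum_bounded_above[of "{..<n}" "\<lambda>i. of_bool (lab i \<noteq> l \<and> h (lab i) = h l) :: real" 1]
    by (auto intro: sum_nonneg)
  have E: "measure_pmf.expectation H ?f \<le> real n / real w"
  proof -
    have "measure_pmf.expectation H ?f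
      = (\<Sum>i<n. measure_pmf.expectation H (\<lambda>h. of_bool (lab i \<noteq> l \<and> h (lab i) = h l)))"
      by (intro Bochner_Integration.integral_sum integrable_pmf_bounded[where B = 1]) auto
    also have "\<dots> \<le> (\<Sum>i<n. 1 / real w)"
    proof (rule sum_mono)
      fix i assume i: "i \<in> {..<n}"
      show "measure_pmf.expectation H (\<lambda>h. of_bool (lab i \<noteq> l \<and> h (lab i) = h l)) \<le> 1 / real w"
      proof (cases "lab i = l")
        case False
        then have "(\<lambda>h :: nat \<Rightarrow> nat. of_bool (lab i \<noteq> l \<and> h (lab i) = h l)) = (indicator {h. h (lab i) = h l} :: _ \<Rightarrow> real)"
          by (auto simp: indicator_def)
        then show ?thesis
          using collision_prob[OF H \<open>0 < w\<close> \<open>l < d\<close>, of "lab i"] lab[of i] i False by (simp only:) simp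
      qed simp
    qed
    finally show ?thesis by simp
  qed
  define c where "c = 72 * real n / real w"
  have c: "0 < c" using \<open>0 < w\<close> \<open>0 < n\<close> by (simp add: c_def)
  have "measure_pmf.prob H {h. c < ?f h} = measure_pmf.expectation H (indicator {h. c < ?f h})" by simp
  also have "\<dots> \<le> measure_pmf.expectation H (\<lambda>h. ?f h / c)"
  proof (rule integral_mono)
    show "integrable (measure_pmf H) (\<lambda>h. ?f h / c)"
      using f by (intro integrable_divide_zero integrable_pmf_bounded[where B = "real n"]) auto
    show "indicator {h. c < ?f h} h \<le> ?f h / c" for h
    proof (cases "c < ?f h")
      case True
      then have "1 \<le> ?f h / c" by (simp only: pos_le_divide_eq[OF c] mult_1 less_imp_le)
      then show ?thesis using True by (simp only: indicator_simps mem_Collect_eq)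
    next
      case False
      moreover have "0 \<le> ?f h / c" by (rule divide_nonneg_pos[OF f(1) c])
      ultimately show ?thesis by (simp only: indicator_simps mem_Collect_eq not_False_eq_True)
    qed
  qed (auto intro!: integrable_pmf_bounded[where B = 1])
  also have "\<dots> = measure_pmf.expectation H ?f / c" by simp
  also have "\<dots> \<le> real n / real w / c" using E c by (intro divide_right_mono) auto
  also have "\<dots> = 1 / 72" using \<open>0 < w\<close> \<open>0 < n\<close> by (simp add: c_def)
  finally show ?thesis by (simp only: c_def)
qed

text \<open>Collision radius plus noise radius. Each is exceeded with probability at most 1/72,
  which adds up to the 1/36 that the majority argument tolerates.\<close>

definition error_radius :: "nat \<Rightarrow> nat \<Rightarrow> nat \<Rightarrow> real \<Rightarrow> real" where
  "error_radius n w L \<theta> = 72 * real n / real w + sqrt (18 * real n / (\<theta>\<^sup>2 * real w * real L))"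

section \<open>From one row to the whole sketch\<close>

lemma histogram_labels:
  assumes "length X = n" "\<And>i. i < n \<Longrightarrow> X ! i = unit_vec d (lab i) \<and> lab i < d" "l < d"
  shows "histogram d X $ l = (\<Sum>i<n. of_bool (lab i = l))"
proof -
  have "histogram d X $ l = (\<Sum>i<n. X ! i $ l)" using assms by (simp add: histogram_def)
  also have "\<dots> = (\<Sum>i<n. of_bool (lab i = l))" using assms by (intro sum.cong) auto
  finally show ?thesis .
qed

text \<open>Users with label l contribute exactly 1 each, because the sign is squared; the others
  contribute at most 1, and only if they collide with l. Outside the event \<open>C\<close> of too
  many collisions, a bad row must therefore come from the noise.\<close>

lemma row_failure_prob:
  assumes X: "length X = n" "\<And>i. i < n \<Longrightarrow> X ! i = unit_vec d (lab i) \<and> lab i < d"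
    and H: "pairwise_independent d {..<2 ^ q} H" and \<Sigma>: "pairwise_independent d {-1, 1} \<Sigma>"
    and \<theta>: "0 < \<theta>" "\<theta> \<le> 1 / 4" and L: "0 < L" and n: "0 < n" and l: "l < d"
  shows "measure_pmf.expectation (pair_pmf H \<Sigma>) (\<lambda>hs. measure_pmf.prob (row_law d q L \<theta> X hs)
    {r. error_radius n (2 ^ q) L \<theta> < \<bar>snd hs l * sum_estimate n q L \<theta> r $ (fst hs l) - histogram d X $ l\<bar>}) \<le> 1 / 36"
proof -
  let ?e = "sqrt (18 * real n / (\<theta>\<^sup>2 * 2 ^ q * real L))"
  define C where "C = {h :: nat \<Rightarrow> nat. 72 * real n / real (2 ^ q) < (\<Sum>i<n. of_bool (lab i \<noteq> l \<and> h (lab i) = h l))}"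
  define bad where "bad hs r \<longleftrightarrow> error_radius n (2 ^ q) L \<theta>
    < \<bar>snd hs l * sum_estimate n q L \<theta> r $ (fst hs l) - histogram d X $ l\<bar>" for hs r
  have ne: "{..<2 ^ q :: nat} \<noteq> {}" by (auto simp: lessThan_empty_iff)
  have bound: "measure_pmf.prob (row_law d q L \<theta> X (h, s)) {r. bad (h, s) r} \<le> indicator C h + 1 / 72"
    if "h \<in> set_pmf H" "s \<in> set_pmf \<Sigma>" for h s
  proof -
    have hs: "h l < 2 ^ q \<and> s l \<in> {-1, 1}" if "l < d" for l
      using pairwise_independent_range[OF H \<open>h \<in> _\<close> that finite_lessThan ne]
        pairwise_independent_range[OF \<Sigma> \<open>s \<in> _\<close> that] by auto
    let ?T = "\<Sum>i<n. s (lab i) * of_bool (h (lab i) = h l)"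
    have "\<bar>s l * ?T - histogram d X $ l\<bar> \<le> (\<Sum>i<n. of_bool (lab i \<noteq> l \<and> h (lab i) = h l))"
    proof -
      have "s l * ?T - histogram d X $ l
        = (\<Sum>i<n. s l * (s (lab i) * of_bool (h (lab i) = h l)) - of_bool (lab i = l))"
        using histogram_labels[OF X l] by (simp only: sum_distrib_left sum_subtractf)
      also have "\<bar>\<dots>\<bar> \<le> (\<Sum>i<n. \<bar>s l * (s (lab i) * of_bool (h (lab i) = h l)) - of_bool (lab i = l)\<bar>)"
        by (rule sum_abs)
      also have "\<dots> \<le> (\<Sum>i<n. of_bool (lab i \<noteq> l \<and> h (lab i) = h l))"
      proof (rule sum_mono)
        fix i assume "i \<in> {..<n}"
        then have "s (lab i) \<in> {-1, 1}" "s l \<in> {-1, 1}" using X(2) hs l by auto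
        then show "\<bar>s l * (s (lab i) * of_bool (h (lab i) = h l)) - of_bool (lab i = l)\<bar>
          \<le> of_bool (lab i \<noteq> l \<and> h (lab i) = h l)" by (cases "lab i = l") auto
      qed
      finally show ?thesis .
    qed
    then have coll: "\<bar>s l * ?T - histogram d X $ l\<bar> \<le> 72 * real n / real (2 ^ q)" if "h \<notin> C"
      using that unfolding C_def by (simp only: mem_Collect_eq not_less)
    show ?thesis
    proof (cases "h \<in> C")
      case True
      then show ?thesis by (intro order_trans[OF measure_pmf.prob_le_1]) simp
    next
      case False
      have "?e < \<bar>sum_estimate n q L \<theta> r $ (h l) - ?T\<bar>" if "bad (h, s) r" for r
      proof -
        have "\<bar>s l * sum_estimate n q L \<theta> r $ (h l) - histogram d X $ l\<bar>
          \<le> \<bar>s l * (sum_estimate n q L \<theta> r $ (h l) - ?T)\<bar> + \<bar>s l * ?T - histogram d X $ l\<bar>"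
          by (simp only: right_diff_distrib)
        also have "\<bar>s l * (sum_estimate n q L \<theta> r $ (h l) - ?T)\<bar> = \<bar>sum_estimate n q L \<theta> r $ (h l) - ?T\<bar>"
          using hs[OF l] by (auto simp: abs_mult)
        finally show ?thesis using that coll[OF False] by (simp add: bad_def error_radius_def)
      qed
      then have "measure_pmf.prob (row_law d q L \<theta> X (h, s)) {r. bad (h, s) r}
        \<le> measure_pmf.prob (row_law d q L \<theta> X (h, s)) {r. ?e < \<bar>sum_estimate n q L \<theta> r $ (h l) - ?T\<bar>}"
        by (intro measure_pmf.finite_measure_mono) auto
      also have "\<dots> \<le> 1 / 72"
        using hs[OF l] by (intro row_noise[OF X hs \<theta> L n]) auto
      finally show ?thesis by (simp add: False)
    qed
  qed
  have "measure_pmf.expectation (pair_pmf H \<Sigma>) (\<lambda>hs. measure_pmf.prob (row_law d q L \<theta> X hs) {r. bad hs r})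
    \<le> measure_pmf.expectation (pair_pmf H \<Sigma>) (\<lambda>hs. indicator C (fst hs) + 1 / 72)"
  proof (rule integral_mono_AE)
    show "integrable (measure_pmf (pair_pmf H \<Sigma>)) (\<lambda>hs. indicator C (fst hs) + 1 / 72 :: real)"
      by (intro integrable_pmf_bounded[where B = 2]) (auto split: split_indicator)
  qed (use bound in \<open>auto simp: AE_measure_pmf_iff intro!: integrable_pmf_bounded[where B = 1]\<close>)
  also have "\<dots> = measure_pmf.expectation (pair_pmf H \<Sigma>) (\<lambda>hs. indicator C (fst hs)) + 1 / 72"
    by (subst Bochner_Integration.integral_add) (auto intro!: integrable_pmf_bounded[where B = 1])
  also have "measure_pmf.expectation (pair_pmf H \<Sigma>) (\<lambda>hs. indicator C (fst hs)) = measure_pmf.prob H C"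
    by simp
  also have "\<dots> \<le> 1 / 72"
    unfolding C_def using X(2) n l by (intro collision_load[OF H]) auto
  finally show ?thesis by (simp add: bad_def)
qed

lemma noisy_sketch_error:
  assumes X: "X \<in> one_hot_datasets n d"
    and H: "pairwise_independent d {..<2 ^ q} H" and \<Sigma>: "pairwise_independent d {-1, 1} \<Sigma>"
    and \<theta>: "0 < \<theta>" "\<theta> \<le> 1 / 4" and L: "0 < L" and n: "0 < n" and t: "0 < t"
  shows "1 - real d * (1 / 3) ^ t \<le> measure_pmf.prob (noisy_sketch d H \<Sigma> q t L \<theta> X)
    {v. \<forall>l<d. \<bar>v $ l - histogram d X $ l\<bar> \<le> error_radius n (2 ^ q) L \<theta>}"
proof -
  let ?M = "noisy_sketch d H \<Sigma> q t L \<theta> X" and ?e = "error_radius n (2 ^ q) L \<theta>"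
  have len: "length X = n" using X by (auto simp: one_hot_datasets_def)
  have "\<exists>l. X ! i = unit_vec d l \<and> l < d" if "i < n" for i
  proof -
    have "X ! i \<in> set X" using that len by simp
    then have "X ! i \<in> unit_vec d ` {..<d}" using X by (auto simp: one_hot_datasets_def)
    then show ?thesis by auto
  qed
  then obtain lab where lab: "\<And>i. i < n \<Longrightarrow> X ! i = unit_vec d (lab i) \<and> lab i < d" by metis
  have ne: "{..<2 ^ q :: nat} \<noteq> {}" by (auto simp: lessThan_empty_iff)
  have coordinate: "measure_pmf.prob ?M {v. ?e < \<bar>v $ l - histogram d X $ l\<bar>} \<le> (1 / 3) ^ t" if l: "l < d" for l
  proof -
    define bad where "bad hs r \<longleftrightarrow> ?e < \<bar>snd hs l * sum_estimate n q L \<theta> r $ (fst hs l) - histogram d X $ l\<bar>" for hs r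
    let ?D = "\<lambda>hs. Pi_pmf ({..<t} \<times> {..<2 ^ q}) 0 (\<lambda>(j, k). binomial_sum L {..<n}
        (\<lambda>i. report_probs q \<theta> (count_sketch (2 ^ q) d (hs ! j)) (X ! i) $ k))"
    have rows: "Pi_pmf {..<t} (\<lambda>_. 0) (\<lambda>j. row_law d q L \<theta> X (hs ! j)) = map_pmf curry (?D hs)" for hs
      by (subst Pi_pmf_times) (simp_all add: row_law_def len)
    have "measure_pmf.prob ?M {v. ?e < \<bar>v $ l - histogram d X $ l\<bar>}
      = measure_pmf.expectation (replicate_pmf t (pair_pmf H \<Sigma>)) (\<lambda>hs. measure_pmf.prob (?D hs)
          {y. ?e < \<bar>decode n d q t L \<theta> hs y $ l - histogram d X $ l\<bar>})"
      by (simp add: noisy_sketch_eq prob_bind_pmf len vimage_def)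
    also have "\<dots> \<le> measure_pmf.expectation (replicate_pmf t (pair_pmf H \<Sigma>)) (\<lambda>hs.
        measure_pmf.prob (Pi_pmf {..<t} (\<lambda>_. 0) (\<lambda>j. row_law d q L \<theta> X (hs ! j)))
          {y. t \<le> 2 * card {j. j < t \<and> bad (hs ! j) (y j)}})"
    proof (rule integral_mono_AE)
      show "AE hs in measure_pmf (replicate_pmf t (pair_pmf H \<Sigma>)).
        measure_pmf.prob (?D hs) {y. ?e < \<bar>decode n d q t L \<theta> hs y $ l - histogram d X $ l\<bar>}
        \<le> measure_pmf.prob (Pi_pmf {..<t} (\<lambda>_. 0) (\<lambda>j. row_law d q L \<theta> X (hs ! j)))
          {y. t \<le> 2 * card {j. j < t \<and> bad (hs ! j) (y j)}}"
        unfolding AE_measure_pmf_iff rows measure_map_pmf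
      proof (intro ballI measure_pmf.finite_measure_mono subsetI)
        fix hs y
        assume hs: "hs \<in> set_pmf (replicate_pmf t (pair_pmf H \<Sigma>))"
          and y: "y \<in> {y. ?e < \<bar>decode n d q t L \<theta> hs y $ l - histogram d X $ l\<bar>}"
        \<comment> \<open>Column l of the sketch has the single nonzero entry s(l) in row h(l), so
          the transpose reads off one signed bucket.\<close>
        have row: "(transpose_mat (count_sketch (2 ^ q) d (hs ! j)) *\<^sub>v sum_estimate n q L \<theta> (\<lambda>m. y (j, m))) $ l
          = snd (hs ! j) l * sum_estimate n q L \<theta> (curry y j) $ (fst (hs ! j) l)" if j: "j < t" for j
        proof -
          obtain h s where hsj: "hs ! j = (h, s)" by force
          have "hs ! j \<in> set hs" using hs j by (auto simp: set_replicate_pmf)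
          then have "h \<in> set_pmf H" using hs unfolding hsj by (auto simp: set_replicate_pmf)
          then have hl: "h l < 2 ^ q" using pairwise_independent_range[OF H _ l finite_lessThan ne] by auto
          have "dim_vec (sum_estimate n q L \<theta> (\<lambda>m. y (j, m))) = 2 ^ q" by (simp add: sum_estimate_def)
          then have "(transpose_mat (count_sketch (2 ^ q) d (h, s)) *\<^sub>v sum_estimate n q L \<theta> (\<lambda>m. y (j, m))) $ l
            = (\<Sum>k<2 ^ q. s l * of_bool (h l = k) * sum_estimate n q L \<theta> (\<lambda>m. y (j, m)) $ k)"
            using l by (simp add: count_sketch_def scalar_prod_def atLeast0LessThan)
          also have "\<dots> = (\<Sum>k\<in>{h l}. s l * of_bool (h l = k) * sum_estimate n q L \<theta> (\<lambda>m. y (j, m)) $ k)"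
            using hl by (intro sum.mono_neutral_right) auto
          finally show ?thesis by (simp add: hsj curry_def)
        qed
        let ?xs = "map (\<lambda>j. (transpose_mat (count_sketch (2 ^ q) d (hs ! j)) *\<^sub>v
          sum_estimate n q L \<theta> (\<lambda>m. y (j, m))) $ l) [0..<t]"
        have "\<not> (2 * card {j. j < length ?xs \<and>
          \<not> (histogram d X $ l - ?e \<le> ?xs ! j \<and> ?xs ! j \<le> histogram d X $ l + ?e)} < length ?xs)"
        proof
          assume "2 * card {j. j < length ?xs \<and>
            \<not> (histogram d X $ l - ?e \<le> ?xs ! j \<and> ?xs ! j \<le> histogram d X $ l + ?e)} < length ?xs"
          from median_between[OF this] y l show False by (simp add: decode_def abs_le_iff not_less[symmetric]) linarith
        qed
        moreover have "{j. j < length ?xs \<and> \<not> (histogram d X $ l - ?e \<le> ?xs ! j \<and> ?xs ! j \<le> histogram d X $ l + ?e)}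
          = {j. j < t \<and> bad (hs ! j) (curry y j)}"
          unfolding bad_def by (auto simp: row simp del: index_mult_mat_vec)
        ultimately show "y \<in> curry -` {y. t \<le> 2 * card {j. j < t \<and> bad (hs ! j) (y j)}}" by simp
      qed auto
    qed (auto intro!: integrable_pmf_bounded[where B = 1])
    also have "\<dots> \<le> (1 / 3) ^ t"
      unfolding bad_def by (intro majority_bad_prob_le row_failure_prob[OF len lab H \<Sigma> \<theta> L n l])
    finally show ?thesis .
  qed
  \<comment> \<open>Union bound over the coordinates, which share the same sketches and
    noise.\<close>
  have "measure_pmf.prob ?M (\<Union>l\<in>{..<d}. {v. ?e < \<bar>v $ l - histogram d X $ l\<bar>})
    \<le> (\<Sum>l<d. measure_pmf.prob ?M {v. ?e < \<bar>v $ l - histogram d X $ l\<bar>})"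
    by (rule measure_pmf.finite_measure_subadditive_finite) auto
  also have "\<dots> \<le> (\<Sum>l<d. (1 / 3) ^ t)" using coordinate by (intro sum_mono) auto
  finally have "measure_pmf.prob ?M (\<Union>l\<in>{..<d}. {v. ?e < \<bar>v $ l - histogram d X $ l\<bar>}) \<le> real d * (1 / 3) ^ t"
    by simp
  moreover have "{v. \<forall>l<d. \<bar>v $ l - histogram d X $ l\<bar> \<le> ?e}
    = - (\<Union>l\<in>{..<d}. {v. ?e < \<bar>v $ l - histogram d X $ l\<bar>})" by (auto simp: not_less)
  ultimately show ?thesis by (simp add: measure_pmf.prob_compl[of _ ?M, simplified] Compl_eq_Diff_UNIV)
qed

section \<open>Parameters\<close>

locale sketch_constants =
  fixes \<gamma>\<^sub>0 \<delta>\<^sub>0 \<kappa> c\<^sub>1 c\<^sub>2 :: real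
  assumes \<gamma>\<^sub>0: "0 < \<gamma>\<^sub>0" "\<gamma>\<^sub>0 < 1" and \<delta>\<^sub>0: "0 < \<delta>\<^sub>0" "\<delta>\<^sub>0 < 1" and \<kappa>: "0 < \<kappa>"
    and c: "0 < c\<^sub>1" "0 < c\<^sub>2"
begin

text \<open>\<open>a\<close> and \<open>b\<close> are positive lower bounds for ln (d/\<gamma>) and
  ln (1/\<delta>), depending only on the fixed thresholds. Additive constants are absorbed by
  dividing by them.\<close>

definition "a = ln (1 / \<gamma>\<^sub>0)"
definition "b = ln (1 / \<delta>\<^sub>0)"
text \<open>31104 = 3 * 10368: the one-bucket constant times the 3 in the upper bound of
  \<open>noise_level\<close>.\<close>

definition "C_rdp = 31104 * c\<^sub>2\<^sup>2"
text \<open>The 2 pays for rounding w to a power of two and the next factor for rounding t up. The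
  last factor is at least 1 and at least 1 / (a sqrt (a b)), so it serves both branches of the
  minimum in the communication bound.\<close>

definition "C_width = 2 * (1 + 1 / a) * (1 + 1 / (a * sqrt (a * b)))"
definition "C_count = 2 / (a * b) + 2 / sqrt (a * b) + 2"
text \<open>Coefficient of B in the noise radius: 288 = 18 * 16, with 16 from the lower bound of
  \<open>noise_level\<close> and 1 + 1/a from the rounding of t.\<close>

definition "N = sqrt (288 * (1 + 1 / a)) / c\<^sub>1"
definition "C_noise = 144 * (1 + \<kappa>) + N"
definition "C_thr = 144 * \<kappa> / b + (144 + N) / sqrt (a * b)"
definition "C_sq = 2 * C_thr * \<kappa> + (2 * 144\<^sup>2 * \<kappa>\<^sup>2 / b + 2 * (144 + N)\<^sup>2 / a)"

lemma a_pos: "0 < a" and b_pos: "0 < b"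
  using \<gamma>\<^sub>0 \<delta>\<^sub>0 by (simp_all add: a_def b_def)

lemma constants_pos: "0 < C_rdp" "0 < C_width" "2 \<le> C_count" "0 \<le> N" "0 < C_noise" "0 < C_thr" "0 < C_sq"
proof -
  show "0 < C_rdp" using c by (simp add: C_rdp_def)
  show "0 < C_width" using a_pos b_pos by (auto simp: C_width_def intro!: mult_pos_pos add_pos_pos)
  show "2 \<le> C_count" using a_pos b_pos by (simp add: C_count_def)
  show N: "0 \<le> N" using a_pos c by (simp add: N_def)
  show "0 < C_noise" using N \<kappa> by (simp add: C_noise_def)
  show T: "0 < C_thr" using N \<kappa> a_pos b_pos by (auto simp: C_thr_def intro!: add_pos_pos)
  have "0 < 2 * C_thr * \<kappa>" using T \<kappa> by simp
  then show "0 < C_sq" using a_pos b_pos unfolding C_sq_def by (intro add_pos_nonneg) auto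
qed

end

locale sketch_parameters = sketch_constants +
  fixes \<epsilon> \<delta> \<gamma> \<theta> :: real and n d q t L :: nat
  assumes n: "1 \<le> n" and d: "1 \<le> d" and \<epsilon>: "0 < \<epsilon>"
    and \<delta>: "0 < \<delta>" "\<delta> \<le> \<delta>\<^sub>0" and \<gamma>: "0 < \<gamma>" "\<gamma> \<le> \<gamma>\<^sub>0"
    and t_def: "t = nat \<lceil>ln (real d / \<gamma>)\<rceil>"
    and q: "rounds_to_power_of_two (target_width n d \<epsilon> \<delta> \<gamma>) q"
    and L_def: "L = nat \<lceil>noise_ratio n (2 ^ q) t \<epsilon> \<delta>\<rceil> + 1"
    and \<theta>_lower: "c\<^sub>1 * min (1 / 4) (sqrt (noise_ratio n (2 ^ q) t \<epsilon> \<delta>)) \<le> \<theta>"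
    and \<theta>_upper: "\<theta> \<le> c\<^sub>2 * min (1 / 4) (sqrt (noise_ratio n (2 ^ q) t \<epsilon> \<delta>))"
    and \<theta>_quarter: "\<theta> \<le> 1 / 4"
begin

definition "\<Lambda> = ln (real d / \<gamma>)"
definition "D = ln (1 / \<delta>)"
definition "\<nu> = noise_ratio n (2 ^ q) t \<epsilon> \<delta>"
text \<open>The target error. The target width is the minimum of n and n/B, so that n/w has order 1
  + B.\<close>

definition "B = sqrt (\<Lambda> * D) / \<epsilon>"

lemma D_ge: "b \<le> D"
  unfolding b_def D_def using \<delta> \<delta>\<^sub>0 by (simp add: field_simps)

lemma ln_\<gamma>_ge: "a \<le> ln (1 / \<gamma>)"
  unfolding a_def using \<gamma> \<gamma>\<^sub>0 by (simp add: field_simps)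

lemma \<Lambda>_eq: "\<Lambda> = ln (real d) + ln (1 / \<gamma>)"
  unfolding \<Lambda>_def using \<gamma> d by (simp add: ln_div)

lemma \<Lambda>_ge: "a \<le> \<Lambda>"
proof -
  have "0 \<le> ln (real d)" using d by simp
  then show ?thesis using \<Lambda>_eq ln_\<gamma>_ge by linarith
qed

lemma \<Lambda>_pos: "0 < \<Lambda>" and D_pos: "0 < D"
  using \<Lambda>_ge a_pos D_ge b_pos by linarith+

lemma B_pos: "0 < B"
  unfolding B_def using \<Lambda>_pos D_pos \<epsilon> by simp

lemma t_ge: "\<Lambda> \<le> real t" and t_le: "real t \<le> (1 + 1 / a) * \<Lambda>" and t_pos: "0 < t"
proof -
  show t: "\<Lambda> \<le> real t" unfolding t_def \<Lambda>_def by (rule real_nat_ceiling_ge)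
  show "0 < t" using t \<Lambda>_pos by (cases t) auto
  have "real t = of_int \<lceil>\<Lambda>\<rceil>" unfolding t_def \<Lambda>_def[symmetric] using \<Lambda>_pos by simp
  then have "real t \<le> \<Lambda> + 1" using of_int_ceiling_le_add_one[of \<Lambda>] by simp
  also have "1 \<le> \<Lambda> / a" using \<Lambda>_ge a_pos by simp
  finally show "real t \<le> (1 + 1 / a) * \<Lambda>" by (simp add: algebra_simps)
qed

text \<open>The third bound rests on min n (n/B) \<ge> n / (1 + B). The 1 that accompanies B
  reflects the cap w \<le> n and has to be absorbed later by the upper bounds on \<epsilon>.\<close>

lemma width_bounds: "2 ^ q \<le> 2 * real n" "2 ^ q \<le> 2 * (real n / B)" "real n / 2 ^ q \<le> 2 * (1 + B)"
proof -
  have W: "target_width n d \<epsilon> \<delta> \<gamma> = min (real n) (real n / B)"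
    by (simp add: target_width_def B_def \<Lambda>_def D_def)
  have *: "min (real n) (real n / B) / 2 < 2 ^ q" "2 ^ q < 2 * min (real n) (real n / B)"
    using q unfolding rounds_to_power_of_two_def W by auto
  then show "2 ^ q \<le> 2 * real n" "2 ^ q \<le> 2 * (real n / B)" by auto
  have "real n / (1 + B) \<le> min (real n) (real n / B)"
    using B_pos n by (auto simp: field_simps intro: frac_le)
  also have "\<dots> \<le> 2 * 2 ^ q" using *(1) by simp
  finally have "real n / (1 + B) \<le> 2 * 2 ^ q" .
  then show "real n / 2 ^ q \<le> 2 * (1 + B)" using B_pos by (simp add: field_simps)
qed

lemma \<nu>_eq: "\<nu> * (2 ^ q * real t * D) = real n * \<epsilon>\<^sup>2"
  unfolding \<nu>_def noise_ratio_def D_def[symmetric] using D_pos t_pos by simp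

lemma \<nu>_pos: "0 < \<nu>"
  unfolding \<nu>_def noise_ratio_def D_def[symmetric] using D_pos t_pos n \<epsilon> by simp

lemma L_pos: "0 < L" and L_ge: "\<nu> \<le> real L" "1 \<le> real L" and L_le: "real L \<le> \<nu> + 2"
proof -
  show "0 < L" "1 \<le> real L" by (simp_all add: L_def)
  have L: "real L = of_int \<lceil>\<nu>\<rceil> + 1" unfolding L_def \<nu>_def[symmetric] using \<nu>_pos by simp
  show "\<nu> \<le> real L" "real L \<le> \<nu> + 2"
    using of_int_ceiling_le_add_one[of \<nu>] le_of_int_ceiling[of \<nu>] unfolding L by linarith+
qed

lemma \<theta>_pos: "0 < \<theta>"
proof -
  have "0 < c\<^sub>1 * min (1 / 4) (sqrt \<nu>)" using c \<nu>_pos by simp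
  then show ?thesis using \<theta>_lower unfolding \<nu>_def by linarith
qed

text \<open>Small \<nu> makes \<theta>^2 proportional to \<nu> while L stays bounded; large \<nu>
  makes \<theta> constant and L proportional to \<nu>. So \<theta>^2 L is comparable to \<nu> in
  both regimes. The 3 comes from L \<le> \<nu> + 2, the 16 from the cap 1/4 squared.\<close>

lemma noise_level: "\<theta>\<^sup>2 * real L \<le> 3 * c\<^sub>2\<^sup>2 * \<nu>" "c\<^sub>1\<^sup>2 * \<nu> / 16 \<le> \<theta>\<^sup>2 * real L"
proof -
  define m where "m = min (1 / 4) (sqrt \<nu>)"
  have m: "m\<^sup>2 = min (1 / 16) \<nu>"
  proof -
    have "(1 / 4 :: real) = sqrt (1 / 16)" by (simp add: real_sqrt_divide)
    then have "m = min (sqrt (1 / 16)) (sqrt \<nu>)" by (simp only: m_def)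
    also have "\<dots> = sqrt (min (1 / 16) \<nu>)"
      by (simp only: min_def real_sqrt_le_iff if_distrib[of sqrt])
    finally show ?thesis using \<nu>_pos by simp
  qed
  have m0: "0 \<le> m" unfolding m_def using \<nu>_pos by simp
  have "m\<^sup>2 * real L \<le> 3 * \<nu>"
  proof (cases "\<nu> \<le> 1")
    case True
    have "m\<^sup>2 * real L \<le> \<nu> * 3" using True L_le \<nu>_pos unfolding m by (intro mult_mono) auto
    then show ?thesis by simp
  next
    case False
    have "m\<^sup>2 * real L \<le> (1 / 16) * (3 * \<nu>)" using False L_le \<nu>_pos unfolding m by (intro mult_mono) auto
    then show ?thesis using \<nu>_pos by simp
  qed
  moreover have "\<theta>\<^sup>2 \<le> (c\<^sub>2 * m)\<^sup>2" using \<theta>_upper \<theta>_pos unfolding m_def \<nu>_def by (intro power_mono) auto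
  ultimately have "\<theta>\<^sup>2 * real L \<le> c\<^sub>2\<^sup>2 * (3 * \<nu>)"
    by (intro order_trans[OF mult_right_mono[of "\<theta>\<^sup>2" "(c\<^sub>2 * m)\<^sup>2"]])
       (auto simp: power_mult_distrib mult.assoc intro!: mult_left_mono)
  then show "\<theta>\<^sup>2 * real L \<le> 3 * c\<^sub>2\<^sup>2 * \<nu>" by (simp add: mult_ac)
  have "\<nu> / 16 \<le> m\<^sup>2 * real L"
  proof (cases "\<nu> \<le> 1 / 16")
    case True
    have "\<nu> * 1 \<le> m\<^sup>2 * real L" using True L_ge \<nu>_pos unfolding m by (intro mult_mono) auto
    then show ?thesis using \<nu>_pos by simp
  next
    case False
    have "1 / 16 * \<nu> \<le> m\<^sup>2 * real L" using False L_ge \<nu>_pos unfolding m by (intro mult_mono) auto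
    then show ?thesis by simp
  qed
  then have "c\<^sub>1\<^sup>2 * (\<nu> / 16) \<le> c\<^sub>1\<^sup>2 * (m\<^sup>2 * real L)" by (intro mult_left_mono) auto
  also have "\<dots> = (c\<^sub>1 * m)\<^sup>2 * real L" by (simp add: power_mult_distrib)
  also have "\<dots> \<le> \<theta>\<^sup>2 * real L"
    using \<theta>_lower m0 c unfolding m_def \<nu>_def by (intro mult_right_mono power_mono) auto
  finally show "c\<^sub>1\<^sup>2 * \<nu> / 16 \<le> \<theta>\<^sup>2 * real L" by simp
qed

subsection \<open>Privacy\<close>

text \<open>Since \<nu> w t = n \<epsilon>^2 / D, the number of buckets cancels. The constant is
  written as exp (\<tau> (\<alpha> - 1) / \<alpha>) with \<tau> =
  \<open>C_rdp * (\<epsilon>\<^sup>2 * \<alpha> / D)\<close>, the shape expected by the conversions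
  to Renyi and approximate privacy.\<close>

lemma hoelder_dominated_neighboring:
  assumes X: "X \<in> one_hot_datasets n d" "X' \<in> one_hot_datasets n d" "neighboring X X'"
    and H: "pairwise_independent d {..<2 ^ q} H" and \<Sigma>: "pairwise_independent d {-1, 1} \<Sigma>" and \<alpha>: "1 < \<alpha>"
  shows "hoelder_dominated \<alpha> (exp (C_rdp * (\<epsilon>\<^sup>2 * \<alpha> / D) * (\<alpha> - 1) / \<alpha>))
    (noisy_sketch d H \<Sigma> q t L \<theta> X) (noisy_sketch d H \<Sigma> q t L \<theta> X')"
proof (rule hoelder_dominated_mono)
  show "hoelder_dominated \<alpha> (exp ((\<alpha> - 1) * (10368 * \<theta>\<^sup>2 * L / n)) ^ (t * 2 ^ q))
      (noisy_sketch d H \<Sigma> q t L \<theta> X) (noisy_sketch d H \<Sigma> q t L \<theta> X')"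
    using \<theta>_pos by (intro noisy_sketch_hoelder_dominated[OF X H \<Sigma> L_pos _ \<theta>_quarter \<alpha>]) simp
  have "\<theta>\<^sup>2 * real L * (2 ^ q * real t) / real n \<le> 3 * c\<^sub>2\<^sup>2 * \<nu> * (2 ^ q * real t) / real n"
    using noise_level(1) by (intro divide_right_mono mult_right_mono) auto
  also have "\<dots> = 3 * c\<^sub>2\<^sup>2 * (\<epsilon>\<^sup>2 / D)"
  proof -
    have "\<nu> * (2 ^ q * real t) = real n * (\<epsilon>\<^sup>2 / D)" using \<nu>_eq D_pos by (simp add: field_simps)
    then have "3 * c\<^sub>2\<^sup>2 * \<nu> * (2 ^ q * real t) = 3 * c\<^sub>2\<^sup>2 * (real n * (\<epsilon>\<^sup>2 / D))" by (simp only: mult.assoc)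
    then show ?thesis using n by simp
  qed
  finally have "(\<alpha> - 1) * 10368 * (\<theta>\<^sup>2 * real L * (2 ^ q * real t) / real n) \<le> (\<alpha> - 1) * 10368 * (3 * c\<^sub>2\<^sup>2 * (\<epsilon>\<^sup>2 / D))"
    using \<alpha> by (intro mult_left_mono) auto
  also have "\<dots> = C_rdp * (\<epsilon>\<^sup>2 * \<alpha> / D) * (\<alpha> - 1) / \<alpha>" using \<alpha> by (simp add: C_rdp_def)
  also have "(\<alpha> - 1) * 10368 * (\<theta>\<^sup>2 * real L * (2 ^ q * real t) / real n)
    = real (t * 2 ^ q) * ((\<alpha> - 1) * (10368 * \<theta>\<^sup>2 * real L / real n))" by simp
  finally show "exp ((\<alpha> - 1) * (10368 * \<theta>\<^sup>2 * L / n)) ^ (t * 2 ^ q) \<le> exp (C_rdp * (\<epsilon>\<^sup>2 * \<alpha> / D) * (\<alpha> - 1) / \<alpha>)"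
    by (simp flip: exp_of_nat_mult)
qed

lemma renyi_privacy:
  assumes H: "pairwise_independent d {..<2 ^ q} H" and \<Sigma>: "pairwise_independent d {-1, 1} \<Sigma>" and \<alpha>: "1 < \<alpha>"
  shows "renyi_differentially_private (one_hot_datasets n d) (noisy_sketch d H \<Sigma> q t L \<theta>) \<alpha> (C_rdp * (\<epsilon>\<^sup>2 * \<alpha> / D))"
proof -
  have "0 \<le> C_rdp * (\<epsilon>\<^sup>2 * \<alpha> / D)" using D_pos \<alpha> by (simp add: C_rdp_def)
  note rules = hoelder_dominated_support[OF \<alpha>] hoelder_dominated_moment(1)[OF \<alpha> exp_gt_zero]
    hoelder_dominated_renyi_divergence[OF \<alpha> _ this]
  show ?thesis
    unfolding renyi_differentially_private_def
    by (intro ballI impI conjI) (rule rules, rule hoelder_dominated_neighboring[OF _ _ _ H \<Sigma> \<alpha>]; assumption)+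
qed

lemma approximate_privacy:
  assumes H: "pairwise_independent d {..<2 ^ q} H" and \<Sigma>: "pairwise_independent d {-1, 1} \<Sigma>"
    and \<epsilon>_le: "\<epsilon> \<le> \<kappa> * D"
  shows "differentially_private (one_hot_datasets n d) (noisy_sketch d H \<Sigma> q t L \<theta>) ((C_rdp * \<kappa> + C_rdp + 1) * \<epsilon>) \<delta>"
  unfolding differentially_private_def
proof (intro ballI impI allI)
  fix X X' A
  assume X: "X \<in> one_hot_datasets n d" "X' \<in> one_hot_datasets n d" "neighboring X X'"
  let ?M = "noisy_sketch d H \<Sigma> q t L \<theta>"
  \<comment> \<open>This order makes the price ln (1/\<delta>) / (\<alpha> - 1) of the conversion
    equal to \<epsilon>. The Renyi term becomes a multiple of \<epsilon> + \<epsilon>^2 / D, and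
    \<epsilon> \<le> \<kappa> D makes it linear in \<epsilon>.\<close>
  define \<alpha> where "\<alpha> = 1 + D / \<epsilon>"
  have \<alpha>: "1 < \<alpha>" using D_pos \<epsilon> by (simp add: \<alpha>_def)
  have "measure_pmf.prob (?M X) A
    \<le> exp (C_rdp * (\<epsilon>\<^sup>2 * \<alpha> / D) + ln (1 / \<delta>) / (\<alpha> - 1)) * measure_pmf.prob (?M X') A + \<delta>"
    using \<delta> \<delta>\<^sub>0 by (intro hoelder_dominated_approximate_dp[OF \<alpha> _ _ hoelder_dominated_neighboring[OF X H \<Sigma> \<alpha>]]) auto
  also have "C_rdp * (\<epsilon>\<^sup>2 * \<alpha> / D) + ln (1 / \<delta>) / (\<alpha> - 1) \<le> (C_rdp * \<kappa> + C_rdp + 1) * \<epsilon>"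
  proof -
    have "ln (1 / \<delta>) / (\<alpha> - 1) = \<epsilon>" using D_pos \<epsilon> by (simp add: \<alpha>_def D_def[symmetric])
    moreover have "\<epsilon>\<^sup>2 * \<alpha> / D = \<epsilon> * (\<epsilon> / D) + \<epsilon>"
      using D_pos \<epsilon> by (simp add: \<alpha>_def power2_eq_square field_simps)
    moreover have "\<epsilon> / D \<le> \<kappa>" using \<epsilon>_le D_pos by (simp add: pos_divide_le_eq)
    then have "C_rdp * (\<epsilon> * (\<epsilon> / D)) \<le> C_rdp * (\<epsilon> * \<kappa>)" using \<epsilon> by (intro mult_left_mono) (auto simp: C_rdp_def)
    ultimately show ?thesis by (simp add: algebra_simps)
  qed
  finally show "measure_pmf.prob (?M X) A \<le> exp ((C_rdp * \<kappa> + C_rdp + 1) * \<epsilon>) * measure_pmf.prob (?M X') A + \<delta>"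
    by (simp add: mult_right_mono)
qed

subsection \<open>Communication\<close>

lemma log_factor_eq: "log_factor n d \<epsilon> \<gamma> = 1 + ln (real n) + ln (of_int \<lceil>\<epsilon>\<rceil>) + \<Lambda>"
  by (simp add: log_factor_def \<Lambda>_eq)

lemma ceiling_\<epsilon>: "1 \<le> real_of_int \<lceil>\<epsilon>\<rceil>"
  using \<epsilon> by (simp add: one_le_ceiling)

lemma log_factor_ge: "1 \<le> log_factor n d \<epsilon> \<gamma>" "\<Lambda> \<le> log_factor n d \<epsilon> \<gamma>"
    "ln (real n) + 2 * ln (of_int \<lceil>\<epsilon>\<rceil>) \<le> 2 * log_factor n d \<epsilon> \<gamma>"
proof -
  have "0 \<le> ln (real n)" "0 \<le> ln (real_of_int \<lceil>\<epsilon>\<rceil>)" using n ceiling_\<epsilon> by auto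
  moreover have "ln (real n) + 2 * y \<le> 2 * (1 + ln (real n) + y + \<Lambda>)" if "0 \<le> ln (real n)" for y
    using that \<Lambda>_pos by simp
  ultimately show "1 \<le> log_factor n d \<epsilon> \<gamma>" "\<Lambda> \<le> log_factor n d \<epsilon> \<gamma>"
    "ln (real n) + 2 * ln (of_int \<lceil>\<epsilon>\<rceil>) \<le> 2 * log_factor n d \<epsilon> \<gamma>"
    using \<Lambda>_pos unfolding log_factor_eq by (linarith, linarith, blast)
qed

lemma \<Lambda>D_ge: "a * b \<le> \<Lambda> * D" "sqrt (a * b) \<le> sqrt (\<Lambda> * D)"
  using \<Lambda>_ge D_ge a_pos b_pos by (auto intro: mult_mono)

text \<open>The two branches come from w \<le> 2 n and w \<le> 2 n / B, while t goes into the
  logarithmic factor. In the second branch a \<le> ln (1/\<gamma>) introduces the factor ln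
  (1/\<gamma>).\<close>

lemma total_width_le:
  "2 ^ q * real t \<le> C_width * log_factor n d \<epsilon> \<gamma> * min (real n * \<epsilon> * ln (1 / \<gamma>)) (real n)"
proof -
  let ?l = "log_factor n d \<epsilon> \<gamma>" and ?A = "1 + 1 / a" and ?s = "1 / (a * sqrt (a * b))"
  have A: "0 < ?A" and s: "0 < ?s" using a_pos b_pos by (auto intro: add_pos_pos)
  have t: "real t \<le> ?A * ?l"
    using t_le log_factor_ge(2) A by (meson less_imp_le mult_left_mono order_trans)
  have l0: "0 < ?l" using log_factor_ge(1) by linarith
  have "2 ^ q * real t \<le> 2 * real n * (?A * ?l)" using width_bounds(1) t by (intro mult_mono) auto
  also have "\<dots> \<le> 2 * real n * (?A * ?l) * (1 + ?s)"
    using A l0 s mult_left_mono[of 1 "1 + ?s" "2 * real n * (?A * ?l)"] by simp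
  finally have 1: "2 ^ q * real t \<le> C_width * ?l * real n" by (simp add: C_width_def mult_ac)
  have "2 ^ q * real t \<le> 2 * (real n / B) * (?A * ?l)"
    using width_bounds(2) t B_pos by (intro mult_mono) auto
  also have "\<dots> = real n * \<epsilon> * (2 * ?A * ?l) * (1 / sqrt (\<Lambda> * D))" by (simp add: B_def)
  also have "\<dots> \<le> real n * \<epsilon> * (2 * ?A * ?l) * (1 / sqrt (a * b))"
    using \<Lambda>D_ge(2) a_pos b_pos \<Lambda>_pos D_pos \<epsilon> A l0 by (intro mult_left_mono divide_left_mono mult_pos_pos) auto
  also have "\<dots> = real n * \<epsilon> * (2 * ?A * ?l) * ?s * a" using a_pos by simp
  also have "\<dots> \<le> real n * \<epsilon> * (2 * ?A * ?l) * (1 + ?s) * ln (1 / \<gamma>)"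
    using ln_\<gamma>_ge a_pos s \<epsilon> A l0 by (intro mult_mono) auto
  finally have 2: "2 ^ q * real t \<le> C_width * ?l * (real n * \<epsilon> * ln (1 / \<gamma>))" by (simp add: C_width_def mult_ac)
  from 1 2 show ?thesis by (simp add: min_def)
qed

text \<open>n/w \<le> 2 (1 + B) eliminates n, leaving a polynomial in \<epsilon>. So ln L
  contributes only a constant and a multiple of the logarithm of the ceiling of \<epsilon>.\<close>

lemma \<nu>_le: "\<nu> \<le> 2 * \<epsilon>\<^sup>2 / (a * b) + 2 * \<epsilon> / sqrt (a * b)"
proof -
  have "\<nu> = real n / 2 ^ q * (\<epsilon>\<^sup>2 / (real t * D))"
    by (simp add: \<nu>_def noise_ratio_def D_def)
  also have "\<dots> \<le> 2 * (1 + B) * (\<epsilon>\<^sup>2 / (\<Lambda> * D))"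
    using width_bounds(3) t_ge \<Lambda>_pos D_pos B_pos t_pos
    by (intro mult_mono divide_left_mono mult_right_mono mult_pos_pos) auto
  also have "\<dots> = 2 * \<epsilon>\<^sup>2 / (\<Lambda> * D) + 2 * \<epsilon> / sqrt (\<Lambda> * D)"
  proof -
    define s where "s = sqrt (\<Lambda> * D)"
    have s: "0 < s" "\<Lambda> * D = s * s" using \<Lambda>_pos D_pos by (auto simp: s_def)
    show ?thesis unfolding B_def s_def[symmetric] s(2) using s(1) \<epsilon> by (simp add: field_simps power2_eq_square)
  qed
  also have "\<dots> \<le> 2 * \<epsilon>\<^sup>2 / (a * b) + 2 * \<epsilon> / sqrt (a * b)"
    using \<Lambda>D_ge a_pos b_pos \<epsilon> by (intro add_mono divide_left_mono) (auto intro!: mult_pos_pos \<Lambda>_pos D_pos)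
  finally show ?thesis .
qed

lemma log_count_le: "log 2 (real n * real L + 1) \<le> (ln (2 * C_count) + 2) / ln 2 * log_factor n d \<epsilon> \<gamma>"
proof -
  let ?e = "real_of_int \<lceil>\<epsilon>\<rceil>" and ?l = "log_factor n d \<epsilon> \<gamma>"
  have e: "1 \<le> ?e" "\<epsilon> \<le> ?e" using ceiling_\<epsilon> by auto
  \<comment> \<open>As the ceiling is at least 1, its square dominates 1, \<epsilon> and
    \<epsilon>^2 alike, for small and large \<epsilon>.\<close>
  have "?e \<le> ?e\<^sup>2" using e mult_left_mono[of 1 ?e ?e] by (simp add: power2_eq_square)
  then have e2: "1 \<le> ?e\<^sup>2" "\<epsilon> \<le> ?e\<^sup>2" using e by linarith+
  have e3: "\<epsilon>\<^sup>2 \<le> ?e\<^sup>2" using e \<epsilon> by (intro power_mono) auto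
  note C = constants_pos(3)
  have "\<nu> + 2 \<le> C_count * ?e\<^sup>2"
  proof -
    have "2 * \<epsilon>\<^sup>2 / (a * b) \<le> 2 * ?e\<^sup>2 / (a * b)" "2 * \<epsilon> / sqrt (a * b) \<le> 2 * ?e\<^sup>2 / sqrt (a * b)"
      using e2(2) e3 a_pos b_pos by (intro divide_right_mono mult_left_mono; simp)+
    then have "\<nu> + 2 \<le> 2 * ?e\<^sup>2 / (a * b) + 2 * ?e\<^sup>2 / sqrt (a * b) + 2 * ?e\<^sup>2"
      using \<nu>_le e2(1) by linarith
    also have "\<dots> = C_count * ?e\<^sup>2" by (simp add: C_count_def algebra_simps)
    finally show ?thesis .
  qed
  then have L: "real L \<le> C_count * ?e\<^sup>2" using L_le by linarith
  have "1 \<le> real n * real L" using n L_ge(2) mult_mono[of 1 "real n" 1 "real L"] by simp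
  then have "real n * real L + 1 \<le> 2 * (real n * real L)" by linarith
  also have "\<dots> \<le> 2 * (real n * (C_count * ?e\<^sup>2))" using L by (intro mult_left_mono) auto
  finally have "ln (real n * real L + 1) \<le> ln (2 * (real n * (C_count * ?e\<^sup>2)))"
    using \<open>1 \<le> real n * real L\<close> by (intro ln_mono) auto
  also have "2 * (real n * (C_count * ?e\<^sup>2)) = (2 * C_count) * (real n * ?e\<^sup>2)" by simp
  also have "ln \<dots> = ln (2 * C_count) + (ln (real n) + 2 * ln ?e)"
  proof -
    have "ln ((2 * x) * (y * z\<^sup>2)) = ln (2 * x) + (ln y + 2 * ln z)" if "0 < x" "0 < y" "0 < z" for x y z :: real
      using that by (simp add: ln_mult ln_realpow)
    then show ?thesis using C n e(1) by simp
  qed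
  also have "\<dots> \<le> ln (2 * C_count) * ?l + 2 * ?l"
  proof -
    have "ln (2 * C_count) * 1 \<le> ln (2 * C_count) * ?l"
      using C log_factor_ge(1) by (intro mult_left_mono) auto
    then show ?thesis using log_factor_ge(3) by linarith
  qed
  finally have "ln (real n * real L + 1) / ln 2 \<le> (ln (2 * C_count) * ?l + 2 * ?l) / ln 2"
    by (intro divide_right_mono) auto
  then show ?thesis by (simp add: log_def algebra_simps add_divide_distrib)
qed

lemma communication_le:
  "communication_bits n (2 ^ q) t L
    \<le> C_width * ((ln (2 * C_count) + 2) / ln 2) * log_factor n d \<epsilon> \<gamma> ^ 2 * min (real n * \<epsilon> * ln (1 / \<gamma>)) (real n)"
proof -
  have "communication_bits n (2 ^ q) t L = (2 ^ q * real t) * log 2 (real n * real L + 1)"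
    by (simp add: communication_bits_def)
  also have "\<dots> \<le> (C_width * log_factor n d \<epsilon> \<gamma> * min (real n * \<epsilon> * ln (1 / \<gamma>)) (real n))
      * ((ln (2 * C_count) + 2) / ln 2 * log_factor n d \<epsilon> \<gamma>)"
    by (rule mult_mono'[OF total_width_le log_count_le]) (simp_all add: add_nonneg_pos)
  finally show ?thesis by (simp add: power2_eq_square mult_ac)
qed

subsection \<open>Accuracy\<close>

lemma error_radius_le: "error_radius n (2 ^ q) L \<theta> \<le> 144 * (1 + B) + N * B"
proof -
  have "18 * real n / (\<theta>\<^sup>2 * 2 ^ q * real L) = 18 * real n / (\<theta>\<^sup>2 * real L * 2 ^ q)" by simp
  also have "\<dots> \<le> 18 * real n / (c\<^sub>1\<^sup>2 * \<nu> / 16 * 2 ^ q)"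
    using noise_level(2) c \<nu>_pos \<theta>_pos L_pos by (intro divide_left_mono mult_right_mono mult_pos_pos) auto
  also have "\<dots> = 288 * (real n / (\<nu> * 2 ^ q)) / c\<^sub>1\<^sup>2" using c \<nu>_pos by (simp add: field_simps)
  also have "real n / (\<nu> * 2 ^ q) = real t * D / \<epsilon>\<^sup>2"
    using \<nu>_eq \<nu>_pos \<epsilon> by (simp add: field_simps)
  also have "288 * (real t * D / \<epsilon>\<^sup>2) / c\<^sub>1\<^sup>2 \<le> 288 * ((1 + 1 / a) * \<Lambda> * D / \<epsilon>\<^sup>2) / c\<^sub>1\<^sup>2"
    using t_le D_pos by (intro divide_right_mono mult_left_mono mult_right_mono) auto
  also have "\<dots> = (N * B)\<^sup>2"
    using \<Lambda>_pos D_pos a_pos c \<epsilon>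
    by (simp add: N_def B_def power_divide power_mult_distrib) (simp add: field_simps)
  finally have "sqrt (18 * real n / (\<theta>\<^sup>2 * 2 ^ q * real L)) \<le> N * B"
    using B_pos constants_pos(4) by (intro real_le_lsqrt) auto
  then show ?thesis using width_bounds(3) by (simp add: error_radius_def)
qed

text \<open>Since e < 3, the base 1/3 of the majority bound is below exp (-1), so t \<ge> ln
  (d/\<gamma>) rows suffice for a union bound over d coordinates without a constant factor in
  t.\<close>

lemma failure_prob_le: "real d * (1 / 3) ^ t \<le> \<gamma>"
proof -
  have "(1 / 3 :: real) \<le> exp (- 1)" using exp_le by (simp add: exp_minus field_simps)
  then have "(1 / 3 :: real) ^ t \<le> exp (- 1) ^ t" by (intro power_mono) auto
  also have "\<dots> = exp (- real t)" by (simp flip: exp_of_nat_mult)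
  also have "\<dots> \<le> exp (- \<Lambda>)" using t_ge by simp
  also have "\<dots> = \<gamma> / real d" using \<gamma> d by (simp add: \<Lambda>_def exp_minus)
  finally show ?thesis using d by (simp add: field_simps)
qed

lemma dim_vec_noisy_sketch: "v \<in> set_pmf (noisy_sketch d H \<Sigma> q t L \<theta> X) \<Longrightarrow> dim_vec v = d"
  unfolding noisy_sketch_eq by (auto simp: decode_def)

text \<open>Both accuracy claims are deterministic consequences of one event of uniform closeness,
  so probability is dealt with only here.\<close>

lemma prob_close:
  assumes X: "X \<in> one_hot_datasets n d"
    and H: "pairwise_independent d {..<2 ^ q} H" and \<Sigma>: "pairwise_independent d {-1, 1} \<Sigma>"
    and close: "\<And>v. dim_vec v = d \<Longrightarrow> (\<And>l. l < d \<Longrightarrow> \<bar>v $ l - histogram d X $ l\<bar> \<le> 144 * (1 + B) + N * B) \<Longrightarrow> P v"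
  shows "1 - \<gamma> \<le> measure_pmf.prob (noisy_sketch d H \<Sigma> q t L \<theta> X) {v. P v}"
proof -
  let ?M = "noisy_sketch d H \<Sigma> q t L \<theta> X"
  have "1 - \<gamma> \<le> 1 - real d * (1 / 3) ^ t" using failure_prob_le by simp
  also have "\<dots> \<le> measure_pmf.prob ?M {v. \<forall>l<d. \<bar>v $ l - histogram d X $ l\<bar> \<le> error_radius n (2 ^ q) L \<theta>}"
    using n by (intro noisy_sketch_error[OF X H \<Sigma> \<theta>_pos \<theta>_quarter L_pos _ t_pos]) simp
  also have "\<dots> \<le> measure_pmf.prob ?M {v. P v}"
  proof (rule measure_pmf.finite_measure_mono_AE[OF AE_pmfI])
    fix v assume "v \<in> set_pmf ?M"
    then have "dim_vec v = d" by (rule dim_vec_noisy_sketch)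
    moreover have "\<bar>v $ l - histogram d X $ l\<bar> \<le> 144 * (1 + B) + N * B"
      if "\<forall>l<d. \<bar>v $ l - histogram d X $ l\<bar> \<le> error_radius n (2 ^ q) L \<theta>" "l < d" for l
      using that error_radius_le order_trans by blast
    ultimately show "v \<in> {v. \<forall>l<d. \<bar>v $ l - histogram d X $ l\<bar> \<le> error_radius n (2 ^ q) L \<theta>} \<longrightarrow> v \<in> {v. P v}"
      using close[of v] by blast
  qed simp
  finally show ?thesis .
qed

lemma linf_norm_diff_le:
  assumes "\<And>l. l < d \<Longrightarrow> \<bar>v $ l - histogram d X $ l\<bar> \<le> e"
  shows "linf_norm (v - histogram d X) \<le> e"
proof -
  have "dim_vec (v - histogram d X) = d" by (simp add: histogram_def)
  moreover have "(v - histogram d X) $ l = v $ l - histogram d X $ l" if "l < d" for l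
    using that by (simp add: histogram_def)
  ultimately show ?thesis
    unfolding linf_norm_def using assms d by (subst Max_le_iff) (auto simp: lessThan_empty_iff)
qed

lemma linf_accuracy:
  assumes X: "X \<in> one_hot_datasets n d"
    and H: "pairwise_independent d {..<2 ^ q} H" and \<Sigma>: "pairwise_independent d {-1, 1} \<Sigma>"
    and \<epsilon>_le: "\<epsilon> \<le> \<kappa> * sqrt (\<Lambda> * D)"
  shows "1 - \<gamma> \<le> measure_pmf.prob (noisy_sketch d H \<Sigma> q t L \<theta> X)
    {v. linf_norm (v - histogram d X) \<le> 4 * real n / 2 ^ q + C_noise * B}"
proof (rule prob_close[OF X H \<Sigma>], rule linf_norm_diff_le)
  fix v l
  assume v: "\<And>l. l < d \<Longrightarrow> \<bar>v $ l - histogram d X $ l\<bar> \<le> 144 * (1 + B) + N * B" and l: "l < d"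
  \<comment> \<open>The bound on \<epsilon> says that B \<ge> 1/\<kappa>, which turns the additive
    144 into a multiple of B.\<close>
  have "1 \<le> \<kappa> * B" using \<epsilon>_le \<epsilon> by (simp add: B_def pos_le_divide_eq)
  then have "144 * (1 + B) + N * B \<le> C_noise * B" by (simp add: C_noise_def algebra_simps)
  moreover have "0 \<le> 4 * real n / 2 ^ q" by simp
  ultimately show "\<bar>v $ l - histogram d X $ l\<bar> \<le> 4 * real n / 2 ^ q + C_noise * B"
    using v[OF l] by linarith
qed

lemma linf_bound_order:
  assumes \<epsilon>_le: "\<epsilon> \<le> \<kappa> * sqrt (\<Lambda> * D)"
  shows "4 * real n / 2 ^ q + C_noise * B \<le> (8 * (1 + \<kappa>) + C_noise) * B"
proof -
  have "1 \<le> \<kappa> * B" using \<epsilon>_le \<epsilon> by (simp add: B_def pos_le_divide_eq)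
  moreover have "4 * real n / 2 ^ q \<le> 8 * (1 + B)" using width_bounds(3) by simp
  ultimately show ?thesis by (simp add: algebra_simps)
qed

text \<open>\<open>R\<close> is the uniform error and \<open>T\<close> the threshold. R \<le> T
  makes every empty coordinate fall below the threshold, and 2 T + R^2 bounds the squared error per
  user.\<close>

lemma threshold_bounds:
  assumes \<epsilon>_le: "\<epsilon> \<le> \<kappa> * \<Lambda>"
  defines "R \<equiv> 144 * (1 + B) + N * B" and "T \<equiv> C_thr * (\<Lambda> * D / \<epsilon>)"
  shows "0 \<le> R" "R \<le> T" "2 * T + R\<^sup>2 \<le> C_sq * (\<Lambda>\<^sup>2 * D / \<epsilon>\<^sup>2)"
proof -
  show "0 \<le> R" using B_pos constants_pos(4) by (simp add: R_def)
  have \<kappa>: "1 \<le> \<kappa> * (\<Lambda> / \<epsilon>)" using \<epsilon>_le \<epsilon> by (simp add: pos_le_divide_eq)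
  have R: "R = 144 + (144 + N) * B" by (simp add: R_def algebra_simps)
  have Db: "1 \<le> D / b" and \<Lambda>a: "1 \<le> \<Lambda> / a" using D_ge b_pos \<Lambda>_ge a_pos by simp_all
  have "1 \<le> \<kappa> * (\<Lambda> / \<epsilon>) * (D / b)" using mult_mono[OF \<kappa> Db] \<kappa> by simp
  moreover have "144 * \<kappa> / b * (\<Lambda> * D / \<epsilon>) = 144 * (\<kappa> * (\<Lambda> / \<epsilon>) * (D / b))" by (simp add: mult_ac)
  ultimately have 1: "144 \<le> 144 * \<kappa> / b * (\<Lambda> * D / \<epsilon>)" by linarith
  have "B = (\<Lambda> * D / \<epsilon>) / sqrt (\<Lambda> * D)"
  proof -
    define s where "s = sqrt (\<Lambda> * D)"
    have s: "0 < s" "\<Lambda> * D = s * s" using \<Lambda>_pos D_pos by (auto simp: s_def)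
    show ?thesis unfolding B_def s_def[symmetric] s(2) using s(1) by simp
  qed
  also have "\<dots> \<le> (\<Lambda> * D / \<epsilon>) / sqrt (a * b)"
    using \<Lambda>D_ge(2) \<Lambda>_pos D_pos \<epsilon> a_pos b_pos by (intro divide_left_mono mult_pos_pos) auto
  finally have "(144 + N) * B \<le> (144 + N) * ((\<Lambda> * D / \<epsilon>) / sqrt (a * b))"
    using constants_pos(4) by (intro mult_left_mono) auto
  moreover have "T = 144 * \<kappa> / b * (\<Lambda> * D / \<epsilon>) + (144 + N) * ((\<Lambda> * D / \<epsilon>) / sqrt (a * b))"
    unfolding T_def C_thr_def distrib_right[of "144 * \<kappa> / b"] by (simp add: mult_ac)
  ultimately show "R \<le> T" using 1 unfolding R by linarith
  \<comment> \<open>A factor that is at least 1 raises the threshold, of order \<Lambda> D /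
    \<epsilon>, to the order \<Lambda>^2 D / \<epsilon>^2 of the target.\<close>
  have "T \<le> T * (\<kappa> * (\<Lambda> / \<epsilon>))"
    using mult_left_mono[OF \<kappa>, of T] constants_pos(6) \<Lambda>_pos D_pos \<epsilon> by (simp add: T_def)
  also have "\<dots> = C_thr * \<kappa> * (\<Lambda>\<^sup>2 * D / \<epsilon>\<^sup>2)" by (simp add: T_def power2_eq_square)
  finally have T: "2 * T \<le> 2 * C_thr * \<kappa> * (\<Lambda>\<^sup>2 * D / \<epsilon>\<^sup>2)" by simp
  have "1 \<le> (\<kappa> * (\<Lambda> / \<epsilon>))\<^sup>2 * (D / b)" using mult_mono[OF one_le_power[OF \<kappa>, of 2] Db] by simp
  then have "2 * 144\<^sup>2 * 1 \<le> 2 * 144\<^sup>2 * ((\<kappa> * (\<Lambda> / \<epsilon>))\<^sup>2 * (D / b))"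
    by (intro mult_left_mono) auto
  moreover have "2 * 144\<^sup>2 * \<kappa>\<^sup>2 / b * (\<Lambda>\<^sup>2 * D / \<epsilon>\<^sup>2) = 2 * 144\<^sup>2 * ((\<kappa> * (\<Lambda> / \<epsilon>))\<^sup>2 * (D / b))"
    by (simp add: power_mult_distrib power_divide mult_ac)
  ultimately have 2: "2 * 144\<^sup>2 \<le> 2 * 144\<^sup>2 * \<kappa>\<^sup>2 / b * (\<Lambda>\<^sup>2 * D / \<epsilon>\<^sup>2)"
    by (simp only: mult_1_right)
  have "B\<^sup>2 = \<Lambda> * D / \<epsilon>\<^sup>2" using \<Lambda>_pos D_pos by (simp add: B_def power_divide)
  also have "\<dots> \<le> \<Lambda> * D / \<epsilon>\<^sup>2 * (\<Lambda> / a)"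
    using mult_left_mono[OF \<Lambda>a, of "\<Lambda> * D / \<epsilon>\<^sup>2"] \<Lambda>_pos D_pos by simp
  also have "\<dots> = 1 / a * (\<Lambda>\<^sup>2 * D / \<epsilon>\<^sup>2)" by (simp add: power2_eq_square mult_ac)
  finally have B_sq: "2 * (144 + N)\<^sup>2 * B\<^sup>2 \<le> 2 * (144 + N)\<^sup>2 * (1 / a * (\<Lambda>\<^sup>2 * D / \<epsilon>\<^sup>2))"
    by (intro mult_left_mono) auto
  have R_sq: "R\<^sup>2 \<le> 2 * 144\<^sup>2 + 2 * (144 + N)\<^sup>2 * B\<^sup>2"
  proof -
    have "(x + y)\<^sup>2 \<le> 2 * x\<^sup>2 + 2 * y\<^sup>2" for x y :: real
      using sum_squares_bound[of x y] by (simp add: power2_sum)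
    from this[of 144 "(144 + N) * B"] show ?thesis unfolding R by (simp only: power_mult_distrib mult.assoc)
  qed
  show "2 * T + R\<^sup>2 \<le> C_sq * (\<Lambda>\<^sup>2 * D / \<epsilon>\<^sup>2)"
  proof -
    have "(x + (y + z / a)) * Z = x * Z + (y * Z + z * (1 / a * Z))" for x y z Z :: real
      by (simp add: algebra_simps)
    then show ?thesis
      unfolding C_sq_def using T 2 B_sq R_sq by (simp only:)
  qed
qed

text \<open>Zeroing a coordinate costs \<open>\<mu>\<^sub>l\<^sup>2 \<le> 2 T \<mu>\<^sub>l\<close> rather than \<open>4 T\<^sup>2\<close>, and the \<open>\<mu>\<^sub>l\<close> sum to \<open>n\<close>. This is what keeps
  the bound linear in \<open>ln (1 / \<delta>)\<close>.\<close>

lemma l2_accuracy: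
  assumes X: "X \<in> one_hot_datasets n d"
    and H: "pairwise_independent d {..<2 ^ q} H" and \<Sigma>: "pairwise_independent d {-1, 1} \<Sigma>"
    and \<epsilon>_le: "\<epsilon> \<le> \<kappa> * \<Lambda>"
  shows "1 - \<gamma> \<le> measure_pmf.prob (noisy_sketch d H \<Sigma> q t L \<theta> X)
    {v. l2_norm_sq (zero_small (C_thr * (\<Lambda> * D / \<epsilon>)) v - histogram d X)
      \<le> C_sq * (real n * \<Lambda>\<^sup>2 * D / \<epsilon>\<^sup>2)}"
proof (rule prob_close[OF X H \<Sigma>])
  fix v :: "real vec"
  define R where "R = 144 * (1 + B) + N * B"
  define T where "T = C_thr * (\<Lambda> * D / \<epsilon>)"
  define \<mu> where "\<mu> l = histogram d X $ l" for l
  assume dim: "dim_vec v = d" and v: "\<And>l. l < d \<Longrightarrow> \<bar>v $ l - histogram d X $ l\<bar> \<le> 144 * (1 + B) + N * B"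
  note RT = threshold_bounds[OF \<epsilon>_le, folded R_def T_def]
  have len: "length X = n" using X by (auto simp: one_hot_datasets_def)
  have "\<exists>l. X ! i = unit_vec d l \<and> l < d" if "i < n" for i
  proof -
    have "X ! i \<in> set X" using that len by simp
    then have "X ! i \<in> unit_vec d ` {..<d}" using X by (auto simp: one_hot_datasets_def)
    then show ?thesis by auto
  qed
  then obtain lab where lab: "\<And>i. i < n \<Longrightarrow> X ! i = unit_vec d (lab i) \<and> lab i < d" by metis
  have \<mu>: "\<mu> l = real (card {i. i < n \<and> lab i = l})" if "l < d" for l
    using histogram_labels[OF len lab that] by (simp add: \<mu>_def Int_def)
  have total: "(\<Sum>l<d. \<mu> l) = real n"
  proof -
    have "(\<Sum>l<d. \<mu> l) = (\<Sum>l<d. \<Sum>i<n. of_bool (lab i = l))"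
      using histogram_labels[OF len lab] by (intro sum.cong) (auto simp: \<mu>_def)
    also have "\<dots> = (\<Sum>i<n. \<Sum>l<d. of_bool (lab i = l))" by (rule sum.swap)
    also have "\<dots> = (\<Sum>i<n. 1)"
    proof (rule sum.cong[OF refl])
      fix i assume "i \<in> {..<n}"
      then have "(\<Sum>l<d. of_bool (lab i = l)) = (\<Sum>l\<in>{lab i}. of_bool (lab i = l) :: real)"
        using lab by (intro sum.mono_neutral_right) auto
      then show "(\<Sum>l<d. of_bool (lab i = l)) = (1 :: real)" by simp
    qed
    finally show ?thesis by simp
  qed
  have coordinate: "((zero_small T v - histogram d X) $ l)\<^sup>2 \<le> (2 * T + R\<^sup>2) * \<mu> l" if l: "l < d" for l
  proof -
    have vl: "\<bar>v $ l - \<mu> l\<bar> \<le> R" using v[OF l] by (simp add: R_def \<mu>_def)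
    have \<mu>0: "0 \<le> \<mu> l" using \<mu>[OF l] by simp
    have diff: "(zero_small T v - histogram d X) $ l = (if \<bar>v $ l\<bar> \<le> T then 0 else v $ l) - \<mu> l"
      using l dim by (simp add: zero_small_def histogram_def \<mu>_def)
    show ?thesis
    proof (cases "\<bar>v $ l\<bar> \<le> T")
      case True
      then have "\<mu> l \<le> 2 * T" using vl RT(2) by linarith
      then have "\<mu> l * \<mu> l \<le> (2 * T + R\<^sup>2) * \<mu> l" using \<mu>0 by (intro mult_right_mono) (auto simp: add_increasing2)
      then show ?thesis using True by (simp add: diff power2_eq_square)
    next
      case False
      \<comment> \<open>A coordinate that survives the threshold cannot be empty, because R \<le> T.
        Hence its count is at least 1, and the error R^2 can be charged to the users who hold that
        label.\<close>
      then have "\<mu> l \<noteq> 0" using vl RT(2) by auto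
      then have "1 \<le> \<mu> l" using \<mu>[OF l] by (auto simp: Suc_le_eq card_gt_0_iff)
      have "(v $ l - \<mu> l)\<^sup>2 \<le> R\<^sup>2" using vl RT(1) by (simp add: abs_le_square_iff[symmetric])
      also have "\<dots> \<le> 2 * T + R\<^sup>2" using RT(1,2) by simp
      also have "\<dots> \<le> (2 * T + R\<^sup>2) * \<mu> l"
        using mult_left_mono[OF \<open>1 \<le> \<mu> l\<close>, of "2 * T + R\<^sup>2"] RT(1,2) by simp
      finally show ?thesis using False by (simp add: diff)
    qed
  qed
  have "l2_norm_sq (zero_small T v - histogram d X) = (\<Sum>l<d. ((zero_small T v - histogram d X) $ l)\<^sup>2)"
    by (simp add: l2_norm_sq_def histogram_def)
  also have "\<dots> \<le> (\<Sum>l<d. (2 * T + R\<^sup>2) * \<mu> l)" using coordinate by (intro sum_mono) auto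
  also have "\<dots> = (2 * T + R\<^sup>2) * real n" by (simp add: total flip: sum_distrib_left)
  also have "\<dots> \<le> C_sq * (\<Lambda>\<^sup>2 * D / \<epsilon>\<^sup>2) * real n" using RT(3) by (intro mult_right_mono) auto
  also have "\<dots> = C_sq * (real n * \<Lambda>\<^sup>2 * D / \<epsilon>\<^sup>2)" by simp
  finally show "l2_norm_sq (zero_small (C_thr * (\<Lambda> * D / \<epsilon>)) v - histogram d X)
      \<le> C_sq * (real n * \<Lambda>\<^sup>2 * D / \<epsilon>\<^sup>2)" by (simp add: T_def)
qed

end

text \<open>All constants depend only on the fixed thresholds, \<kappa> and the two constants around
  \<theta>. Each upper bound on \<epsilon> stands before a claim in which a lower-order term is
  absorbed: \<epsilon>^2 / ln (1/\<delta>) in approximate privacy, and the constant part of the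
  error in the two accuracy claims.\<close>

theorem theoremA3:
  fixes \<gamma>\<^sub>0 \<delta>\<^sub>0 \<kappa> c\<^sub>1 c\<^sub>2 :: real
  assumes "0 < \<gamma>\<^sub>0" "\<gamma>\<^sub>0 < 1" "0 < \<delta>\<^sub>0" "\<delta>\<^sub>0 < 1" "0 < \<kappa>" "0 < c\<^sub>1" "0 < c\<^sub>2"
  shows "\<exists>C_dp > 0. \<exists>C_rdp > 0. \<exists>C_comm > 0. \<exists>p::nat. \<exists>C_noise > 0. \<exists>C_err > 0.
    \<exists>C_thr > 0. \<exists>C_sq > 0.
    \<forall>(n::nat) (d::nat) (\<epsilon>::real) (\<delta>::real) (\<gamma>::real) (q::nat) (w::nat) (t::nat) (L::nat)
      (\<theta>::real) (H :: (nat \<Rightarrow> nat) pmf) (\<Sigma> :: (nat \<Rightarrow> real) pmf).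
      1 \<le> n \<and> 1 \<le> d \<and> 0 < \<epsilon> \<and> 0 < \<delta> \<and> \<delta> \<le> \<delta>\<^sub>0 \<and> 0 < \<gamma> \<and> \<gamma> \<le> \<gamma>\<^sub>0 \<and>
      t = nat \<lceil>ln (real d / \<gamma>)\<rceil> \<and>
      rounds_to_power_of_two (target_width n d \<epsilon> \<delta> \<gamma>) q \<and> w = 2 ^ q \<and>
      L = nat \<lceil>noise_ratio n w t \<epsilon> \<delta>\<rceil> + 1 \<and>
      c\<^sub>1 * min (1 / 4) (sqrt (noise_ratio n w t \<epsilon> \<delta>)) \<le> \<theta> \<and>
      \<theta> \<le> c\<^sub>2 * min (1 / 4) (sqrt (noise_ratio n w t \<epsilon> \<delta>)) \<and> \<theta> \<le> 1 / 4 \<and>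
      pairwise_independent d {..<w} H \<and> pairwise_independent d {-1, 1} \<Sigma>
      \<longrightarrow>
      (let M = noisy_sketch d H \<Sigma> q t L \<theta>;
           D = one_hot_datasets n d;
           B = sqrt (ln (real d / \<gamma>) * ln (1 / \<delta>)) / \<epsilon>
       in
         (\<epsilon> \<le> \<kappa> * ln (1 / \<delta>) \<longrightarrow> differentially_private D M (C_dp * \<epsilon>) \<delta>) \<and>
         (\<forall>\<alpha>>1. renyi_differentially_private D M \<alpha> (C_rdp * (\<epsilon>\<^sup>2 * \<alpha> / ln (1 / \<delta>)))) \<and>
         communication_bits n w t L
           \<le> C_comm * log_factor n d \<epsilon> \<gamma> ^ p * min (real n * \<epsilon> * ln (1 / \<gamma>)) (real n) \<and>
         (\<epsilon> \<le> \<kappa> * sqrt (ln (real d / \<gamma>) * ln (1 / \<delta>)) \<longrightarrow>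
           (\<forall>X\<in>D. measure_pmf.prob (M X)
              {v. linf_norm (v - histogram d X) \<le> 4 * real n / real w + C_noise * B} \<ge> 1 - \<gamma>) \<and>
           4 * real n / real w + C_noise * B \<le> C_err * B) \<and>
         (\<epsilon> \<le> \<kappa> * ln (real d / \<gamma>) \<longrightarrow>
           (\<forall>X\<in>D. measure_pmf.prob (M X)
              {v. l2_norm_sq
                    (zero_small (C_thr * (ln (real d / \<gamma>) * ln (1 / \<delta>) / \<epsilon>)) v - histogram d X)
                  \<le> C_sq * (real n * (ln (real d / \<gamma>))\<^sup>2 * ln (1 / \<delta>) / \<epsilon>\<^sup>2)} \<ge> 1 - \<gamma>)))"
proof -
  interpret C: sketch_constants \<gamma>\<^sub>0 \<delta>\<^sub>0 \<kappa> c\<^sub>1 c\<^sub>2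
    using assms by unfold_locales
  have comm_pos: "0 < C.C_width * ((ln (2 * C.C_count) + 2) / ln 2)"
    using C.constants_pos by (intro mult_pos_pos divide_pos_pos add_nonneg_pos) auto
  \<comment> \<open>The first witness is the coefficient of \<epsilon> at the order 1 + ln
    (1/\<delta>) / \<epsilon>. The summand 8 (1 + \<kappa>) bounds 4 n / w \<le> 8 (1 + B) by a
    multiple of B, and the exponent 2 counts one logarithmic factor for t and one for the bits of an
    entry.\<close>
  show ?thesis
  proof (rule exI[of _ "C.C_rdp * \<kappa> + C.C_rdp + 1"], rule conjI, use C.constants_pos assms in \<open>simp add: add_pos_pos\<close>,
      rule exI[of _ C.C_rdp], rule conjI, rule C.constants_pos,
      rule exI[of _ "C.C_width * ((ln (2 * C.C_count) + 2) / ln 2)"], rule conjI, rule comm_pos, rule exI[of _ 2],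
      rule exI[of _ C.C_noise], rule conjI, rule C.constants_pos,
      rule exI[of _ "8 * (1 + \<kappa>) + C.C_noise"], rule conjI, use C.constants_pos assms in \<open>simp add: add_pos_pos\<close>,
      rule exI[of _ C.C_thr], rule conjI, rule C.constants_pos,
      rule exI[of _ C.C_sq], rule conjI, rule C.constants_pos, intro allI impI, elim conjE)
    fix n d q w t L :: nat and \<epsilon> \<delta> \<gamma> \<theta> :: real and H :: "(nat \<Rightarrow> nat) pmf" and \<Sigma> :: "(nat \<Rightarrow> real) pmf"
    assume w: "w = 2 ^ q" and H: "pairwise_independent d {..<w} H" and \<Sigma>: "pairwise_independent d {-1, 1} \<Sigma>"
      and params: "1 \<le> n" "1 \<le> d" "0 < \<epsilon>" "0 < \<delta>" "\<delta> \<le> \<delta>\<^sub>0" "0 < \<gamma>" "\<gamma> \<le> \<gamma>\<^sub>0"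
        "t = nat \<lceil>ln (real d / \<gamma>)\<rceil>" "rounds_to_power_of_two (target_width n d \<epsilon> \<delta> \<gamma>) q"
        "L = nat \<lceil>noise_ratio n w t \<epsilon> \<delta>\<rceil> + 1"
        "c\<^sub>1 * min (1 / 4) (sqrt (noise_ratio n w t \<epsilon> \<delta>)) \<le> \<theta>"
        "\<theta> \<le> c\<^sub>2 * min (1 / 4) (sqrt (noise_ratio n w t \<epsilon> \<delta>))" "\<theta> \<le> 1 / 4"
    interpret P: sketch_parameters \<gamma>\<^sub>0 \<delta>\<^sub>0 \<kappa> c\<^sub>1 c\<^sub>2 \<epsilon> \<delta> \<gamma> \<theta> n d q t L
      using params unfolding w by unfold_locales
    have H': "pairwise_independent d {..<2 ^ q} H" using H unfolding w .
    note eqs = P.\<Lambda>_def[symmetric] P.D_def[symmetric] P.B_def[symmetric]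
    show "let M = noisy_sketch d H \<Sigma> q t L \<theta>;
           D = one_hot_datasets n d;
           B = sqrt (ln (real d / \<gamma>) * ln (1 / \<delta>)) / \<epsilon>
       in
         (\<epsilon> \<le> \<kappa> * ln (1 / \<delta>) \<longrightarrow> differentially_private D M ((C.C_rdp * \<kappa> + C.C_rdp + 1) * \<epsilon>) \<delta>) \<and>
         (\<forall>\<alpha>>1. renyi_differentially_private D M \<alpha> (C.C_rdp * (\<epsilon>\<^sup>2 * \<alpha> / ln (1 / \<delta>)))) \<and>
         communication_bits n w t L
           \<le> C.C_width * ((ln (2 * C.C_count) + 2) / ln 2) * log_factor n d \<epsilon> \<gamma> ^ 2
              * min (real n * \<epsilon> * ln (1 / \<gamma>)) (real n) \<and>
         (\<epsilon> \<le> \<kappa> * sqrt (ln (real d / \<gamma>) * ln (1 / \<delta>)) \<longrightarrow>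
           (\<forall>X\<in>D. measure_pmf.prob (M X)
              {v. linf_norm (v - histogram d X) \<le> 4 * real n / real w + C.C_noise * B} \<ge> 1 - \<gamma>) \<and>
           4 * real n / real w + C.C_noise * B \<le> (8 * (1 + \<kappa>) + C.C_noise) * B) \<and>
         (\<epsilon> \<le> \<kappa> * ln (real d / \<gamma>) \<longrightarrow>
           (\<forall>X\<in>D. measure_pmf.prob (M X)
              {v. l2_norm_sq
                    (zero_small (C.C_thr * (ln (real d / \<gamma>) * ln (1 / \<delta>) / \<epsilon>)) v - histogram d X)
                  \<le> C.C_sq * (real n * (ln (real d / \<gamma>))\<^sup>2 * ln (1 / \<delta>) / \<epsilon>\<^sup>2)} \<ge> 1 - \<gamma>))"
      unfolding Let_def w eqs of_nat_power of_nat_numeral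
      using P.approximate_privacy[OF H' \<Sigma>] P.renyi_privacy[OF H' \<Sigma>] P.communication_le
        P.linf_accuracy[OF _ H' \<Sigma>] P.linf_bound_order P.l2_accuracy[OF _ H' \<Sigma>]
      by blast
  qed
qed

end
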